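(* Let $n\ge 3$, let $Q$ be the reduced quiver of the GL$_2$-dimer of an arbitrary triangulation of the convex $n$-gon, and let $Q_F(n)$ be the reduced quiver of the GL$_2$-dimer of a fan triangulation of the $n$-gon. Let $e_{b'}$ and $e_b$ be the sums of the boundary idempotents of $\Lambda_Q$ and $\Lambda_{Q_F(n)}$, respectively. Then there is an algebra isomorphism $$e_{b'}\Lambda_Qe_{b'}\cong e_b\Lambda_{Q_F(n)}e_b.$$
   Context: Paths are composed from left to right. The dimer algebra of a dimer model with boundary $Q$ is $\Lambda_Q=\mathbb{C}Q/\langle\partial W\rangle$, where $\partial W$ consists of the relations $p_1\cdots p_k=q_1\cdots q_l$, one for each internal arrow $\alpha$ lying on the anticlockwise face boundary $\alpha p_1\cdots p_k$ and the clockwise face boundary $\alpha q_1\cdots q_l$; boundary vertices are those incident with arrows lying in only one face. A fan triangulation is one whose diagonals all share a common polygon vertex. GL$_2$-dimer quiver: for a triangulation $T$ of a convex $n$-gon $P$, subdivide each triangle of $T$ by the midlines into $4$ small triangles; put a black node at the midpoint of each half-side of each triangle and in each downward (middle) small triangle, and a white node in each of the three upward small triangles; join nodes of different colour lying in the same small triangle or in small triangles sharing a side. The quiver has a vertex for each component of the complement of this graph in $P$ and an arrow across each edge, oriented with the white endpoint on its left; white nodes give anticlockwise faces, black nodes of degree $\ge 2$ clockwise faces; 2-cycles of internal arrows are removed via the relations (reduced quiver). *)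

theory Defs
  imports Complex_Main "HOL-Algebra.QuotRing"
begin

text \<open>A dimer model (with boundary) is given by a finite quiver (vertex set, arrow set,
  source and target maps) together with a set of anticlockwise faces and a set of
  clockwise faces, each face being given as a cyclic list of arrows.
  Paths are composed from left to right.\<close>

record ('v, 'a) dimer =
  dV :: "'v set"
  dA :: "'a set"
  dsrc :: "'a \<Rightarrow> 'v"
  dtgt :: "'a \<Rightarrow> 'v"
  dFp :: "'a list set"   \<comment> \<open>anticlockwise faces\<close>
  dFm :: "'a list set"   \<comment> \<open>clockwise faces\<close>

text \<open>A path is a pair (start vertex, list of arrows); trivial paths have no arrows.\<close>

definition pend :: "('a \<Rightarrow> 'v) \<Rightarrow> 'v \<times> 'a list \<Rightarrow> 'v" where
  "pend tgt p = (if snd p = [] then fst p else tgt (last (snd p)))"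

definition qpaths :: "('v, 'a) dimer \<Rightarrow> ('v \<times> 'a list) set" where
  "qpaths D = {(v, as). v \<in> dV D \<and> set as \<subseteq> dA D \<and>
      (as \<noteq> [] \<longrightarrow> dsrc D (hd as) = v) \<and>
      (\<forall>i. Suc i < length as \<longrightarrow> dtgt D (as ! i) = dsrc D (as ! Suc i))}"

definition path_algebra :: "('v, 'a) dimer \<Rightarrow> ('v \<times> 'a list \<Rightarrow> complex) ring" where
  "path_algebra D =
    \<lparr>carrier = {f. finite {p. f p \<noteq> 0} \<and> (\<forall>p. f p \<noteq> 0 \<longrightarrow> p \<in> qpaths D)},
     mult = (\<lambda>f g p. \<Sum>(p1, p2) \<in> {(p1, p2). f p1 \<noteq> 0 \<and> g p2 \<noteq> 0 \<and>
                pend (dtgt D) p1 = fst p2 \<and> (fst p1, snd p1 @ snd p2) = p}. f p1 * g p2),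
     one = (\<lambda>p. if snd p = [] \<and> fst p \<in> dV D then 1 else 0),
     zero = (\<lambda>p. 0),
     add = (\<lambda>f g p. f p + g p)\<rparr>"

definition pbasis :: "'v \<times> 'a list \<Rightarrow> ('v \<times> 'a list \<Rightarrow> complex)" where
  "pbasis p = (\<lambda>q. if q = p then 1 else 0)"

text \<open>The relations dW: for each internal arrow alpha lying on the anticlockwise face
  alpha p1...pk and on the clockwise face alpha q1...ql, the relation p1...pk = q1...ql.\<close>

definition dimer_rels :: "('v, 'a) dimer \<Rightarrow> ('v \<times> 'a list \<Rightarrow> complex) set" where
  "dimer_rels D = {(\<lambda>q. pbasis (dtgt D \<alpha>, ys @ xs) q - pbasis (dtgt D \<alpha>, vs @ us) q) | \<alpha> xs ys us vs.
      xs @ \<alpha> # ys \<in> dFp D \<and> us @ \<alpha> # vs \<in> dFm D}"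

definition dimer_ideal :: "('v, 'a) dimer \<Rightarrow> ('v \<times> 'a list \<Rightarrow> complex) set" where
  "dimer_ideal D = genideal (path_algebra D) (dimer_rels D)"

definition dimer_algebra :: "('v, 'a) dimer \<Rightarrow> ('v \<times> 'a list \<Rightarrow> complex) set ring" where
  "dimer_algebra D = path_algebra D Quot dimer_ideal D"

definition boundary_vertices :: "('v, 'a) dimer \<Rightarrow> 'v set" where
  "boundary_vertices D = {v \<in> dV D. \<exists>\<alpha> \<in> dA D. (dsrc D \<alpha> = v \<or> dtgt D \<alpha> = v) \<and>
      card {F \<in> dFp D \<union> dFm D. \<alpha> \<in> set F} = 1}"

definition boundary_idem :: "('v, 'a) dimer \<Rightarrow> ('v \<times> 'a list \<Rightarrow> complex) set" where
  "boundary_idem D = dimer_ideal D +>\<^bsub>path_algebra D\<^esub>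
      (\<lambda>p. if snd p = [] \<and> fst p \<in> boundary_vertices D then 1 else 0)"

definition corner_ring :: "('a, 'b) ring_scheme \<Rightarrow> 'a \<Rightarrow> 'a ring" where
  "corner_ring R e =
    \<lparr>carrier = {e \<otimes>\<^bsub>R\<^esub> x \<otimes>\<^bsub>R\<^esub> e | x. x \<in> carrier R},
     mult = mult R, one = e, zero = zero R, add = add R\<rparr>"

definition boundary_algebra :: "('v, 'a) dimer \<Rightarrow> ('v \<times> 'a list \<Rightarrow> complex) set ring" where
  "boundary_algebra D = corner_ring (dimer_algebra D) (boundary_idem D)"

definition qsmult :: "('p \<Rightarrow> complex) set \<Rightarrow> complex \<Rightarrow> ('p \<Rightarrow> complex) set \<Rightarrow> ('p \<Rightarrow> complex) set" where
  "qsmult I c X = {(\<lambda>p. c * f p + g p) | f g. f \<in> X \<and> g \<in> I}"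

definition boundary_algebras_isomorphic :: "('v, 'a) dimer \<Rightarrow> ('w, 'b) dimer \<Rightarrow> bool" where
  "boundary_algebras_isomorphic D1 D2 =
    (\<exists>\<phi>. \<phi> \<in> ring_iso (boundary_algebra D1) (boundary_algebra D2) \<and>
         (\<forall>c X. X \<in> carrier (boundary_algebra D1) \<longrightarrow>
             \<phi> (qsmult (dimer_ideal D1) c X) = qsmult (dimer_ideal D2) c (\<phi> X)))"

text \<open>Polygon vertices 0, ..., n-1 in anticlockwise order.\<close>

definition is_diagonal :: "nat \<Rightarrow> nat set \<Rightarrow> bool" where
  "is_diagonal n d = (\<exists>i j. d = {i, j} \<and> i < j \<and> j < n \<and> j \<noteq> Suc i \<and> \<not> (i = 0 \<and> j = n - 1))"

definition crosses :: "nat set \<Rightarrow> nat set \<Rightarrow> bool" where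
  "crosses d1 d2 = (\<exists>a b c d. ((d1 = {a, b} \<and> d2 = {c, d}) \<or> (d1 = {c, d} \<and> d2 = {a, b})) \<and>
                        a < c \<and> c < b \<and> b < d)"

definition triangulation :: "nat \<Rightarrow> nat set set \<Rightarrow> bool" where
  "triangulation n T = ((\<forall>d \<in> T. is_diagonal n d) \<and> (\<forall>d1 \<in> T. \<forall>d2 \<in> T. \<not> crosses d1 d2) \<and>
      (\<forall>d. is_diagonal n d \<and> d \<notin> T \<longrightarrow> (\<exists>d' \<in> T. crosses d d')))"

definition fan_triangulation :: "nat \<Rightarrow> nat set set \<Rightarrow> bool" where
  "fan_triangulation n T = (triangulation n T \<and> (\<exists>v < n. \<forall>d \<in> T. v \<in> d))"

definition sides :: "nat \<Rightarrow> nat set set \<Rightarrow> nat set set" where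
  "sides n T = {{i, Suc i mod n} | i. i < n} \<union> T"

definition triangles :: "nat \<Rightarrow> nat set set \<Rightarrow> nat set set" where
  "triangles n T = {{a, b, c} | a b c. a < b \<and> b < c \<and> c < n \<and>
      {a, b} \<in> sides n T \<and> {b, c} \<in> sides n T \<and> {a, c} \<in> sides n T}"

datatype gl2_vertex = Corner nat | Side "nat set"
datatype gl2_arrow = Alpha nat | Beta nat | Gam nat nat nat

text \<open>rk n x y: position of y in the anticlockwise order of polygon vertices starting at x.\<close>

definition rk :: "nat \<Rightarrow> nat \<Rightarrow> nat \<Rightarrow> nat" where
  "rk n x y = (y + n - x) mod n"

definition gl2_src :: "nat \<Rightarrow> gl2_arrow \<Rightarrow> gl2_vertex" where
  "gl2_src n a = (case a of Alpha i \<Rightarrow> Corner i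
                          | Beta i \<Rightarrow> Side {(i + n - 1) mod n, i}
                          | Gam x y z \<Rightarrow> Side {x, y})"

definition gl2_tgt :: "nat \<Rightarrow> gl2_arrow \<Rightarrow> gl2_vertex" where
  "gl2_tgt n a = (case a of Alpha i \<Rightarrow> Side {i, Suc i mod n}
                          | Beta i \<Rightarrow> Corner i
                          | Gam x y z \<Rightarrow> Side {x, z})"

definition nbrs :: "nat \<Rightarrow> nat set set \<Rightarrow> nat \<Rightarrow> nat list" where
  "nbrs n T v = map (\<lambda>r. (v + r) mod n)
      (sorted_list_of_set {r. 0 < r \<and> r < n \<and> {v, (v + r) mod n} \<in> sides n T})"

definition white_face :: "nat \<Rightarrow> nat set set \<Rightarrow> nat \<Rightarrow> gl2_arrow list" where
  "white_face n T v = Alpha v # map (\<lambda>(y, z). Gam v y z) (zip (nbrs n T v) (tl (nbrs n T v))) @ [Beta v]"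

definition gl2_dimer :: "nat \<Rightarrow> nat set set \<Rightarrow> (gl2_vertex, gl2_arrow) dimer" where
  "gl2_dimer n T =
    \<lparr>dV = {Corner i | i. i < n} \<union> Side ` sides n T,
     dA = {Alpha i | i. i < n} \<union> {Beta i | i. i < n} \<union>
          {Gam x y z | x y z. {x, y, z} \<in> triangles n T \<and> card {x, y, z} = 3 \<and> rk n x y < rk n x z},
     dsrc = gl2_src n,
     dtgt = gl2_tgt n,
     dFp = {white_face n T v | v. v < n},
     dFm = {[Gam a b c, Gam c a b, Gam b c a] | a b c. a < b \<and> b < c \<and> {a, b, c} \<in> triangles n T}\<rparr>"

end

theory Submission
  imports Defs "HOL-Computational_Algebra.Polynomial"
begin

text \<open>Give the arrows \<open>Alpha i\<close>, \<open>Beta i\<close> weight 1 and \<open>Gam v y z\<close> the number of polygon edges from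
  \<open>y\<close> to \<open>z\<close> (the inscribed angle at \<open>v\<close> in the regular \<open>n\<close>-gon). Every face then has total weight
  \<open>n\<close>, so the weight of a path depends only on its class modulo the relations. Conversely, a path
  starting at a boundary vertex is determined, modulo the relations, by its end and its weight: it
  equals a power of the central face cycle times a normal form, which first follows the boundary of
  the polygon and then turns about a single polygon vertex, or only turns about the first one. The
  boundary algebra is therefore the algebra of matrices, indexed by boundary vertices, of polynomials
  supported on the weights that occur, and between boundary vertices the weights of the normal forms
  do not depend on the triangulation.\<close>

section \<open>Boundary algebras of graded dimer models\<close>

text \<open>In units of pi/n the angles of a triangle add up to n, and so do the interior angle n -
  2 of the regular polygon and the two boundary arrows at its vertex; this is where the weight of
  \<open>Gam\<close> comes from. No map between the two quivers is constructed and no flips are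
  performed: both boundary algebras are embedded in matrices over C[x], and the images are compared.
  The difficulty is injectivity: equal ends and equal weight must force congruence. For a start on
  the boundary this reduces to a local check, that a normal form followed by one arrow is again a
  power of the central cycle times a normal form. Of the three arrows of a triangle, two extend or
  rewrite the normal form without creating a cycle, and the third closes a black face and creates
  one. The rewriting rests on one identity: turning about one end of a side and then about the other
  is congruent to following the boundary between them, proved by splitting off the triangle on that
  side. The face cycles commute with all paths, so the powers can be collected in front.\<close>

fun walk :: "('v, 'a) dimer \<Rightarrow> 'v \<Rightarrow> 'a list \<Rightarrow> 'v \<Rightarrow> bool" where
  "walk D v [] w = (v \<in> dV D \<and> v = w)"
| "walk D v (a # as) w = (v \<in> dV D \<and> a \<in> dA D \<and> dsrc D a = v \<and> walk D (dtgt D a) as w)"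

lemma walk_append: "walk D v (as @ bs) w \<longleftrightarrow> (\<exists>u. walk D v as u \<and> walk D u bs w)"
proof (induction as arbitrary: v)
  case Nil
  show ?case by (cases bs) auto
qed auto

lemma walk_dV: "walk D v as w \<Longrightarrow> v \<in> dV D \<and> w \<in> dV D"
  by (induction as arbitrary: v) auto

lemma walk_pend: "walk D v as w \<Longrightarrow> pend (dtgt D) (v, as) = w"
  by (induction as arbitrary: v) (auto simp: pend_def split: if_splits)

lemma qpaths_Cons:
  "(v, a # as) \<in> qpaths D \<longleftrightarrow> v \<in> dV D \<and> a \<in> dA D \<and> dsrc D a = v \<and>
     (as \<noteq> [] \<longrightarrow> dsrc D (hd as) = dtgt D a) \<and> set as \<subseteq> dA D \<and>
     (\<forall>i. Suc i < length as \<longrightarrow> dtgt D (as ! i) = dsrc D (as ! Suc i))"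
proof -
  have "(\<forall>i. Suc i < length (a # as) \<longrightarrow> dtgt D ((a # as) ! i) = dsrc D ((a # as) ! Suc i)) \<longleftrightarrow>
     (as \<noteq> [] \<longrightarrow> dsrc D (hd as) = dtgt D a) \<and>
     (\<forall>i. Suc i < length as \<longrightarrow> dtgt D (as ! i) = dsrc D (as ! Suc i))" (is "?L = ?R")
  proof
    assume L: ?L
    have "dsrc D (hd as) = dtgt D a" if "as \<noteq> []"
      using L[rule_format, of 0] that by (simp add: hd_conv_nth)
    moreover have "dtgt D (as ! i) = dsrc D (as ! Suc i)" if "Suc i < length as" for i
      using L[rule_format, of "Suc i"] that by simp
    ultimately show ?R by blast
  next
    assume R: ?R
    show ?L
    proof (intro allI impI)
      fix i assume "Suc i < length (a # as)"
      with R show "dtgt D ((a # as) ! i) = dsrc D ((a # as) ! Suc i)"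
        by (cases i) (auto simp: hd_conv_nth)
    qed
  qed
  then show ?thesis by (auto simp: qpaths_def)
qed

text \<open>The hypothesis on targets bridges the two notions: \<open>walk\<close> tests membership
  in \<open>dV\<close> at every vertex that it visits, \<open>qpaths\<close> only at the
  start.\<close>

lemma qpaths_walk:
  assumes "dtgt D ` dA D \<subseteq> dV D"
  shows "(v, as) \<in> qpaths D \<longleftrightarrow> (\<exists>w. walk D v as w)"
proof (induction as arbitrary: v)
  case Nil
  show ?case by (auto simp: qpaths_def)
next
  case (Cons a as)
  have "(v, a # as) \<in> qpaths D \<longleftrightarrow> v \<in> dV D \<and> a \<in> dA D \<and> dsrc D a = v \<and> (dtgt D a, as) \<in> qpaths D"
    using assms by (auto simp: qpaths_Cons) (auto simp: qpaths_def)
  then show ?case by (simp add: Cons.IH)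
qed

text \<open>The combinatorial counterpart of the ideal, kept on bare arrow lists: the two sides of a
  relation have common ends, so a start vertex can be attached later. The contexts \<open>ls\<close>
  and \<open>rs\<close> are arbitrary lists; \<open>pcong_walk\<close> shows that walks are
  nevertheless preserved.\<close>

inductive pcong :: "('v, 'a) dimer \<Rightarrow> 'a list \<Rightarrow> 'a list \<Rightarrow> bool" for D where
  pc_refl: "pcong D as as"
| pc_sym: "pcong D as bs \<Longrightarrow> pcong D bs as"
| pc_trans [trans]: "pcong D as bs \<Longrightarrow> pcong D bs cs \<Longrightarrow> pcong D as cs"
| pc_rel: "xs @ \<alpha> # ys \<in> dFp D \<Longrightarrow> us @ \<alpha> # vs \<in> dFm D \<Longrightarrow>
     pcong D (ls @ ys @ xs @ rs) (ls @ vs @ us @ rs)"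

lemma pcong_ctx: "pcong D as bs \<Longrightarrow> pcong D (ls @ as @ rs) (ls @ bs @ rs)"
proof (induction rule: pcong.induct)
  case (pc_rel xs \<alpha> ys us vs ls' rs')
  then show ?case using pcong.pc_rel[OF pc_rel, of "ls @ ls'" "rs' @ rs"] by simp
qed (blast intro: pcong.intros)+

lemma pcong_append: "pcong D as bs \<Longrightarrow> pcong D as' bs' \<Longrightarrow> pcong D (as @ as') (bs @ bs')"
  using pcong_ctx[of D as bs "[]" as'] pcong_ctx[of D as' bs' bs "[]"]
  by (auto intro: pc_trans)

section \<open>Multiplication in the path algebra as a sum over cuts\<close>

lemma pa_mult:
  "(f \<otimes>\<^bsub>path_algebra D\<^esub> g) (v, as) =
    (\<Sum>k\<le>length as. f (v, take k as) * g (pend (dtgt D) (v, take k as), drop k as))"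
proof -
  \<comment> \<open>A factorisation of a path is a position at which it is cut, so the sum over
    pairs of paths becomes a finite sum over positions.\<close>
  let ?h = "\<lambda>k. ((v, take k as), (pend (dtgt D) (v, take k as), drop k as))"
  let ?K = "{k \<in> {..length as}. f (v, take k as) \<noteq> 0 \<and> g (pend (dtgt D) (v, take k as), drop k as) \<noteq> 0}"
  let ?P = "{(p1, p2). f p1 \<noteq> 0 \<and> g p2 \<noteq> 0 \<and>
                pend (dtgt D) p1 = fst p2 \<and> (fst p1, snd p1 @ snd p2) = (v, as)}"
  have inj: "inj_on ?h ?K"
  proof (rule inj_onI)
    fix j k assume "j \<in> ?K" "k \<in> ?K" "?h j = ?h k"
    then have "length (take j as) = length (take k as)" by simp
    with \<open>j \<in> ?K\<close> \<open>k \<in> ?K\<close> show "j = k" by simp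
  qed
  have img: "?P = ?h ` ?K"
  proof
    show "?P \<subseteq> ?h ` ?K"
    proof
      fix x assume x: "x \<in> ?P"
      obtain a b c d where xx: "x = ((a, b), (c, d))" by (metis surj_pair)
      have e: "a = v" "b @ d = as" "c = pend (dtgt D) (v, b)" using x xx by auto
      have "x = ?h (length b)" using e xx by auto
      moreover have "length b \<in> ?K" using x xx e by auto
      ultimately show "x \<in> ?h ` ?K" by blast
    qed
    show "?h ` ?K \<subseteq> ?P" by auto
  qed
  have "(f \<otimes>\<^bsub>path_algebra D\<^esub> g) (v, as) = (\<Sum>(p1, p2)\<in>?P. f p1 * g p2)"
    by (simp add: path_algebra_def)
  also have "\<dots> = (\<Sum>k\<in>?K. f (v, take k as) * g (pend (dtgt D) (v, take k as), drop k as))"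
    unfolding img by (subst sum.reindex[OF inj]) simp
  also have "\<dots> = (\<Sum>k\<le>length as. f (v, take k as) * g (pend (dtgt D) (v, take k as), drop k as))"
    by (rule sum.mono_neutral_left) auto
  finally show ?thesis .
qed

lemma pend_append: "pend t (pend t (v, as), bs) = pend t (v, as @ bs)"
  by (simp add: pend_def)

text \<open>Both bracketings are the sum over pairs of cuts j <= k of one path, taken in the two
  orders of summation.\<close>

lemma pa_assoc:
  "(f \<otimes>\<^bsub>path_algebra D\<^esub> g) \<otimes>\<^bsub>path_algebra D\<^esub> h = f \<otimes>\<^bsub>path_algebra D\<^esub> (g \<otimes>\<^bsub>path_algebra D\<^esub> h)"
proof (rule ext, safe)
  fix v as
  let ?w = "\<lambda>k. pend (dtgt D) (v, take k as)"
  let ?n = "length as"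
  let ?F = "\<lambda>j k. f (v, take j as) * g (?w j, take (k - j) (drop j as)) * h (?w k, drop k as)"
  have w: "pend (dtgt D) (?w j, take (k - j) (drop j as)) = ?w k" if "j \<le> k" for j k
    unfolding pend_append using that by (metis le_add_diff_inverse take_add)
  have "((f \<otimes>\<^bsub>path_algebra D\<^esub> g) \<otimes>\<^bsub>path_algebra D\<^esub> h) (v, as) = (\<Sum>k\<le>?n. \<Sum>j\<le>k. ?F j k)"
    unfolding pa_mult sum_distrib_right
    by (intro sum.cong) (auto simp: take_take min_def take_drop)
  also have "\<dots> = (\<Sum>j\<le>?n. \<Sum>k\<in>{j..?n}. ?F j k)"
    unfolding sum.Sigma[OF finite_atMost ballI[OF finite_atMost]]
      sum.Sigma[OF finite_atMost ballI[OF finite_atLeastAtMost]]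
    by (rule sum.reindex_bij_witness[of _ prod.swap prod.swap]) auto
  also have "\<dots> = (\<Sum>j\<le>?n. \<Sum>i\<le>?n - j. ?F j (j + i))"
  proof (rule sum.cong[OF refl])
    fix j assume "j \<in> {..?n}"
    then show "(\<Sum>k\<in>{j..?n}. ?F j k) = (\<Sum>i\<le>?n - j. ?F j (j + i))"
      by (intro sum.reindex_bij_witness[of _ "\<lambda>i. j + i" "\<lambda>k. k - j"]) auto
  qed
  also have "\<dots> = (f \<otimes>\<^bsub>path_algebra D\<^esub> (g \<otimes>\<^bsub>path_algebra D\<^esub> h)) (v, as)"
    unfolding pa_mult sum_distrib_left
    using w by (intro sum.cong refl) (auto simp: mult.assoc pend_append take_add ac_simps)
  finally show "((f \<otimes>\<^bsub>path_algebra D\<^esub> g) \<otimes>\<^bsub>path_algebra D\<^esub> h) (v, as) =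
     (f \<otimes>\<^bsub>path_algebra D\<^esub> (g \<otimes>\<^bsub>path_algebra D\<^esub> h)) (v, as)" .
qed

lemma pa_mult_diff_right:
  "f \<otimes>\<^bsub>path_algebra D\<^esub> (\<lambda>q. g q - h q) = (\<lambda>q. (f \<otimes>\<^bsub>path_algebra D\<^esub> g) q - (f \<otimes>\<^bsub>path_algebra D\<^esub> h) q)"
  by (rule ext, safe) (simp add: pa_mult sum_subtractf right_diff_distrib)

lemma pa_mult_diff_left:
  "(\<lambda>q. g q - h q) \<otimes>\<^bsub>path_algebra D\<^esub> f = (\<lambda>q. (g \<otimes>\<^bsub>path_algebra D\<^esub> f) q - (h \<otimes>\<^bsub>path_algebra D\<^esub> f) q)"
  by (rule ext, safe) (simp add: pa_mult sum_subtractf left_diff_distrib)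

lemma pa_simps:
  "\<zero>\<^bsub>path_algebra D\<^esub> = (\<lambda>p. 0)"
  "\<one>\<^bsub>path_algebra D\<^esub> = (\<lambda>p. if snd p = [] \<and> fst p \<in> dV D then 1 else 0)"
  "f \<oplus>\<^bsub>path_algebra D\<^esub> g = (\<lambda>p. f p + g p)"
  "f \<in> carrier (path_algebra D) \<longleftrightarrow> finite {p. f p \<noteq> 0} \<and> (\<forall>p. f p \<noteq> 0 \<longrightarrow> p \<in> qpaths D)"
  by (auto simp: path_algebra_def)

lemma pbasis_mult:
  "pbasis (v, as) \<otimes>\<^bsub>path_algebra D\<^esub> pbasis (w, bs) =
     (if pend (dtgt D) (v, as) = w then pbasis (v, as @ bs) else (\<lambda>p. 0))"
proof -
  have "{(p1, p2). pbasis (v, as) p1 \<noteq> 0 \<and> pbasis (w, bs) p2 \<noteq> 0 \<and>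
                pend (dtgt D) p1 = fst p2 \<and> (fst p1, snd p1 @ snd p2) = p} =
     (if pend (dtgt D) (v, as) = w \<and> p = (v, as @ bs) then {((v, as), (w, bs))} else {})" for p
    by (auto simp: pbasis_def)
  then show ?thesis
    by (auto simp: path_algebra_def pbasis_def fun_eq_iff)
qed

text \<open>One family covers the unit (V = \<open>dV D\<close>) and the boundary idempotent (V =
  \<open>boundary_vertices D\<close>); multiplying by it restricts supports by start or by
  end.\<close>

definition videm :: "'v set \<Rightarrow> ('v \<times> 'a list \<Rightarrow> complex)" where
  "videm V = (\<lambda>p. if snd p = [] \<and> fst p \<in> V then 1 else 0)"

lemma videm_mult_left:
  "(videm V \<otimes>\<^bsub>path_algebra D\<^esub> f) p = (if fst p \<in> V then f p else 0)"
proof (cases p)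
  case (Pair v as)
  have "(\<Sum>k\<le>length as. videm V (v, take k as) * f (pend (dtgt D) (v, take k as), drop k as)) =
    (\<Sum>k\<in>{0}. videm V (v, take k as) * f (pend (dtgt D) (v, take k as), drop k as))"
    by (rule sum.mono_neutral_right) (auto simp: videm_def)
  then show ?thesis by (simp add: Pair pa_mult pend_def videm_def)
qed

lemma videm_mult_right:
  "(f \<otimes>\<^bsub>path_algebra D\<^esub> videm V) p = (if pend (dtgt D) p \<in> V then f p else 0)"
proof (cases p)
  case (Pair v as)
  have "(\<Sum>k\<le>length as. f (v, take k as) * videm V (pend (dtgt D) (v, take k as), drop k as)) =
    (\<Sum>k\<in>{length as}. f (v, take k as) * videm V (pend (dtgt D) (v, take k as), drop k as))"
    by (rule sum.mono_neutral_right) (auto simp: videm_def)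
  then show ?thesis by (simp add: Pair pa_mult videm_def)
qed

lemma scaled_videm_mult_left:
  "((\<lambda>p. c * videm V p) \<otimes>\<^bsub>path_algebra D\<^esub> f) p = (if fst p \<in> V then c * f p else 0)"
proof -
  have "((\<lambda>p. c * videm V p) \<otimes>\<^bsub>path_algebra D\<^esub> f) p = c * (videm V \<otimes>\<^bsub>path_algebra D\<^esub> f) p"
    by (cases p) (simp add: pa_mult sum_distrib_left mult.assoc)
  then show ?thesis by (simp add: videm_mult_left)
qed

text \<open>Length at least 2 ensures that a face minus one arrow is a nonempty list, whose ends are
  then determined by its arrows. The common weight N of all faces makes the relations
  homogeneous.\<close>

locale graded_dimer =
  fixes D :: "('v, 'a) dimer" and wt :: "'a \<Rightarrow> nat" and N :: nat
  assumes finite_dV: "finite (dV D)"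
    and tgt_dV: "dtgt D ` dA D \<subseteq> dV D"
    and face: "\<And>F. F \<in> dFp D \<union> dFm D \<Longrightarrow> 2 \<le> length F \<and> (\<exists>v. walk D v F v) \<and> sum_list (map wt F) = N"
begin

abbreviation "A \<equiv> path_algebra D"
abbreviation "I \<equiv> dimer_ideal D"
abbreviation "ed \<equiv> pend (dtgt D)"

definition dg :: "'v \<times> 'a list \<Rightarrow> nat" where "dg p = sum_list (map wt (snd p))"

lemma qp_walk: "p \<in> qpaths D \<longleftrightarrow> walk D (fst p) (snd p) (ed p)"
  using qpaths_walk[OF tgt_dV, of "fst p" "snd p"] walk_pend[of D "fst p" "snd p"] by auto

lemma qp_comp: "p \<in> qpaths D \<Longrightarrow> q \<in> qpaths D \<Longrightarrow> ed p = fst q \<Longrightarrow>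
   (fst p, snd p @ snd q) \<in> qpaths D \<and> ed (fst p, snd p @ snd q) = ed q"
  using walk_append[of D "fst p" "snd p" "snd q" "ed q"] walk_pend[of D "fst p" "snd p @ snd q" "ed q"]
  unfolding qp_walk by (metis fst_conv snd_conv)

lemma carrier_mult:
  assumes f: "f \<in> carrier A" and g: "g \<in> carrier A"
  shows "f \<otimes>\<^bsub>A\<^esub> g \<in> carrier A"
proof -
  let ?S = "{p. f p \<noteq> 0} \<times> {p. g p \<noteq> 0}"
  let ?c = "\<lambda>(p1, p2). (fst p1, snd p1 @ snd p2)"
  have *: "\<exists>p1 p2. f p1 \<noteq> 0 \<and> g p2 \<noteq> 0 \<and> ed p1 = fst p2 \<and> (fst p1, snd p1 @ snd p2) = p"
    if "(f \<otimes>\<^bsub>A\<^esub> g) p \<noteq> 0" for p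
  proof (rule ccontr)
    assume "\<not> ?thesis"
    then have "{(p1, p2). f p1 \<noteq> 0 \<and> g p2 \<noteq> 0 \<and> ed p1 = fst p2 \<and> (fst p1, snd p1 @ snd p2) = p} = {}"
      by blast
    then have "(f \<otimes>\<^bsub>A\<^esub> g) p = 0" unfolding path_algebra_def by (simp only: monoid.simps sum.empty)
    with that show False by simp
  qed
  have "{p. (f \<otimes>\<^bsub>A\<^esub> g) p \<noteq> 0} \<subseteq> ?c ` ?S"
    using * by fastforce
  moreover have "finite ?S" using f g by (simp add: pa_simps)
  ultimately have "finite {p. (f \<otimes>\<^bsub>A\<^esub> g) p \<noteq> 0}" by (meson finite_imageI finite_subset)
  moreover have "p \<in> qpaths D" if "(f \<otimes>\<^bsub>A\<^esub> g) p \<noteq> 0" for p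
    using *[OF that] f g qp_comp by (fastforce simp: pa_simps(4))
  ultimately show ?thesis by (simp add: pa_simps(4))
qed

lemma videm_carrier: "V \<subseteq> dV D \<Longrightarrow> videm V \<in> carrier A"
proof -
  assume V: "V \<subseteq> dV D"
  have "{p. videm V p \<noteq> 0} \<subseteq> V \<times> {[]}" by (auto simp: videm_def)
  then have "finite {p. videm V p \<noteq> (0 :: complex)}"
    using finite_subset finite_subset[OF V finite_dV] by blast
  moreover have "p \<in> qpaths D" if "videm V p \<noteq> 0" for p
    using V that by (cases p) (auto simp: videm_def qpaths_def split: if_splits)
  ultimately show ?thesis by (simp add: pa_simps(4))
qed

lemma one_videm: "\<one>\<^bsub>A\<^esub> = videm (dV D)"
  by (simp add: pa_simps videm_def)

lemma carrier_lin:
  assumes "f \<in> carrier A" "g \<in> carrier A"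
  shows "(\<lambda>p. c * f p + d * g p) \<in> carrier A"
proof -
  have "{p. c * f p + d * g p \<noteq> 0} \<subseteq> {p. f p \<noteq> 0} \<union> {p. g p \<noteq> 0}" by auto
  moreover have "finite ({p. f p \<noteq> 0} \<union> {p. g p \<noteq> 0})" using assms by (simp add: pa_simps)
  ultimately have "finite {p. c * f p + d * g p \<noteq> 0}" by (rule finite_subset)
  then show ?thesis using assms by (auto simp: pa_simps(4)) (metis mult_zero_right add_0)
qed

lemma ring_A: "ring A"
proof (rule ringI)
  show "abelian_group A"
  proof (rule abelian_groupI)
    fix f g assume "f \<in> carrier A" "g \<in> carrier A"
    then show "f \<oplus>\<^bsub>A\<^esub> g \<in> carrier A" using carrier_lin[of f g 1 1] by (simp add: pa_simps(3))
  next
    fix f assume "f \<in> carrier A"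
    then have "(\<lambda>p. - f p) \<in> carrier A" by (simp add: pa_simps(4))
    then show "\<exists>g\<in>carrier A. g \<oplus>\<^bsub>A\<^esub> f = \<zero>\<^bsub>A\<^esub>"
      by (rule bexI[rotated]) (simp add: pa_simps)
  qed (auto simp: pa_simps fun_eq_iff)
  show "Group.monoid A"
  proof (rule Group.monoidI)
    fix f assume f: "f \<in> carrier A"
    show "\<one>\<^bsub>A\<^esub> \<otimes>\<^bsub>A\<^esub> f = f" "f \<otimes>\<^bsub>A\<^esub> \<one>\<^bsub>A\<^esub> = f"
      unfolding one_videm using f
      by (auto simp: fun_eq_iff videm_mult_left videm_mult_right pa_simps(4) qp_walk dest: walk_dV)
  qed (auto simp: carrier_mult pa_assoc one_videm videm_carrier)
qed (auto simp: fun_eq_iff pa_mult pa_simps(3) distrib_left distrib_right sum.distrib)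


lemma pbasis_carrier: "p \<in> qpaths D \<Longrightarrow> pbasis p \<in> carrier A"
  by (auto simp: pa_simps(4) pbasis_def)

lemma face_split:
  assumes "xs @ \<alpha> # ys \<in> dFp D \<union> dFm D"
  shows "walk D (dtgt D \<alpha>) (ys @ xs) (dsrc D \<alpha>)" "ys @ xs \<noteq> []"
    "sum_list (map wt (ys @ xs)) + wt \<alpha> = N"
proof -
  obtain v where "walk D v (xs @ \<alpha> # ys) v" and l: "2 \<le> length (xs @ \<alpha> # ys)"
    and s: "sum_list (map wt (xs @ \<alpha> # ys)) = N"
    using face[OF assms] by blast
  then obtain u where "walk D v xs u" "walk D u (\<alpha> # ys) v" by (auto simp: walk_append)
  then show "walk D (dtgt D \<alpha>) (ys @ xs) (dsrc D \<alpha>)" by (auto simp: walk_append)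
  show "ys @ xs \<noteq> []" using l by auto
  show "sum_list (map wt (ys @ xs)) + wt \<alpha> = N" using s by simp
qed

lemma walk_nonempty: "walk D v as w \<Longrightarrow> as \<noteq> [] \<Longrightarrow> v = dsrc D (hd as) \<and> w = dtgt D (last as)"
  by (induction as arbitrary: v) (auto split: if_splits)

text \<open>Deleting \<alpha> from either face leaves a nonempty walk from
  \<open>dtgt D \<alpha>\<close> to \<open>dsrc D \<alpha>\<close> of weight N minus that of
  \<alpha>, so one side may replace the other inside any walk.\<close>

lemma pcong_walk:
  assumes "pcong D as bs"
  shows "walk D v as w = walk D v bs w \<and> sum_list (map wt as) = sum_list (map wt bs)"
  using assms
proof (induction arbitrary: v w rule: pcong.induct)
  case (pc_rel xs \<alpha> ys us vs ls rs)
  note p = face_split[of xs \<alpha> ys] and q = face_split[of us \<alpha> vs]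
  have "walk D u (ys @ xs) u' \<longleftrightarrow> u = dtgt D \<alpha> \<and> u' = dsrc D \<alpha>" for u u'
    using p pc_rel walk_nonempty[OF _ p(2)] by (metis UnI1)
  moreover have "walk D u (vs @ us) u' \<longleftrightarrow> u = dtgt D \<alpha> \<and> u' = dsrc D \<alpha>" for u u'
    using q pc_rel walk_nonempty[OF _ q(2)] by (metis UnI2)
  ultimately have "walk D u ((ys @ xs) @ rs) u' \<longleftrightarrow> walk D u ((vs @ us) @ rs) u'" for u u'
    unfolding walk_append[of D u "ys @ xs"] walk_append[of D u "vs @ us"] by blast
  moreover have "sum_list (map wt (ys @ xs)) = sum_list (map wt (vs @ us))"
    using p(3) q(3) pc_rel by simp
  ultimately show ?case by (simp add: walk_append[of D v ls])
qed auto

section \<open>The ideal of relations\<close>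

lemma rels_carrier: "dimer_rels D \<subseteq> carrier A"
proof
  fix f assume "f \<in> dimer_rels D"
  then obtain \<alpha> xs ys us vs where f: "f = (\<lambda>q. pbasis (dtgt D \<alpha>, ys @ xs) q - pbasis (dtgt D \<alpha>, vs @ us) q)"
    and r: "xs @ \<alpha> # ys \<in> dFp D" "us @ \<alpha> # vs \<in> dFm D"
    unfolding dimer_rels_def by blast
  have "(dtgt D \<alpha>, ys @ xs) \<in> qpaths D" "(dtgt D \<alpha>, vs @ us) \<in> qpaths D"
    using face_split(1)[of xs \<alpha> ys] face_split(1)[of us \<alpha> vs] r qpaths_walk[OF tgt_dV] by blast+
  from carrier_lin[OF pbasis_carrier pbasis_carrier, OF this, of 1 "-1"]
  show "f \<in> carrier A" unfolding f by simp
qed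

lemma ideal_I: "ideal I A"
  unfolding dimer_ideal_def by (rule ring.genideal_ideal[OF ring_A rels_carrier])

lemma I_carrier: "f \<in> I \<Longrightarrow> f \<in> carrier A"
  using ideal.Icarr[OF ideal_I] .

lemma I_add: "f \<in> I \<Longrightarrow> g \<in> I \<Longrightarrow> (\<lambda>p. f p + g p) \<in> I"
  using additive_subgroup.a_closed[OF ideal.axioms(1)[OF ideal_I], of f g] by (simp add: pa_simps(3))

lemma I_zero: "(\<lambda>p. 0) \<in> I"
  using additive_subgroup.zero_closed[OF ideal.axioms(1)[OF ideal_I]] by (simp add: pa_simps(1))

text \<open>\<open>genideal\<close> yields an ideal of a ring; complex scalars enter through
  multiplication by c times the unit.\<close>

lemma I_scale: assumes "f \<in> I" shows "(\<lambda>p. c * f p) \<in> I"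
proof -
  have "(\<lambda>p. c * videm (dV D) p) \<in> carrier A"
    using carrier_lin[OF videm_carrier[OF order_refl] videm_carrier[OF order_refl], of c 0] by simp
  from ideal.I_l_closed[OF ideal_I assms this]
  have "(\<lambda>p. c * videm (dV D) p) \<otimes>\<^bsub>A\<^esub> f \<in> I" .
  moreover have "(\<lambda>p. c * videm (dV D) p) \<otimes>\<^bsub>A\<^esub> f = (\<lambda>p. c * f p)"
    using I_carrier[OF assms] walk_dV
    by (fastforce simp: fun_eq_iff scaled_videm_mult_left pa_simps(4) qp_walk)
  ultimately show ?thesis by simp
qed

lemma I_lin: "f \<in> I \<Longrightarrow> g \<in> I \<Longrightarrow> (\<lambda>p. c * f p + d * g p) \<in> I"
  using I_add I_scale by blast

lemma I_sum: "finite X \<Longrightarrow> (\<And>x. x \<in> X \<Longrightarrow> f x \<in> I) \<Longrightarrow> (\<lambda>p. \<Sum>x\<in>X. f x p) \<in> I"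
  by (induction X rule: finite_induct) (auto simp: I_zero I_add)

lemma pcong_ideal:
  assumes "pcong D as bs" "walk D v as w"
  shows "(\<lambda>q. pbasis (v, as) q - pbasis (v, bs) q) \<in> I"
  using assms
proof (induction arbitrary: v w rule: pcong.induct)
  case (pc_refl as)
  then show ?case by (simp add: I_zero)
next
  case (pc_sym as bs)
  then have "(\<lambda>q. pbasis (v, as) q - pbasis (v, bs) q) \<in> I" using pcong_walk by blast
  from I_scale[OF this, of "-1"] show ?case by simp
next
  case (pc_trans as bs cs)
  then have "(\<lambda>q. pbasis (v, as) q - pbasis (v, bs) q) \<in> I" "(\<lambda>q. pbasis (v, bs) q - pbasis (v, cs) q) \<in> I"
    using pcong_walk by blast+
  from I_add[OF this] show ?case by simp
next
  case (pc_rel xs \<alpha> ys us vs ls rs)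
  let ?d = "\<lambda>q. pbasis (dtgt D \<alpha>, ys @ xs) q - pbasis (dtgt D \<alpha>, vs @ us) q"
  have "?d \<in> dimer_rels D" unfolding dimer_rels_def using pc_rel by blast
  then have d: "?d \<in> I" unfolding dimer_ideal_def using ring.genideal_self[OF ring_A rels_carrier] by blast
  obtain u u' where w: "walk D v ls u" "walk D u (ys @ xs) u'" "walk D u' rs w"
    using pc_rel(3) by (auto simp: walk_append)
  \<comment> \<open>The replaced piece is nonempty, so its start is forced; this makes the products
    of \<open>pbasis\<close> elements below composable rather than zero.\<close>
  have u: "u = dtgt D \<alpha>" using face_split(1,2)[of xs \<alpha> ys] pc_rel w(2) walk_nonempty by (metis UnI1)
  have w': "walk D u (vs @ us) u'"
    using pcong_walk[OF pcong.pc_rel[OF pc_rel(1,2), of "[]" "[]"], of u u'] w(2) by simp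
  have "pbasis (v, ls) \<otimes>\<^bsub>A\<^esub> ?d \<in> I"
    by (rule ideal.I_l_closed[OF ideal_I d]) (use w qp_walk walk_pend in \<open>force intro: pbasis_carrier\<close>)
  then have "(pbasis (v, ls) \<otimes>\<^bsub>A\<^esub> ?d) \<otimes>\<^bsub>A\<^esub> pbasis (u', rs) \<in> I"
    by (rule ideal.I_r_closed[OF ideal_I]) (use w qp_walk walk_pend in \<open>force intro: pbasis_carrier\<close>)
  moreover have "walk D v (ls @ ys @ xs) u'" "walk D v (ls @ vs @ us) u'"
    using w w' by (auto simp: walk_append)
  then have "(pbasis (v, ls) \<otimes>\<^bsub>A\<^esub> ?d) \<otimes>\<^bsub>A\<^esub> pbasis (u', rs) =
     (\<lambda>q. pbasis (v, ls @ ys @ xs @ rs) q - pbasis (v, ls @ vs @ us @ rs) q)"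
    using w walk_pend[OF w(1)]
    by (simp add: pa_mult_diff_right pa_mult_diff_left pbasis_mult u[symmetric] walk_pend)
  ultimately show ?case by simp
qed

text \<open>The linear extension of sending a path from s to t of weight m to x^m times the matrix
  unit at (s, t): a representation of the path algebra by matrices over C[x].\<close>

definition mat :: "('v \<times> 'a list \<Rightarrow> complex) \<Rightarrow> 'v \<Rightarrow> 'v \<Rightarrow> complex poly" where
  "mat f s t = (\<Sum>p | f p \<noteq> 0. if fst p = s \<and> ed p = t then monom (f p) (dg p) else 0)"

lemma mat_superset:
  assumes "finite X" "{p. f p \<noteq> 0} \<subseteq> X"
  shows "mat f s t = (\<Sum>p\<in>X. if fst p = s \<and> ed p = t then monom (f p) (dg p) else 0)"
  unfolding mat_def using assms by (intro sum.mono_neutral_left) auto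

lemma smult_sum: "smult c (\<Sum>x\<in>X. f x) = (\<Sum>x\<in>X. smult c (f x))"
  by (induction X rule: infinite_finite_induct) (auto simp: smult_add_right)

lemma mat_lin:
  assumes "f \<in> carrier A" "g \<in> carrier A"
  shows "mat (\<lambda>p. c * f p + d * g p) s t = smult c (mat f s t) + smult d (mat g s t)"
proof -
  let ?X = "{p. f p \<noteq> 0} \<union> {p. g p \<noteq> 0}"
  have X: "finite ?X" using assms by (simp add: pa_simps(4))
  show ?thesis
    by (subst (1 2 3) mat_superset[OF X])
       (auto simp: smult_sum smult_monom add_monom[symmetric] simp flip: sum.distrib intro!: sum.cong)
qed

text \<open>The index sets are the full supports, independent of the product path p; this permits
  exchanging the sums in \<open>mat_mult\<close>.\<close>

lemma pa_mult_sum: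
  assumes "f \<in> carrier A" "g \<in> carrier A"
  shows "(f \<otimes>\<^bsub>A\<^esub> g) p = (\<Sum>p1 | f p1 \<noteq> 0. \<Sum>p2 | g p2 \<noteq> 0.
     if ed p1 = fst p2 \<and> (fst p1, snd p1 @ snd p2) = p then f p1 * g p2 else 0)"
proof -
  let ?S = "{p. f p \<noteq> 0} \<times> {p. g p \<noteq> 0}"
  let ?P = "{(p1, p2). f p1 \<noteq> 0 \<and> g p2 \<noteq> 0 \<and> ed p1 = fst p2 \<and> (fst p1, snd p1 @ snd p2) = p}"
  have fin: "finite ?S" using assms by (simp add: pa_simps(4))
  have "(f \<otimes>\<^bsub>A\<^esub> g) p = (\<Sum>(p1, p2)\<in>?P. f p1 * g p2)"
    by (simp add: path_algebra_def)
  also have "\<dots> = (\<Sum>(p1, p2)\<in>?P.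
     if ed p1 = fst p2 \<and> (fst p1, snd p1 @ snd p2) = p then f p1 * g p2 else 0)"
    by (rule sum.cong) auto
  also have "\<dots> = (\<Sum>(p1, p2)\<in>?S.
     if ed p1 = fst p2 \<and> (fst p1, snd p1 @ snd p2) = p then f p1 * g p2 else 0)"
    by (rule sum.mono_neutral_left[OF fin]) (auto split: if_splits)
  also have "\<dots> = (\<Sum>p1 | f p1 \<noteq> 0. \<Sum>p2 | g p2 \<noteq> 0.
     if ed p1 = fst p2 \<and> (fst p1, snd p1 @ snd p2) = p then f p1 * g p2 else 0)"
    by (rule sum.cartesian_product[symmetric])
  finally show ?thesis .
qed

lemma mat_mult:
  assumes f: "f \<in> carrier A" and g: "g \<in> carrier A"
  shows "mat (f \<otimes>\<^bsub>A\<^esub> g) s t = (\<Sum>u\<in>dV D. mat f s u * mat g u t)"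
proof -
  let ?F = "{p. f p \<noteq> 0}" and ?G = "{p. g p \<noteq> 0}" and ?H = "{p. (f \<otimes>\<^bsub>A\<^esub> g) p \<noteq> 0}"
  let ?c = "\<lambda>p1 p2. (fst p1, snd p1 @ snd p2)"
  \<comment> \<open>Concatenations whose coefficients cancel in the product are kept in the index
    set, so that every pair (p1, p2) finds its concatenation there.\<close>
  let ?X = "?H \<union> (\<lambda>(p1, p2). ?c p1 p2) ` (?F \<times> ?G)"
  have fin: "finite ?F" "finite ?G" "finite ?H"
    using f g carrier_mult[OF f g] by (simp_all add: pa_simps(4))
  then have X: "finite ?X" by simp
  have "mat (f \<otimes>\<^bsub>A\<^esub> g) s t = (\<Sum>p\<in>?X. if fst p = s \<and> ed p = t then monom ((f \<otimes>\<^bsub>A\<^esub> g) p) (dg p) else 0)"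
    by (rule mat_superset[OF X]) auto
  also have "\<dots> = (\<Sum>p\<in>?X. \<Sum>p1\<in>?F. \<Sum>p2\<in>?G. if ed p1 = fst p2 \<and> ?c p1 p2 = p \<and> fst p = s \<and> ed p = t
      then monom (f p1 * g p2) (dg p) else 0)"
    unfolding pa_mult_sum[OF f g] monom_sum
    by (intro sum.cong refl) (auto simp: monom_sum intro!: sum.cong sum.neutral)
  also have "\<dots> = (\<Sum>p1\<in>?F. \<Sum>p2\<in>?G. \<Sum>p\<in>?X. if ed p1 = fst p2 \<and> ?c p1 p2 = p \<and> fst p = s \<and> ed p = t
      then monom (f p1 * g p2) (dg p) else 0)"
    by (rule trans[OF sum.swap sum.cong[OF refl sum.swap]])
  also have "\<dots> = (\<Sum>p1\<in>?F. \<Sum>p2\<in>?G. if ed p1 = fst p2 \<and> fst p1 = s \<and> ed p2 = t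
      then monom (f p1) (dg p1) * monom (g p2) (dg p2) else 0)"
  proof (intro sum.cong refl)
    fix p1 p2 assume p: "p1 \<in> ?F" "p2 \<in> ?G"
    then have q: "p1 \<in> qpaths D" "p2 \<in> qpaths D" using f g unfolding pa_simps(4) by blast+
    have "(\<Sum>p\<in>?X. if ed p1 = fst p2 \<and> ?c p1 p2 = p \<and> fst p = s \<and> ed p = t
      then monom (f p1 * g p2) (dg p) else 0) =
      (\<Sum>p\<in>?X. if p = ?c p1 p2 then (if ed p1 = fst p2 \<and> fst (?c p1 p2) = s \<and> ed (?c p1 p2) = t
      then monom (f p1 * g p2) (dg (?c p1 p2)) else 0) else 0)"
      by (rule sum.cong) auto
    also have "\<dots> = (if ed p1 = fst p2 \<and> fst (?c p1 p2) = s \<and> ed (?c p1 p2) = t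
      then monom (f p1 * g p2) (dg (?c p1 p2)) else 0)"
      using p by (subst sum.delta[OF X]) auto
    also have "\<dots> = (if ed p1 = fst p2 \<and> fst p1 = s \<and> ed p2 = t
      then monom (f p1) (dg p1) * monom (g p2) (dg p2) else 0)"
      using qp_comp[OF q] by (auto simp: dg_def mult_monom)
    finally show "(\<Sum>p\<in>?X. if ed p1 = fst p2 \<and> ?c p1 p2 = p \<and> fst p = s \<and> ed p = t
      then monom (f p1 * g p2) (dg p) else 0) = (if ed p1 = fst p2 \<and> fst p1 = s \<and> ed p2 = t
      then monom (f p1) (dg p1) * monom (g p2) (dg p2) else 0)" .
  qed
  \<comment> \<open>The condition \<open>ed p1 = fst p2\<close> becomes a sum over the middle vertex
    u, of which at most one term survives.\<close>
  also have "\<dots> = (\<Sum>p1\<in>?F. \<Sum>p2\<in>?G. \<Sum>u\<in>dV D. (if fst p1 = s \<and> ed p1 = u then monom (f p1) (dg p1) else 0) *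
       (if fst p2 = u \<and> ed p2 = t then monom (g p2) (dg p2) else 0))"
  proof (intro sum.cong refl)
    fix p1 p2 assume p: "p1 \<in> ?F" "p2 \<in> ?G"
    then have "p1 \<in> qpaths D" using f unfolding pa_simps(4) by blast
    then have v: "ed p1 \<in> dV D" unfolding qp_walk by (blast dest: walk_dV)
    have "(\<Sum>u\<in>dV D. (if fst p1 = s \<and> ed p1 = u then monom (f p1) (dg p1) else 0) *
       (if fst p2 = u \<and> ed p2 = t then monom (g p2) (dg p2) else 0)) =
       (\<Sum>u\<in>dV D. if u = ed p1 then (if ed p1 = fst p2 \<and> fst p1 = s \<and> ed p2 = t
      then monom (f p1) (dg p1) * monom (g p2) (dg p2) else 0) else 0)"
      by (rule sum.cong) auto
    then show "(if ed p1 = fst p2 \<and> fst p1 = s \<and> ed p2 = t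
      then monom (f p1) (dg p1) * monom (g p2) (dg p2) else 0) =
      (\<Sum>u\<in>dV D. (if fst p1 = s \<and> ed p1 = u then monom (f p1) (dg p1) else 0) *
       (if fst p2 = u \<and> ed p2 = t then monom (g p2) (dg p2) else 0))"
      using v by (simp add: sum.delta[OF finite_dV])
  qed
  also have "\<dots> = (\<Sum>u\<in>dV D. \<Sum>p1\<in>?F. \<Sum>p2\<in>?G. (if fst p1 = s \<and> ed p1 = u then monom (f p1) (dg p1) else 0) *
       (if fst p2 = u \<and> ed p2 = t then monom (g p2) (dg p2) else 0))"
    by (rule trans[OF sum.cong[OF refl sum.swap] sum.swap])
  also have "\<dots> = (\<Sum>u\<in>dV D. mat f s u * mat g u t)"
    unfolding mat_def sum_product by (rule refl)
  finally show ?thesis .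
qed


lemma coeff_mat:
  assumes "f \<in> carrier A"
  shows "coeff (mat f s t) m = (\<Sum>p | f p \<noteq> 0. if fst p = s \<and> ed p = t \<and> dg p = m then f p else 0)"
  unfolding mat_def coeff_sum by (intro sum.cong) auto

lemma mat_pbasis: "mat (pbasis p) s t = (if fst p = s \<and> ed p = t then monom 1 (dg p) else 0)"
  by (subst mat_superset[of "{p}"]) (auto simp: pbasis_def)

text \<open>The common kernel \<open>?J\<close> of all matrix entries is an ideal by
  \<open>mat_mult\<close> and contains the relations, whose two sides share ends and weight;
  minimality of \<open>genideal\<close> does the rest.\<close>

lemma mat_ideal:
  assumes "f \<in> I" shows "mat f s t = 0"
proof -
  let ?J = "{f \<in> carrier A. \<forall>s t. mat f s t = 0}"
  interpret A: ring A by (rule ring_A)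
  have "ideal ?J A"
  proof (rule idealI[OF ring_A])
    show "subgroup ?J (add_monoid A)"
    proof (rule A.add.subgroupI)
      have "\<zero>\<^bsub>A\<^esub> \<in> ?J" using A.zero_closed by (simp add: mat_def pa_simps(1))
      then show "?J \<noteq> {}" by blast
    next
      fix f assume f: "f \<in> ?J"
      then have c: "(\<lambda>p. - f p) \<in> carrier A" by (simp add: pa_simps(4))
      have "\<ominus>\<^bsub>A\<^esub> f = (\<lambda>p. - f p)"
        by (rule A.minus_equality) (use f c in \<open>auto simp: pa_simps(1,3)\<close>)
      then show "\<ominus>\<^bsub>A\<^esub> f \<in> ?J"
        using f c mat_lin[of f f "-1" 0] by simp
    next
      fix f g assume "f \<in> ?J" "g \<in> ?J"
      then show "f \<oplus>\<^bsub>A\<^esub> g \<in> ?J"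
        using mat_lin[of f g 1 1] A.a_closed[of f g] by (simp add: pa_simps(3))
    qed auto
  qed (auto simp: mat_mult carrier_mult)
  moreover have "dimer_rels D \<subseteq> ?J"
  proof
    fix f assume "f \<in> dimer_rels D"
    moreover from this obtain \<alpha> xs ys us vs where
      f: "f = (\<lambda>q. pbasis (dtgt D \<alpha>, ys @ xs) q - pbasis (dtgt D \<alpha>, vs @ us) q)"
      and r: "xs @ \<alpha> # ys \<in> dFp D \<union> dFm D" "us @ \<alpha> # vs \<in> dFp D \<union> dFm D"
      unfolding dimer_rels_def by blast
    note p = face_split[OF r(1)] and q = face_split[OF r(2)]
    have qp: "(dtgt D \<alpha>, ys @ xs) \<in> qpaths D" "(dtgt D \<alpha>, vs @ us) \<in> qpaths D"
      using p q qpaths_walk[OF tgt_dV] by blast+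
    have eq: "sum_list (map wt (ys @ xs)) = sum_list (map wt (vs @ us))" using p(3) q(3) by simp
    have "mat f s t = 0" for s t
      using mat_lin[OF pbasis_carrier pbasis_carrier, OF qp, of 1 "-1" s t]
        walk_pend[OF p(1)] walk_pend[OF q(1)] eq
      unfolding f by (simp add: mat_pbasis dg_def)
    ultimately show "f \<in> ?J" using rels_carrier by blast
  qed
  ultimately have "I \<subseteq> ?J" unfolding dimer_ideal_def by (rule A.genideal_minimal)
  with assms show ?thesis by blast
qed

section \<open>The corner of the quotient at the boundary idempotent\<close>

abbreviation "bV \<equiv> boundary_vertices D"
abbreviation "B \<equiv> boundary_algebra D"

lemma bV_dV: "bV \<subseteq> dV D"
  by (auto simp: boundary_vertices_def)

text \<open>The corner e A e, taken before passing to the quotient.\<close>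

definition bcar :: "('v \<times> 'a list \<Rightarrow> complex) set" where
  "bcar = {f \<in> carrier A. \<forall>p. f p \<noteq> 0 \<longrightarrow> fst p \<in> bV \<and> ed p \<in> bV}"

lemma bcarI:
  "f \<in> carrier A \<Longrightarrow> (\<And>p. f p \<noteq> 0 \<Longrightarrow> fst p \<in> bV \<and> ed p \<in> bV) \<Longrightarrow> f \<in> bcar"
  unfolding bcar_def by blast

abbreviation cls :: "('v \<times> 'a list \<Rightarrow> complex) \<Rightarrow> ('v \<times> 'a list \<Rightarrow> complex) set" where
  "cls f \<equiv> I +>\<^bsub>A\<^esub> f"

lemma cls_altdef: "cls f = {(\<lambda>p. h p + f p) | h. h \<in> I}"
  by (auto simp: a_r_coset_def' pa_simps(3))

lemma B_simps:
  "x \<otimes>\<^bsub>B\<^esub> y = rcoset_mult A I x y" "x \<oplus>\<^bsub>B\<^esub> y = x <+>\<^bsub>A\<^esub> y" "\<one>\<^bsub>B\<^esub> = cls (videm bV)"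
  by (simp_all add: boundary_algebra_def corner_ring_def dimer_algebra_def FactRing_def
      boundary_idem_def videm_def)

lemma cls_mult: "f \<in> carrier A \<Longrightarrow> g \<in> carrier A \<Longrightarrow> rcoset_mult A I (cls f) (cls g) = cls (f \<otimes>\<^bsub>A\<^esub> g)"
  by (rule ideal.rcoset_mult_add[OF ideal_I])

lemma cls_add:
  assumes "f \<in> carrier A" "g \<in> carrier A"
  shows "cls f <+>\<^bsub>A\<^esub> cls g = cls (\<lambda>p. f p + g p)"
proof -
  interpret ideal I A by (rule ideal_I)
  show ?thesis
    using a_rcos_sum[OF assms] by (simp add: pa_simps(3))
qed

text \<open>Cosets multiply through representatives, so every element of the corner is the class of
  some e f e; conversely a function in \<open>bcar\<close> is fixed by e on both sides.\<close>

lemma carrier_B: "carrier B = cls ` bcar"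
proof -
  let ?e = "videm bV"
  have e: "?e \<in> carrier A" by (rule videm_carrier[OF bV_dV])
  have cB: "carrier B = {rcoset_mult A I (rcoset_mult A I (cls ?e) (cls f)) (cls ?e) | f. f \<in> carrier A}"
    unfolding boundary_algebra_def corner_ring_def dimer_algebra_def FactRing_def
      boundary_idem_def A_RCOSETS_def' videm_def by auto
  also have "\<dots> = {cls (?e \<otimes>\<^bsub>A\<^esub> f \<otimes>\<^bsub>A\<^esub> ?e) | f. f \<in> carrier A}"
  proof -
    have "rcoset_mult A I (rcoset_mult A I (cls ?e) (cls f)) (cls ?e) = cls (?e \<otimes>\<^bsub>A\<^esub> f \<otimes>\<^bsub>A\<^esub> ?e)"
      if "f \<in> carrier A" for f using e that by (simp add: cls_mult carrier_mult)
    then show ?thesis by (intro Collect_cong) auto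
  qed
  also have "\<dots> = cls ` bcar"
  proof safe
    fix f assume "f \<in> carrier A"
    then show "cls (?e \<otimes>\<^bsub>A\<^esub> f \<otimes>\<^bsub>A\<^esub> ?e) \<in> cls ` bcar"
      using e carrier_mult[OF carrier_mult[OF e] e, of f]
      by (intro imageI bcarI) (assumption, simp add: videm_mult_left videm_mult_right split: if_splits)
  next
    fix f assume f: "f \<in> bcar"
    then have "?e \<otimes>\<^bsub>A\<^esub> f \<otimes>\<^bsub>A\<^esub> ?e = f"
      by (auto simp: fun_eq_iff bcar_def videm_mult_left videm_mult_right)
    moreover have "f \<in> carrier A" using f by (simp add: bcar_def)
    ultimately show "\<exists>g. cls f = cls (?e \<otimes>\<^bsub>A\<^esub> g \<otimes>\<^bsub>A\<^esub> ?e) \<and> g \<in> carrier A"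
      by (intro exI[of _ f]) simp
  qed
  finally show ?thesis .
qed

lemma carrier_BE:
  assumes "X \<in> carrier B"
  obtains f where "f \<in> bcar" "f \<in> carrier A" "X = cls f"
  using assms unfolding carrier_B bcar_def by blast

lemma bcar_carrier: "f \<in> bcar \<Longrightarrow> f \<in> carrier A"
  by (simp add: bcar_def)

lemma bcar_lin: "f \<in> bcar \<Longrightarrow> g \<in> bcar \<Longrightarrow> (\<lambda>p. c * f p + d * g p) \<in> bcar"
  using carrier_lin[of f g c d] by (auto simp: bcar_def) (metis add_0 mult_zero_right)+

lemma bcar_mult: assumes "f \<in> bcar" "g \<in> bcar" shows "f \<otimes>\<^bsub>A\<^esub> g \<in> bcar"
proof -
  have "videm bV \<otimes>\<^bsub>A\<^esub> f = f" "g \<otimes>\<^bsub>A\<^esub> videm bV = g"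
    using assms by (auto simp: fun_eq_iff bcar_def videm_mult_left videm_mult_right)
  then have e: "videm bV \<otimes>\<^bsub>A\<^esub> (f \<otimes>\<^bsub>A\<^esub> g) = f \<otimes>\<^bsub>A\<^esub> g" "(f \<otimes>\<^bsub>A\<^esub> g) \<otimes>\<^bsub>A\<^esub> videm bV = f \<otimes>\<^bsub>A\<^esub> g"
    by (simp_all only: pa_assoc) (simp only: flip: pa_assoc)
  have "fst p \<in> bV \<and> ed p \<in> bV" if "(f \<otimes>\<^bsub>A\<^esub> g) p \<noteq> 0" for p
    using fun_cong[OF e(1), of p] fun_cong[OF e(2), of p] that
    unfolding videm_mult_left videm_mult_right by (auto split: if_splits)
  then show ?thesis using carrier_mult[OF bcar_carrier bcar_carrier, OF assms] by (intro bcarI)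
qed

lemma videm_bcar: "videm bV \<in> bcar"
  using videm_carrier[OF bV_dV] by (auto simp: bcar_def videm_def pend_def split: if_splits)

text \<open>An arbitrary representative is chosen; by \<open>mat_ideal\<close> the matrix does not
  depend on the choice, which is the content of \<open>bmat_cls\<close>.\<close>

definition bmat :: "('v \<times> 'a list \<Rightarrow> complex) set \<Rightarrow> 'v \<Rightarrow> 'v \<Rightarrow> complex poly" where
  "bmat X = mat (SOME f. f \<in> X)"

lemma bmat_cls: assumes "f \<in> carrier A" shows "bmat (cls f) = mat f"
proof -
  have "\<exists>g. g \<in> cls f" using I_zero by (auto simp: cls_altdef)
  then have "(SOME g. g \<in> cls f) \<in> cls f" by (rule someI_ex)
  then obtain h where "h \<in> I" "(SOME g. g \<in> cls f) = (\<lambda>p. h p + f p)" by (auto simp: cls_altdef)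
  then show ?thesis
    using mat_lin[OF I_carrier assms, of h 1 1] mat_ideal by (intro ext) (simp add: bmat_def)
qed

lemma mat_bcar_outside: "f \<in> bcar \<Longrightarrow> s \<notin> bV \<or> t \<notin> bV \<Longrightarrow> mat f s t = 0"
  unfolding mat_def bcar_def by (rule sum.neutral) auto

lemma bmat_mult:
  assumes "X \<in> carrier B" "Y \<in> carrier B"
  shows "X \<otimes>\<^bsub>B\<^esub> Y \<in> carrier B" "bmat (X \<otimes>\<^bsub>B\<^esub> Y) s t = (\<Sum>u\<in>bV. bmat X s u * bmat Y u t)"
proof -
  obtain f where f: "f \<in> bcar" "f \<in> carrier A" "X = cls f" by (rule carrier_BE[OF assms(1)])
  obtain g where g: "g \<in> bcar" "g \<in> carrier A" "Y = cls g" by (rule carrier_BE[OF assms(2)])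
  then have m: "X \<otimes>\<^bsub>B\<^esub> Y = cls (f \<otimes>\<^bsub>A\<^esub> g)" by (simp add: B_simps cls_mult f g)
  show "X \<otimes>\<^bsub>B\<^esub> Y \<in> carrier B" unfolding m carrier_B by (intro imageI bcar_mult f g)
  \<comment> \<open>Rows and columns outside the boundary vanish, so the sum shrinks to the boundary
    vertices; in this form the product rule can be compared between two quivers.\<close>
  have "(\<Sum>u\<in>dV D. mat f s u * mat g u t) = (\<Sum>u\<in>bV. mat f s u * mat g u t)"
    by (rule sum.mono_neutral_right[OF finite_dV bV_dV]) (auto simp: mat_bcar_outside[OF f(1)])
  then show "bmat (X \<otimes>\<^bsub>B\<^esub> Y) s t = (\<Sum>u\<in>bV. bmat X s u * bmat Y u t)"
    unfolding m by (simp only: f(3) g(3) bmat_cls[OF carrier_mult[OF f(2) g(2)]] bmat_cls[OF f(2)]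
      bmat_cls[OF g(2)] mat_mult[OF f(2) g(2)])
qed

lemma bmat_add:
  assumes "X \<in> carrier B" "Y \<in> carrier B"
  shows "X \<oplus>\<^bsub>B\<^esub> Y \<in> carrier B" "bmat (X \<oplus>\<^bsub>B\<^esub> Y) s t = bmat X s t + bmat Y s t"
proof -
  obtain f where f: "f \<in> bcar" "f \<in> carrier A" "X = cls f" by (rule carrier_BE[OF assms(1)])
  obtain g where g: "g \<in> bcar" "g \<in> carrier A" "Y = cls g" by (rule carrier_BE[OF assms(2)])
  then have m: "X \<oplus>\<^bsub>B\<^esub> Y = cls (\<lambda>p. f p + g p)" by (simp add: B_simps cls_add f g)
  have "(\<lambda>p. f p + g p) \<in> bcar" using bcar_lin[OF f(1) g(1), of 1 1] by simp
  then show "X \<oplus>\<^bsub>B\<^esub> Y \<in> carrier B" unfolding m carrier_B by (rule imageI)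
  have "(\<lambda>p. f p + g p) \<in> carrier A" using carrier_lin[OF f(2) g(2), of 1 1] by simp
  then show "bmat (X \<oplus>\<^bsub>B\<^esub> Y) s t = bmat X s t + bmat Y s t"
    using mat_lin[OF f(2) g(2), of 1 1] unfolding m by (simp add: f(3) g(3) bmat_cls f(2) g(2))
qed

lemma bmat_one: "\<one>\<^bsub>B\<^esub> \<in> carrier B" "bmat \<one>\<^bsub>B\<^esub> s t = (if s = t \<and> s \<in> bV then 1 else 0)"
proof -
  show "\<one>\<^bsub>B\<^esub> \<in> carrier B" using videm_bcar by (simp add: B_simps carrier_B)
  have fin: "finite (bV \<times> {[] :: 'a list})" using finite_subset[OF bV_dV finite_dV] by simp
  have "mat (videm bV) s t = (\<Sum>p\<in>bV \<times> {[]}. if fst p = s \<and> ed p = t then monom (videm bV p) (dg p) else 0)"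
    by (rule mat_superset[OF fin]) (auto simp: videm_def split: if_splits)
  also have "\<dots> = (\<Sum>p\<in>bV \<times> {[] :: 'a list}. if p = (s, []) then (if s = t then 1 else 0) else 0)"
  proof (rule sum.cong[OF refl])
    fix p assume "p \<in> bV \<times> {[] :: 'a list}"
    then show "(if fst p = s \<and> ed p = t then monom (videm bV p) (dg p) else 0) =
       (if p = (s, []) then (if s = t then 1 else 0) else 0)"
      by (auto simp: videm_def pend_def dg_def)
  qed
  also have "\<dots> = (if s = t \<and> s \<in> bV then 1 else 0)" by (simp add: sum.delta[OF fin])
  finally show "bmat \<one>\<^bsub>B\<^esub> s t = (if s = t \<and> s \<in> bV then 1 else 0)"
    by (simp add: B_simps bmat_cls videm_carrier[OF bV_dV])
qed

lemma bmat_qsmult: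
  assumes "X \<in> carrier B"
  shows "qsmult I c X \<in> carrier B" "bmat (qsmult I c X) s t = smult c (bmat X s t)"
proof -
  obtain f where f: "f \<in> bcar" "X = cls f" by (rule carrier_BE[OF assms])
  \<comment> \<open>The summand from the ideal in \<open>qsmult\<close> matters for c = 0: scaling
    alone would give the zero function, not the zero coset.\<close>
  have q: "qsmult I c X = cls (\<lambda>p. c * f p)"
  proof
    show "qsmult I c X \<subseteq> cls (\<lambda>p. c * f p)"
    proof
      fix x assume "x \<in> qsmult I c X"
      then obtain h g where "h \<in> I" "g \<in> I" "x = (\<lambda>p. c * (h p + f p) + g p)"
        by (auto simp: qsmult_def f(2) cls_altdef)
      then show "x \<in> cls (\<lambda>p. c * f p)"
        unfolding cls_altdef using I_lin[of h g c 1]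
        by (auto simp: algebra_simps intro!: exI[of _ "\<lambda>p. c * h p + g p"])
    qed
    show "cls (\<lambda>p. c * f p) \<subseteq> qsmult I c X"
    proof
      fix x assume "x \<in> cls (\<lambda>p. c * f p)"
      then obtain h where "h \<in> I" "x = (\<lambda>p. h p + c * f p)" by (auto simp: cls_altdef)
      moreover have "f \<in> X" using I_zero by (force simp: f(2) cls_altdef)
      ultimately show "x \<in> qsmult I c X" by (force simp: qsmult_def add.commute)
    qed
  qed
  have "(\<lambda>p. c * f p) \<in> bcar" using bcar_lin[OF f(1) f(1), of c 0] by simp
  then show "qsmult I c X \<in> carrier B" unfolding q carrier_B by blast
  show "bmat (qsmult I c X) s t = smult c (bmat X s t)"
    unfolding q using mat_lin[of f f c 0] bcar_carrier[OF f(1)] carrier_lin[of f f c 0]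
    by (simp add: f(2) bmat_cls)
qed

end

text \<open>Thin means that, for boundary vertices s and t, the paths from s to t of one weight span
  a space of dimension at most one modulo the relations. This is what makes the matrix a complete
  invariant of an element.\<close>

locale thin_dimer = graded_dimer D wt N for D :: "('v, 'a) dimer" and wt N +
  assumes thin: "\<And>s t as bs. s \<in> boundary_vertices D \<Longrightarrow> t \<in> boundary_vertices D \<Longrightarrow>
     walk D s as t \<Longrightarrow> walk D s bs t \<Longrightarrow> sum_list (map wt as) = sum_list (map wt bs) \<Longrightarrow> pcong D as bs"
begin

definition degs :: "'v \<Rightarrow> 'v \<Rightarrow> nat set" where
  "degs s t = {sum_list (map wt as) | as. walk D s as t}"

text \<open>The choice depends only on start, end and weight, so all paths with the same data share
  one representative (\<open>rep_eq\<close>).\<close>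

definition rep :: "'v \<times> 'a list \<Rightarrow> 'v \<times> 'a list" where
  "rep p = (SOME q. q \<in> qpaths D \<and> fst q = fst p \<and> ed q = ed p \<and> dg q = dg p)"

lemma rep:
  assumes "p \<in> qpaths D"
  shows "rep p \<in> qpaths D" "fst (rep p) = fst p" "ed (rep p) = ed p" "dg (rep p) = dg p"
proof -
  have "rep p \<in> qpaths D \<and> fst (rep p) = fst p \<and> ed (rep p) = ed p \<and> dg (rep p) = dg p"
    unfolding rep_def by (rule someI[of _ p]) (use assms in simp)
  then show "rep p \<in> qpaths D" "fst (rep p) = fst p" "ed (rep p) = ed p" "dg (rep p) = dg p" by auto
qed

lemma rep_eq: "fst p = fst q \<Longrightarrow> ed p = ed q \<Longrightarrow> dg p = dg q \<Longrightarrow> rep p = rep q"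
  by (simp add: rep_def)

text \<open>Split f into the sum of f p (p - rep p) and the sum of f p (rep p). Thinness puts the
  first sum into the ideal; in the second, the coefficient at a representative is a coefficient of a
  matrix entry, hence zero.\<close>

lemma mat_zero_ideal:
  assumes f: "f \<in> bcar" and z: "\<And>s t. mat f s t = 0"
  shows "f \<in> I"
proof -
  let ?X = "{p. f p \<noteq> 0}"
  have fin: "finite ?X" and qp: "\<And>p. p \<in> ?X \<Longrightarrow> p \<in> qpaths D \<and> fst p \<in> bV \<and> ed p \<in> bV"
    using f by (auto simp: bcar_def pa_simps(4))
  have "(\<lambda>q. f p * (pbasis p q - pbasis (rep p) q)) \<in> I" if "p \<in> ?X" for p
  proof (rule I_scale)
    have r: "walk D (fst p) (snd p) (ed p)" "walk D (fst p) (snd (rep p)) (ed p)"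
      using qp[OF that] rep[of p] qp_walk by metis+
    have "pcong D (snd p) (snd (rep p))"
      by (rule thin[of "fst p" "ed p"]) (use qp[OF that] r rep(4)[of p] in \<open>auto simp: dg_def\<close>)
    from pcong_ideal[OF this r(1)] rep(2)[of p] qp[OF that]
    show "(\<lambda>q. pbasis p q - pbasis (rep p) q) \<in> I" by (metis prod.collapse)
  qed
  from I_sum[OF fin this]
  have "(\<lambda>q. \<Sum>p\<in>?X. f p * (pbasis p q - pbasis (rep p) q)) \<in> I" .
  moreover have "(\<Sum>p\<in>?X. f p * (pbasis p q - pbasis (rep p) q)) = f q" for q
  proof -
    have "(\<Sum>p\<in>?X. f p * pbasis p q) = (\<Sum>p\<in>?X. if q = p then f p else 0)"
      by (rule sum.cong) (auto simp: pbasis_def)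
    also have "\<dots> = f q" using fin by (subst sum.delta'[OF fin]) auto
    finally have 1: "(\<Sum>p\<in>?X. f p * pbasis p q) = f q" .
    have 2: "(\<Sum>p\<in>?X. f p * pbasis (rep p) q) = 0"
    proof (cases "\<exists>p\<in>?X. q = rep p")
      case True
      then obtain p0 where p0: "p0 \<in> ?X" "q = rep p0" by blast
      have "(\<Sum>p\<in>?X. f p * pbasis (rep p) q) =
         (\<Sum>p\<in>?X. if fst p = fst p0 \<and> ed p = ed p0 \<and> dg p = dg p0 then f p else 0)"
      proof (rule sum.cong[OF refl])
        fix p assume p: "p \<in> ?X"
        have "q = rep p \<longleftrightarrow> fst p = fst p0 \<and> ed p = ed p0 \<and> dg p = dg p0"
          using rep_eq[of p p0] rep(2-4)[of p] rep(2-4)[of p0] qp[OF p] qp[OF p0(1)] p0(2) by metis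
        then show "f p * pbasis (rep p) q =
           (if fst p = fst p0 \<and> ed p = ed p0 \<and> dg p = dg p0 then f p else 0)"
          by (simp add: pbasis_def)
      qed
      also have "\<dots> = coeff (mat f (fst p0) (ed p0)) (dg p0)"
        using coeff_mat[OF bcar_carrier[OF f]] by simp
      finally show ?thesis by (simp add: z)
    next
      case False
      then have "f p * pbasis (rep p) q = 0" if "p \<in> ?X" for p
        using that unfolding pbasis_def by (metis mult_zero_right)
      then show ?thesis by (rule sum.neutral[OF ballI])
    qed
    show ?thesis using 1 2 by (simp add: right_diff_distrib sum_subtractf)
  qed
  ultimately show ?thesis by simp
qed

text \<open>The image of \<open>bmat\<close>. It is given by the boundary vertices and the sets
  \<open>degs\<close> alone, so two dimers can be compared through it.\<close>

definition target :: "('v \<Rightarrow> 'v \<Rightarrow> complex poly) set" where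
  "target = {G. \<forall>s t. (G s t \<noteq> 0 \<longrightarrow> s \<in> bV \<and> t \<in> bV) \<and> (\<forall>m. coeff (G s t) m \<noteq> 0 \<longrightarrow> m \<in> degs s t)}"

lemma bmat_target: assumes "X \<in> carrier B" shows "bmat X \<in> target"
proof -
  obtain f where f: "f \<in> bcar" "X = cls f" by (rule carrier_BE[OF assms])
  have "m \<in> degs s t" if "coeff (mat f s t) m \<noteq> 0" for s t m
  proof -
    from that have "\<exists>p. f p \<noteq> 0 \<and> fst p = s \<and> ed p = t \<and> dg p = m"
      unfolding coeff_mat[OF bcar_carrier[OF f(1)]]
      by (rule contrapos_np) (intro sum.neutral, auto)
    then obtain p where "f p \<noteq> 0" "fst p = s" "ed p = t" "dg p = m" by blast
    with f(1) show ?thesis unfolding degs_def bcar_def pa_simps(4) qp_walk dg_def by blast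
  qed
  moreover have "s \<in> bV \<and> t \<in> bV" if "mat f s t \<noteq> 0" for s t
    using mat_bcar_outside[OF f(1)] that by blast
  ultimately show ?thesis by (auto simp: target_def f bmat_cls bcar_carrier)
qed

lemma bmat_inj: "inj_on bmat (carrier B)"
proof (rule inj_onI)
  fix X Y assume X: "X \<in> carrier B" and Y: "Y \<in> carrier B" and e: "bmat X = bmat Y"
  obtain f where f: "f \<in> bcar" "f \<in> carrier A" "X = cls f" by (rule carrier_BE[OF X])
  obtain g where g: "g \<in> bcar" "g \<in> carrier A" "Y = cls g" by (rule carrier_BE[OF Y])
  note c = f(2) g(2)
  have "(\<lambda>p. 1 * f p + - 1 * g p) \<in> I"
  proof (rule mat_zero_ideal)
    show "(\<lambda>p. 1 * f p + - 1 * g p) \<in> bcar" by (rule bcar_lin[OF f(1) g(1)])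
    have "mat f = mat g" using e by (simp only: f(3) g(3) bmat_cls[OF f(2)] bmat_cls[OF g(2)])
    then show "mat (\<lambda>p. 1 * f p + - 1 * g p) s t = 0" for s t
      unfolding mat_lin[OF c] by simp
  qed
  then have d: "(\<lambda>p. f p - g p) \<in> I" by simp
  have "cls f = cls g"
  proof safe
    fix x assume "x \<in> cls f"
    then obtain h where "h \<in> I" "x = (\<lambda>p. h p + f p)" by (auto simp: cls_altdef)
    with I_lin[OF _ d, of h 1 1] show "x \<in> cls g"
      unfolding cls_altdef by (auto intro!: exI[of _ "\<lambda>p. h p + (f p - g p)"])
  next
    fix x assume "x \<in> cls g"
    then obtain h where "h \<in> I" "x = (\<lambda>p. h p + g p)" by (auto simp: cls_altdef)
    with I_lin[OF _ d, of h 1 "-1"] show "x \<in> cls f"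
      unfolding cls_altdef by (auto intro!: exI[of _ "\<lambda>p. h p + (g p - f p)"])
  qed
  then show "X = Y" by (simp only: f(3) g(3))
qed

lemma bmat_surj: assumes G: "G \<in> target" shows "G \<in> bmat ` carrier B"
proof -
  define f where "f p = (if p \<in> qpaths D \<and> fst p \<in> bV \<and> ed p \<in> bV \<and> rep p = p
     then coeff (G (fst p) (ed p)) (dg p) else 0)" for p
  \<comment> \<open>Degrees bound the weights, so only finitely many chosen paths carry a
    coefficient; the \<open>SOME\<close> term repeats the choice made in \<open>rep\<close>.\<close>
  let ?Y = "\<Union>s\<in>bV. \<Union>t\<in>bV. \<Union>m\<le>degree (G s t). {SOME q. q \<in> qpaths D \<and> fst q = s \<and> ed q = t \<and> dg q = m}"
  have fbV: "finite bV" using finite_subset[OF bV_dV finite_dV] .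
  have "{p. f p \<noteq> 0} \<subseteq> ?Y"
  proof
    fix p assume "p \<in> {p. f p \<noteq> 0}"
    then have p: "p \<in> qpaths D" "fst p \<in> bV" "ed p \<in> bV" "rep p = p" "coeff (G (fst p) (ed p)) (dg p) \<noteq> 0"
      by (auto simp: f_def split: if_splits)
    then show "p \<in> ?Y" using le_degree[OF p(5)] unfolding rep_def by force
  qed
  then have fin: "finite {p. f p \<noteq> 0}" by (rule finite_subset) (auto simp: fbV)
  then have f: "f \<in> bcar" by (auto simp: bcar_def pa_simps(4) f_def split: if_splits)
  have "coeff (mat f s t) m = coeff (G s t) m" for s t m
  proof (cases "s \<in> bV \<and> t \<in> bV \<and> m \<in> degs s t")
    case False
    then have "coeff (G s t) m = 0" using G unfolding target_def by fastforce
    moreover have "coeff (mat f s t) m = 0"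
      unfolding coeff_mat[OF bcar_carrier[OF f]] using False
      by (intro sum.neutral) (auto simp: f_def degs_def qp_walk dg_def)
    ultimately show ?thesis by simp
  next
    case True
    then obtain as where as: "walk D s as t" "m = sum_list (map wt as)" unfolding degs_def by blast
    let ?r = "rep (s, as)"
    have qp: "(s, as) \<in> qpaths D" "ed (s, as) = t" using as walk_pend[OF as(1)] by (auto simp: qp_walk)
    note r = rep[OF qp(1)]
    have rr: "rep ?r = ?r" by (rule rep_eq) (use r in auto)
    have "coeff (mat f s t) m = (\<Sum>p | f p \<noteq> 0. if p = ?r then f ?r else 0)"
      unfolding coeff_mat[OF bcar_carrier[OF f]]
    proof (rule sum.cong[OF refl])
      fix p assume "p \<in> {p. f p \<noteq> 0}"
      then have p: "rep p = p" by (auto simp: f_def split: if_splits)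
      have "fst p = s \<and> ed p = t \<and> dg p = m \<longleftrightarrow> p = ?r"
        using rep_eq[of p "(s, as)"] p r qp as by (auto simp: dg_def)
      then show "(if fst p = s \<and> ed p = t \<and> dg p = m then f p else 0) = (if p = ?r then f ?r else 0)"
        by auto
    qed
    also have "\<dots> = f ?r" using fin by (simp add: sum.delta[OF fin])
    also have "\<dots> = coeff (G s t) m" using True r rr qp as by (simp add: f_def dg_def)
    finally show ?thesis .
  qed
  then have "mat f = G" by (auto simp: fun_eq_iff poly_eq_iff)
  then show ?thesis using f bmat_cls[OF bcar_carrier[OF f]] unfolding carrier_B by (metis imageI)
qed

lemma bmat_bij: "bij_betw bmat (carrier B) target"
  unfolding bij_betw_def using bmat_inj bmat_target bmat_surj by blast

end

text \<open>The two quivers share their vertex type but not their arrows, so the matrix images lie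
  in one set and coincide there; one identification followed by the inverse of the other is the
  isomorphism.\<close>

lemma thin_dimers_isomorphic:
  fixes D1 :: "('v, 'a) dimer" and D2 :: "('v, 'b) dimer"
  assumes D1: "thin_dimer D1 wt1 N1" and D2: "thin_dimer D2 wt2 N2"
    and bV: "boundary_vertices D1 = boundary_vertices D2"
    and degs: "\<And>s t. s \<in> boundary_vertices D1 \<Longrightarrow> t \<in> boundary_vertices D1 \<Longrightarrow>
       thin_dimer.degs D1 wt1 s t = thin_dimer.degs D2 wt2 s t"
  shows "boundary_algebras_isomorphic D1 D2"
proof -
  interpret D1: thin_dimer D1 wt1 N1 by (rule D1)
  interpret D2: thin_dimer D2 wt2 N2 by (rule D2)
  \<comment> \<open>Matrix entries outside the boundary vanish, so agreement of \<open>degs\<close>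
    on boundary vertices suffices.\<close>
  have tt: "D1.target = D2.target"
    unfolding D1.target_def D2.target_def using degs bV by (auto; metis coeff_0)
  define \<phi> where "\<phi> X = inv_into (carrier D2.B) D2.bmat (D1.bmat X)" for X
  have bij: "bij_betw \<phi> (carrier D1.B) (carrier D2.B)"
    using bij_betw_trans[OF D1.bmat_bij, of "inv_into (carrier D2.B) D2.bmat" "carrier D2.B"]
      bij_betw_inv_into[OF D2.bmat_bij] by (simp add: tt \<phi>_def[abs_def] comp_def)
  have \<phi>c: "\<phi> X \<in> carrier D2.B" if "X \<in> carrier D1.B" for X
    using bij_betwE[OF bij] that by blast
  have \<phi>m: "D2.bmat (\<phi> X) = D1.bmat X" if "X \<in> carrier D1.B" for X
    unfolding \<phi>_def using D2.bmat_bij D1.bmat_target[OF that] tt by (metis bij_betw_inv_into_right)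
  \<comment> \<open>Elements of the second algebra are recognised by their matrices, so each law of
    an algebra homomorphism becomes an identity of matrix entries.\<close>
  have \<phi>I: "\<phi> X = Y" if "X \<in> carrier D1.B" "Y \<in> carrier D2.B" "\<And>s t. D1.bmat X s t = D2.bmat Y s t" for X Y
    using inj_onD[OF D2.bmat_inj _ \<phi>c[OF that(1)] that(2)] \<phi>m[OF that(1)] that(3) by (simp add: fun_eq_iff)
  have "\<phi> \<in> ring_iso D1.B D2.B"
  proof (rule ring_iso_memI)
    fix X Y assume X: "X \<in> carrier D1.B" and Y: "Y \<in> carrier D1.B"
    show "\<phi> (X \<otimes>\<^bsub>D1.B\<^esub> Y) = \<phi> X \<otimes>\<^bsub>D2.B\<^esub> \<phi> Y"
      by (rule \<phi>I) (simp_all add: D1.bmat_mult[OF X Y] D2.bmat_mult[OF \<phi>c[OF X] \<phi>c[OF Y]] \<phi>m X Y bV)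
    show "\<phi> (X \<oplus>\<^bsub>D1.B\<^esub> Y) = \<phi> X \<oplus>\<^bsub>D2.B\<^esub> \<phi> Y"
      by (rule \<phi>I) (simp_all add: D1.bmat_add[OF X Y] D2.bmat_add[OF \<phi>c[OF X] \<phi>c[OF Y]] \<phi>m X Y)
  next
    show "\<phi> \<one>\<^bsub>D1.B\<^esub> = \<one>\<^bsub>D2.B\<^esub>"
      by (rule \<phi>I) (simp_all add: D1.bmat_one D2.bmat_one bV)
  qed (use \<phi>c bij in auto)
  moreover have "\<phi> (qsmult D1.I c X) = qsmult D2.I c (\<phi> X)" if X: "X \<in> carrier D1.B" for c X
    by (rule \<phi>I) (simp_all add: D1.bmat_qsmult[OF X] D2.bmat_qsmult[OF \<phi>c[OF X]] \<phi>m X)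
  ultimately show ?thesis unfolding boundary_algebras_isomorphic_def by blast
qed

section \<open>Triangulations and paths turning about a polygon vertex\<close>

locale triangulated_polygon =
  fixes n :: nat and T :: "nat set set"
  assumes n3: "3 \<le> n" and triangulation: "triangulation n T"
begin

text \<open>Polygon vertices are labelled by arbitrary natural numbers, read modulo \<open>n\<close>; a list of
  labels in anticlockwise order can then be chosen increasing in a window of length \<open>n\<close>.\<close>

definition S :: "nat \<Rightarrow> nat \<Rightarrow> bool" where "S x y \<longleftrightarrow> {x mod n, y mod n} \<in> sides n T"

abbreviation Gm :: "nat \<Rightarrow> nat \<Rightarrow> nat \<Rightarrow> gl2_arrow" where
  "Gm a b c \<equiv> Gam (a mod n) (b mod n) (c mod n)"
abbreviation Al :: "nat \<Rightarrow> gl2_arrow" where "Al a \<equiv> Alpha (a mod n)"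
abbreviation Be :: "nat \<Rightarrow> gl2_arrow" where "Be a \<equiv> Beta (a mod n)"
abbreviation Sd :: "nat \<Rightarrow> nat \<Rightarrow> gl2_vertex" where "Sd a b \<equiv> Side {a mod n, b mod n}"
abbreviation Cn :: "nat \<Rightarrow> gl2_vertex" where "Cn a \<equiv> Corner (a mod n)"

section \<open>Labels modulo n and non-crossing sides\<close>

lemma S_sym: "S x y \<longleftrightarrow> S y x"
  by (simp add: S_def insert_commute)

lemma S_add [simp]: "S (x + n) y = S x y" "S x (y + n) = S x y"
  by (simp_all add: S_def)

lemma S_Suc: "S x (Suc x)"
proof -
  have "x mod n < n" "{x mod n, Suc x mod n} = {x mod n, Suc (x mod n) mod n}"
    using n3 by (auto simp: mod_Suc_eq)
  then show ?thesis unfolding S_def sides_def by blast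
qed

text \<open>Within one window at most one wrap occurs; stating both outcomes linearly lets linear
  arithmetic settle later comparisons of residues.\<close>

lemma mod_lift:
  assumes "a \<le> b" "b < a + n"
  shows "a mod n + (b - a) < n \<and> b mod n = a mod n + (b - a) \<or>
     n \<le> a mod n + (b - a) \<and> b mod n + n = a mod n + (b - a)"
proof -
  have b: "b mod n = (a mod n + (b - a)) mod n"
    using assms(1) mod_add_left_eq[of a n "b - a"] by simp
  have an: "a mod n < n" using n3 by simp
  show ?thesis
  proof (cases "a mod n + (b - a) < n")
    case True
    then show ?thesis using b by simp
  next
    case False
    have "(a mod n + (b - a)) mod n = (a mod n + (b - a) - n) mod n"
      using False by (simp add: le_mod_geq)
    also have "\<dots> = a mod n + (b - a) - n"
      by (rule mod_less) (use an assms False in linarith)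
    finally show ?thesis using False b by simp
  qed
qed

lemma mod_inj: "a \<le> b \<Longrightarrow> b < a + n \<Longrightarrow> a mod n = b mod n \<Longrightarrow> a = b"
  using mod_lift[of a b] by linarith

lemma side_in_T:
  assumes "a < b" "b < a + n" "b \<noteq> Suc a" "Suc b \<noteq> a + n" "S a b"
  shows "{a mod n, b mod n} \<in> T"
proof (rule ccontr)
  assume "\<not> ?thesis"
  then obtain i where i: "i < n" "{a mod n, b mod n} = {i, Suc i mod n}"
    using assms(5) by (auto simp: S_def sides_def)
  from i(2) consider "a mod n = i" "b mod n = Suc i mod n" | "b mod n = i" "a mod n = Suc i mod n"
    by (auto simp: doubleton_eq_iff)
  then show False
  proof cases
    case 1
    then have "Suc a mod n = b mod n" using mod_Suc_eq[of a n] by simp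
    with mod_inj[of "Suc a" b] assms show False by simp
  next
    case 2
    then have "Suc b mod n = (a + n) mod n" using mod_Suc_eq[of b n] by simp
    with mod_inj[of "Suc b" "a + n"] assms show False by simp
  qed
qed

lemma crossesI: "p < q \<Longrightarrow> q < r \<Longrightarrow> r < s \<Longrightarrow> crosses {p, r} {q, s} \<and> crosses {q, s} {p, r}"
  unfolding crosses_def by blast

text \<open>Labels increasing within one window wrap around at most once, so their residues appear
  in one of four rotated orders.\<close>

lemma cyclic_cases:
  fixes \<alpha> \<beta> \<gamma> \<delta> j k m N :: nat
  assumes l: "0 < j" "j < k" "k < m" "m < N" "\<alpha> < N"
    and B: "\<alpha> + j < N \<and> \<beta> = \<alpha> + j \<or> N \<le> \<alpha> + j \<and> \<beta> + N = \<alpha> + j"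
    and C: "\<alpha> + k < N \<and> \<gamma> = \<alpha> + k \<or> N \<le> \<alpha> + k \<and> \<gamma> + N = \<alpha> + k"
    and D: "\<alpha> + m < N \<and> \<delta> = \<alpha> + m \<or> N \<le> \<alpha> + m \<and> \<delta> + N = \<alpha> + m"
  shows "\<alpha> < \<beta> \<and> \<beta> < \<gamma> \<and> \<gamma> < \<delta> \<or> \<delta> < \<alpha> \<and> \<alpha> < \<beta> \<and> \<beta> < \<gamma> \<or>
    \<gamma> < \<delta> \<and> \<delta> < \<alpha> \<and> \<alpha> < \<beta> \<or> \<beta> < \<gamma> \<and> \<gamma> < \<delta> \<and> \<delta> < \<alpha>"
  using B
proof
  assume b: "\<alpha> + j < N \<and> \<beta> = \<alpha> + j"
  show ?thesis using C
  proof
    assume c: "\<alpha> + k < N \<and> \<gamma> = \<alpha> + k"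
    show ?thesis using D by (rule disjE) (use l b c in linarith)+
  next
    assume c: "N \<le> \<alpha> + k \<and> \<gamma> + N = \<alpha> + k"
    then have "N \<le> \<alpha> + m \<and> \<delta> + N = \<alpha> + m" using D l by auto
    then show ?thesis using b c l by linarith
  qed
next
  assume b: "N \<le> \<alpha> + j \<and> \<beta> + N = \<alpha> + j"
  then have "N \<le> \<alpha> + k \<and> \<gamma> + N = \<alpha> + k" "N \<le> \<alpha> + m \<and> \<delta> + N = \<alpha> + m"
    using C D l by auto
  then show ?thesis using b l by linarith
qed

text \<open>\<open>crosses\<close> compares residues, while labels may wrap; in each of the four
  rotations the ends of the two sides still alternate. The labels strictly inside both arcs show
  that the two sides are diagonals, hence in \<open>T\<close>.\<close>

lemma noncrossing:
  assumes l: "a < b" "b < c" "c < d" "d < a + n" and "S a c" "S b d"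
  shows False
proof -
  have T: "{a mod n, c mod n} \<in> T" "{b mod n, d mod n} \<in> T"
    by (rule side_in_T; use assms in linarith)+
  have an: "a mod n < n" using n3 by simp
  obtain j where j: "b = a + j" "0 < j" using l(1) less_imp_add_positive by blast
  obtain k where k: "c = a + k" "j < k" using l(2) j less_imp_add_positive[of b c] by auto
  obtain m where m: "d = a + m" "k < m" "m < n" using l(3,4) k less_imp_add_positive[of c d] by auto
  note L = mod_lift[of a b, unfolded j(1)] mod_lift[of a c, unfolded k(1)] mod_lift[of a d, unfolded m(1)]
  consider "a mod n < b mod n" "b mod n < c mod n" "c mod n < d mod n"
    | "d mod n < a mod n" "a mod n < b mod n" "b mod n < c mod n"
    | "c mod n < d mod n" "d mod n < a mod n" "a mod n < b mod n"
    | "b mod n < c mod n" "c mod n < d mod n" "d mod n < a mod n"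
    using cyclic_cases[OF j(2) k(2) m(2,3) an, of "b mod n" "c mod n" "d mod n"] L j k m by auto
  then have "crosses {a mod n, c mod n} {b mod n, d mod n}"
  proof cases
    case 1
    then show ?thesis using crossesI by blast
  next
    case 2
    then show ?thesis using crossesI[of "d mod n" "a mod n" "b mod n" "c mod n"] by (simp add: insert_commute)
  next
    case 3
    then show ?thesis using crossesI[of "c mod n" "d mod n" "a mod n" "b mod n"] by (simp add: insert_commute)
  next
    case 4
    then show ?thesis using crossesI[of "b mod n" "c mod n" "d mod n" "a mod n"] by (simp add: insert_commute)
  qed
  with T triangulation show False unfolding triangulation_def by blast
qed

lemma is_diagonalI:
  assumes "x < n" "y < n" "x < y" "{x, y} \<notin> sides n T"
  shows "is_diagonal n {x, y}"
proof -
  have "{x, Suc x mod n} \<in> sides n T" using assms(1) by (auto simp: sides_def)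
  then have "y \<noteq> Suc x" using assms by auto
  moreover have "{n - 1, Suc (n - 1) mod n} \<in> sides n T"
    unfolding sides_def using n3 by (intro UnI1 CollectI exI[of _ "n - 1"]) auto
  then have "{n - 1, 0} \<in> sides n T" using n3 by simp
  then have "\<not> (x = 0 \<and> y = n - 1)" using assms(4) by (auto simp: insert_commute)
  ultimately show ?thesis unfolding is_diagonal_def using assms by blast
qed

text \<open>The passage back from residues to labels. Four orders of the ends are possible; in each,
  p and q arise by adding to y the anticlockwise distance to an end of e, with n added when the
  distance wraps.\<close>

lemma crossing_lift:
  assumes yz: "y < z" "z < y + n" and cr: "crosses {y mod n, z mod n} e" and e: "is_diagonal n e"
  shows "\<exists>p q. y < p \<and> p < z \<and> z < q \<and> q < y + n \<and> e = {p mod n, q mod n}"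
proof -
  obtain a b c d where *: "{y mod n, z mod n} = {a, b} \<and> e = {c, d} \<or> {y mod n, z mod n} = {c, d} \<and> e = {a, b}"
    and o: "a < c" "c < b" "b < d" using cr unfolding crosses_def by blast
  have yn: "y mod n < n" "z mod n < n" using n3 by auto
  have "d < n"
  proof -
    have "d \<in> {y mod n, z mod n} \<or> d \<in> e" using * by blast
    with yn e show ?thesis by (auto simp: is_diagonal_def)
  qed
  have m: "(y + k) mod n = w" if "(y mod n + k = w \<or> y mod n + k = w + n) \<and> w < n" for k w
    using that by (metis mod_add_left_eq mod_add_self2 mod_less)
  obtain k where k: "z = y + k" "0 < k" "k < n" using yz less_imp_add_positive[of y z] by auto
  have L: "y mod n + k < n \<and> z mod n = y mod n + k \<or> n \<le> y mod n + k \<and> z mod n + n = y mod n + k"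
    using mod_lift[of y z] yz k(1) by simp
  from * consider "y mod n = a" "z mod n = b" "e = {c, d}" | "y mod n = b" "z mod n = a" "e = {c, d}"
    | "y mod n = c" "z mod n = d" "e = {a, b}" | "y mod n = d" "z mod n = c" "e = {a, b}"
    by (auto simp: doubleton_eq_iff)
  then show ?thesis
  proof cases
    case 1
    then have "b = a + k" using L k yn o by auto
    have "(y + (c - a)) mod n = c" "(y + (d - a)) mod n = d" by (rule m; use 1 o \<open>d < n\<close> in linarith)+
    moreover have "y < y + (c - a)" "y + (c - a) < z" "z < y + (d - a)" "y + (d - a) < y + n"
      using \<open>b = a + k\<close> o \<open>d < n\<close> k by linarith+
    ultimately show ?thesis using 1 by metis
  next
    case 2
    then have "a + n = b + k" using L k yn o by auto
    have "(y + (d - b)) mod n = d" "(y + (c + n - b)) mod n = c" by (rule m; use 2 o \<open>d < n\<close> in linarith)+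
    moreover have "y < y + (d - b)" "y + (d - b) < z" "z < y + (c + n - b)" "y + (c + n - b) < y + n"
      using \<open>a + n = b + k\<close> o \<open>d < n\<close> k by linarith+
    ultimately show ?thesis using 2 insert_commute[of c d "{}"] by metis
  next
    case 3
    then have "d = c + k" using L k yn o by auto
    have "(y + (b - c)) mod n = b" "(y + (a + n - c)) mod n = a" by (rule m; use 3 o \<open>d < n\<close> in linarith)+
    moreover have "y < y + (b - c)" "y + (b - c) < z" "z < y + (a + n - c)" "y + (a + n - c) < y + n"
      using \<open>d = c + k\<close> o \<open>d < n\<close> k by linarith+
    ultimately show ?thesis using 3 insert_commute[of a b "{}"] by metis
  next
    case 4
    then have "c + n = d + k" using L k yn o by auto
    have "(y + (a + n - d)) mod n = a" "(y + (b + n - d)) mod n = b" by (rule m; use 4 o \<open>d < n\<close> in linarith)+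
    moreover have "y < y + (a + n - d)" "y + (a + n - d) < z" "z < y + (b + n - d)" "y + (b + n - d) < y + n"
      using \<open>c + n = d + k\<close> o \<open>d < n\<close> k by linarith+
    ultimately show ?thesis using 4 by metis
  qed
qed

text \<open>Two consecutive neighbours of a polygon vertex span a triangle with it: a diagonal of \<open>T\<close>
  separating them would have to cross one of the two given sides.\<close>

lemma consecutive_side:
  assumes l: "v < y" "y < z" "z < v + n" and S: "S v y" "S v z"
    and gap: "\<And>w. y < w \<Longrightarrow> w < z \<Longrightarrow> \<not> S v w"
  shows "S y z"
proof (rule ccontr)
  assume ns: "\<not> S y z"
  have "y mod n \<noteq> z mod n" using mod_inj[of y z] l by auto
  moreover have "y mod n < n" "z mod n < n" using n3 by auto
  moreover have "{y mod n, z mod n} \<notin> sides n T" "{z mod n, y mod n} \<notin> sides n T"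
    using ns by (simp_all add: S_def insert_commute)
  ultimately consider "is_diagonal n {y mod n, z mod n}" | "is_diagonal n {z mod n, y mod n}"
    using is_diagonalI by (meson linorder_neqE_nat)
  then have d: "is_diagonal n {y mod n, z mod n}"
    by cases (simp_all only: insert_commute[of "z mod n"])
  have "{y mod n, z mod n} \<notin> T" using ns unfolding S_def sides_def by blast
  with d obtain e where e: "e \<in> T" "crosses {y mod n, z mod n} e"
    using triangulation unfolding triangulation_def by blast
  have "is_diagonal n e" using e triangulation unfolding triangulation_def by blast
  moreover have "z < y + n" using l by simp
  ultimately obtain p q where pq: "y < p" "p < z" "z < q" "q < y + n" "e = {p mod n, q mod n}"
    using crossing_lift[OF l(2) _ e(2)] by blast
  have Spq: "S p q" unfolding S_def sides_def using pq(5) e(1) by blast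
  \<comment> \<open>The far end q of the crossing diagonal lies before v, at v or beyond v. It then
    crosses vz, gives v a neighbour inside the gap, or crosses vy.\<close>
  consider "q < v + n" | "q = v + n" | "v + n < q" by linarith
  then show False
  proof cases
    case 1
    show ?thesis by (rule noncrossing[of v p z q]) (use 1 pq l S Spq in auto)
  next
    case 2
    then have "S v p" using Spq S_add(1)[of v p] S_sym[of p q] by metis
    then show ?thesis using gap pq by blast
  next
    case 3
    have "S (q - n) p" using Spq 3 S_add(1)[of "q - n" p] S_sym[of p q] by simp
    then show ?thesis by (intro noncrossing[of v "q - n" y p]) (use pq l S 3 in auto)
  qed
qed

text \<open>The search for the next neighbour of a is not confined to a window, so it always
  succeeds (\<open>nx\<close>) and commutes with full turns (\<open>nx_add\<close>).\<close>

definition nx :: "nat \<Rightarrow> nat \<Rightarrow> nat" where "nx a z = (LEAST w. z < w \<and> S a w)"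

text \<open>The arrows turning about the polygon vertex \<open>a\<close> from the side \<open>ax\<close> to the side \<open>ay\<close>.\<close>

definition piv :: "nat \<Rightarrow> nat \<Rightarrow> nat \<Rightarrow> gl2_arrow list" where
  "piv a x y = map (\<lambda>z. Gm a z (nx a z)) (filter (S a) [x..<y])"

section \<open>Turning about a vertex\<close>

lemma S_shift: "S a x \<Longrightarrow> S a (x + n * k)"
  by (simp add: S_def)

lemma nx: "z < nx a z" "S a (nx a z)" "z < w \<Longrightarrow> S a w \<Longrightarrow> nx a z \<le> w"
proof -
  \<comment> \<open>A copy of the polygon neighbour a + 1, shifted by enough full turns to exceed
    z.\<close>
  let ?k = "Suc a + n * Suc z"
  have "z < ?k" using n3 by (cases n) auto
  moreover have "S a ?k" by (rule S_shift[OF S_Suc])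
  ultimately have "z < nx a z \<and> S a (nx a z)"
    unfolding nx_def using LeastI[of "\<lambda>w. z < w \<and> S a w" ?k] by blast
  then show "z < nx a z" "S a (nx a z)" by auto
  show "z < w \<Longrightarrow> S a w \<Longrightarrow> nx a z \<le> w"
    unfolding nx_def using Least_le[of "\<lambda>w. z < w \<and> S a w" w] by blast
qed

lemma nx_eq: "z < w \<Longrightarrow> S a w \<Longrightarrow> (\<And>u. z < u \<Longrightarrow> u < w \<Longrightarrow> \<not> S a u) \<Longrightarrow> nx a z = w"
  using nx(1)[of z a] nx(2)[of a z] nx(3)[of z w a] by (metis le_neq_implies_less)

lemma nx_add: "nx a (z + n) = nx a z + n"
proof (rule nx_eq)
  fix u assume u: "z + n < u" "u < nx a z + n"
  then have "S a (u - n) \<longleftrightarrow> S a u" using S_add(2)[of a "u - n"] by simp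
  moreover have "z < u - n" "u - n < nx a z" using u by linarith+
  ultimately show "\<not> S a u" using nx(3)[of z "u - n" a] by auto
qed (use nx(1)[of z a] nx(2)[of a z] in auto)

lemma piv_refl [simp]: "piv a x x = []"
  by (simp add: piv_def)

lemma piv_append:
  assumes "x \<le> y" "y \<le> z"
  shows "piv a x y @ piv a y z = piv a x z"
proof -
  have "[x..<z] = [x..<y] @ [y..<z]" using upt_add_eq_append[of x y "z - y"] assms by simp
  then show ?thesis by (simp add: piv_def)
qed

lemma map_add_upt_shift: "map (\<lambda>i. i + k) [x..<y] = [x + k..<y + k :: nat]"
  by (induction y) auto

lemma piv_add [simp]: "piv a (x + n) (y + n) = piv a x y"
proof -
  have "[x + n..<y + n] = map (\<lambda>i. i + n) [x..<y]" by (simp add: map_add_upt_shift)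
  then show ?thesis by (simp add: piv_def filter_map comp_def nx_add)
qed

lemma piv_center_add [simp]: "piv (a + n) x y = piv a x y"
proof -
  have "S (a + n) = S a" by (rule ext) simp
  then show ?thesis by (simp add: piv_def nx_def)
qed

lemma piv_add_mult: "piv (a + k * n) (x + k * n) (y + k * n) = piv a x y"
proof (induction k)
  case (Suc k)
  have e: "c + Suc k * n = c + k * n + n" for c by simp
  show ?case unfolding e piv_center_add piv_add by (rule Suc.IH)
qed simp

text \<open>By \<open>consecutive_side\<close> the next neighbour b of a after x spans a triangle
  with a and x. Peeling off its arrow is the recursion behind \<open>piv_triangle\<close> and
  \<open>walk_piv\<close>.\<close>

lemma piv_step:
  assumes "a < x" "x < y" "y < a + n" "S a x" "S a y"
  obtains b where "x < b" "b \<le> y" "S a b" "S x b" "piv a x y = Gm a x b # piv a b y"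
proof -
  let ?b = "nx a x"
  have b: "x < ?b" "?b \<le> y" "S a ?b" using nx(1)[of x a] nx(2)[of a x] nx(3)[of x y a] assms by auto
  have gap: "\<not> S a w" if "x < w" "w < ?b" for w using nx(3)[of x w a] that by auto
  have "?b < a + n" using b(2) assms(3) by simp
  from consecutive_side[OF assms(1) b(1) this assms(4) b(3) gap] have "S x ?b" .
  moreover have "filter (S a) [x..<?b] = [x]"
    using b(1) assms(4) gap by (simp add: upt_conv_Cons filter_empty_conv)
  then have "piv a x ?b = [Gm a x ?b]" by (simp add: piv_def)
  then have "piv a x y = Gm a x ?b # piv a ?b y" using piv_append[of x ?b y a] b(1,2) by simp
  ultimately show ?thesis using that[OF b] by blast
qed

text \<open>A further neighbour of a strictly between b and c would cross the side bc.\<close>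

lemma piv_triangle:
  assumes "a < b" "b < c" "c < a + n" "S a b" "S b c" "S a c"
  shows "piv a b c = [Gm a b c]"
proof -
  obtain w where w: "b < w" "w \<le> c" "S a w" "S b w" "piv a b c = Gm a b w # piv a w c"
    by (rule piv_step[OF assms(1-4) assms(6)])
  have "w = c"
  proof (rule ccontr)
    assume "w \<noteq> c"
    then have "w < c" using w(2) by simp
    from noncrossing[OF assms(1) w(1) this assms(3) w(3) assms(5)] show False .
  qed
  with w(5) show ?thesis by simp
qed

text \<open>For a < c this is the path along the boundary from the side {a, a + 1} to the side {c -
  1, c}, through the corners strictly between a and c.\<close>

definition bd :: "nat \<Rightarrow> nat \<Rightarrow> gl2_arrow list" where
  "bd a c = concat (map (\<lambda>i. [Be i, Al i]) [Suc a..<c])"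

lemma bd_append: "a < m \<Longrightarrow> m < c \<Longrightarrow> bd a m @ Be m # Al m # bd m c = bd a c"
proof -
  assume "a < m" "m < c"
  then have "[Suc a..<c] = [Suc a..<m] @ m # [Suc m..<c]"
    by (metis Suc_leI le_add_diff_inverse less_or_eq_imp_le upt_add_eq_append upt_conv_Cons)
  then show ?thesis by (simp add: bd_def)
qed

lemma bd_Suc: "a < m \<Longrightarrow> bd a (Suc m) = bd a m @ [Be m, Al m]"
  by (simp add: bd_def)

lemma bd_Suc_self [simp]: "bd a (Suc a) = []"
  by (simp add: bd_def)

section \<open>Arrows and weights of the quiver in terms of labels\<close>

abbreviation D where "D \<equiv> gl2_dimer n T"

lemma D_simps [simp]:
  "dsrc D (Gm a b c) = Sd a b" "dtgt D (Gm a b c) = Sd a c"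
  "dsrc D (Al a) = Cn a" "dtgt D (Be a) = Cn a"
  "dtgt D (Al a) = Sd a (Suc a)"
  "a < n \<Longrightarrow> Alpha a \<in> dA D" "a < n \<Longrightarrow> Beta a \<in> dA D"
  "a < n \<Longrightarrow> Corner a \<in> dV D"
  using n3 by (auto simp: gl2_dimer_def gl2_src_def gl2_tgt_def mod_Suc_eq)

lemma src_Be [simp]: "dsrc D (Be (Suc a)) = Sd a (Suc a)"
proof -
  have "(Suc a mod n + n - 1) mod n = (Suc a mod n + (n - 1)) mod n" using n3 by simp
  also have "\<dots> = (Suc a + (n - 1)) mod n" by (rule mod_add_left_eq)
  also have "\<dots> = a mod n" using n3 by simp
  finally show ?thesis by (simp add: gl2_dimer_def gl2_src_def)
qed

lemma Sd_dV [simp]: "Sd a b \<in> dV D \<longleftrightarrow> S a b"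
  by (auto simp: gl2_dimer_def S_def)

lemma rk_lift:
  assumes l: "a \<le> b" "b < a + n"
  shows "rk n (a mod n) (b mod n) = b - a"
proof -
  have "a mod n < n" using n3 by simp
  then have "b mod n + n - a mod n = b - a + n \<or> b mod n + n - a mod n = b - a"
    using mod_lift[OF l] by (elim disjE) linarith+
  moreover have h: "(b - a + n) mod n = b - a" "(b - a) mod n = b - a"
    unfolding mod_add_self2 using l by simp_all
  ultimately show ?thesis unfolding rk_def by (elim disjE) (simp_all only: h)
qed

text \<open>\<open>triangles\<close> asks for increasing residues, which increasing labels provide
  only up to a rotation; the second part records the rotations.\<close>

lemma triangle_cases:
  assumes l: "a < b" "b < c" "c < a + n" and S: "S a b" "S b c" "S a c"
  shows "{a mod n, b mod n, c mod n} \<in> triangles n T"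
    and "a mod n < b mod n \<and> b mod n < c mod n \<or> c mod n < a mod n \<and> a mod n < b mod n \<or>
      b mod n < c mod n \<and> c mod n < a mod n"
proof -
  have an: "a mod n < n" "b mod n < n" "c mod n < n" using n3 by auto
  show o: "a mod n < b mod n \<and> b mod n < c mod n \<or> c mod n < a mod n \<and> a mod n < b mod n \<or>
      b mod n < c mod n \<and> c mod n < a mod n"
  proof -
    obtain j where j: "b = a + j" "0 < j" using l(1) less_imp_add_positive by blast
    obtain k where k: "c = a + k" "j < k" "k < n" using l(2,3) j less_imp_add_positive[of b c] by auto
    have "a mod n + j < n \<and> b mod n = a mod n + j \<or> n \<le> a mod n + j \<and> b mod n + n = a mod n + j"
      "a mod n + k < n \<and> c mod n = a mod n + k \<or> n \<le> a mod n + k \<and> c mod n + n = a mod n + k"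
      using mod_lift[of a b] mod_lift[of a c] j k by auto
    then show ?thesis by (elim disjE) (use j k an in linarith)+
  qed
  have S': "{a mod n, b mod n} \<in> sides n T" "{b mod n, a mod n} \<in> sides n T"
     "{b mod n, c mod n} \<in> sides n T" "{c mod n, b mod n} \<in> sides n T"
     "{a mod n, c mod n} \<in> sides n T" "{c mod n, a mod n} \<in> sides n T"
    using S by (auto simp: S_def insert_commute)
  have tri: "{x, y, z} \<in> triangles n T" if "x < y" "y < z" "z < n" "{x, y} \<in> sides n T" "{y, z} \<in> sides n T"
    "{x, z} \<in> sides n T" for x y z using that unfolding triangles_def by blast
  from o show "{a mod n, b mod n, c mod n} \<in> triangles n T"
    using tri[of "a mod n" "b mod n" "c mod n"] tri[of "c mod n" "a mod n" "b mod n"]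
      tri[of "b mod n" "c mod n" "a mod n"] S' an by (auto simp: insert_commute)
qed

lemma Gm_dA:
  assumes l: "a < b" "b < c" "c < a + n" and S: "S a b" "S b c" "S a c"
  shows "Gm a b c \<in> dA D"
proof -
  have "card {a mod n, b mod n, c mod n} = 3"
    using triangle_cases(2)[OF assms] by auto
  moreover have "rk n (a mod n) (b mod n) < rk n (a mod n) (c mod n)"
    using rk_lift[of a b] rk_lift[of a c] l by simp
  ultimately show ?thesis using triangle_cases(1)[OF assms] by (auto simp: gl2_dimer_def)
qed

lemma triangle_pairs:
  assumes "{x, y, z} \<in> triangles n T" "u \<in> {x, y, z}" "w \<in> {x, y, z}" "u \<noteq> w"
  shows "{u, w} \<in> sides n T" "u < n"
proof -
  obtain a b c where "{x, y, z} = {a, b, c}" and abc: "a < b" "b < c" "c < n" "{a, b} \<in> sides n T"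
    "{b, c} \<in> sides n T" "{a, c} \<in> sides n T" using assms(1) unfolding triangles_def by blast
  then have "u \<in> {a, b, c}" "w \<in> {a, b, c}" using assms(2,3) by auto
  with abc assms(4) show "{u, w} \<in> sides n T" "u < n" by (auto simp: insert_commute)
qed

text \<open>The condition on \<open>rk\<close> in \<open>dA\<close> says that x, y, z are in
  anticlockwise order, so adding the ranks to x turns the residues into increasing labels.\<close>

lemma Gam_dA:
  assumes "Gam x y z \<in> dA D"
  obtains a b c where "a < b" "b < c" "c < a + n" "S a b" "S b c" "S a c" "Gam x y z = Gm a b c"
    "a < n"
proof -
  have t: "{x, y, z} \<in> triangles n T" and c: "card {x, y, z} = 3" and r: "rk n x y < rk n x z"
    using assms by (auto simp: gl2_dimer_def)
  have "card {u, w} \<noteq> 3" for u w :: nat by (simp add: card_insert_if)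
  then have d: "x \<noteq> y" "y \<noteq> z" "x \<noteq> z" using c by (metis insert_absorb2 insert_commute)+
  note p = triangle_pairs[OF t]
  have lt: "x < n" "y < n" "z < n" using p(2)[of x y] p(2)[of y x] p(2)[of z x] d by simp_all
  have m: "(x + rk n x w) mod n = w" if "w < n" for w
  proof -
    have "(x + rk n x w) mod n = (x + (w + n - x)) mod n" unfolding rk_def by (rule mod_add_right_eq)
    then show ?thesis using lt that by simp
  qed
  have sd: "{x, y} \<in> sides n T" "{y, z} \<in> sides n T" "{x, z} \<in> sides n T"
    using p(1)[of x y] p(1)[of y z] p(1)[of x z] d by simp_all
  have e: "x mod n = x" "(x + rk n x y) mod n = y" "(x + rk n x z) mod n = z"
    using lt m by simp_all
  show ?thesis
  proof (rule that[of x "x + rk n x y" "x + rk n x z"])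
    have "rk n x y \<noteq> 0"
    proof
      assume "rk n x y = 0"
      then show False using e(1,2) d(1) by simp
    qed
    then show "x < x + rk n x y" by simp
    show "x + rk n x y < x + rk n x z" using r by simp
    have "rk n x z < n" unfolding rk_def using n3 by simp
    then show "x + rk n x z < x + n" by simp
    show "S x (x + rk n x y)" "S (x + rk n x y) (x + rk n x z)" "S x (x + rk n x z)"
      unfolding S_def e by (fact sd)+
    show "Gam x y z = Gm x (x + rk n x y) (x + rk n x z)" by (simp only: e)
    show "x < n" by (fact lt)
  qed
qed

fun wt :: "gl2_arrow \<Rightarrow> nat" where
  "wt (Gam x y z) = rk n y z"
| "wt (Alpha i) = 1"
| "wt (Beta i) = 1"

text \<open>The weights telescope: the arrow from ax to the next side ab contributes b - x.\<close>

lemma walk_piv: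
  assumes "a < x" "x \<le> y" "y < a + n" "S a x" "S a y"
  shows "walk D (Sd a x) (piv a x y) (Sd a y) \<and> sum_list (map wt (piv a x y)) = y - x"
  using assms
proof (induction "y - x" arbitrary: x rule: less_induct)
  case less
  show ?case
  proof (cases "x = y")
    case True
    then show ?thesis using less by simp
  next
    case False
    then have "x < y" using less.prems(2) by simp
    then obtain b where b: "x < b" "b \<le> y" "S a b" "S x b" "piv a x y = Gm a x b # piv a b y"
      by (rule piv_step[OF less.prems(1) _ less.prems(3-5)])
    have "walk D (Sd a b) (piv a b y) (Sd a y) \<and> sum_list (map wt (piv a b y)) = y - b"
      by (rule less.hyps) (use less.prems b(1-3) in simp_all)
    moreover have "Gm a x b \<in> dA D"
      by (rule Gm_dA) (use less.prems b(1-4) in simp_all)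
    moreover have "rk n (x mod n) (b mod n) = b - x"
      by (rule rk_lift) (use less.prems b(1,2) in simp_all)
    ultimately show ?thesis using b(1,2) less.prems(4) unfolding b(5) by simp
  qed
qed

text \<open>Links the zipped neighbour lists of \<open>white_face\<close> to the
  \<open>LEAST\<close> of \<open>nx\<close>. Since b satisfies P, every earlier element of the list
  has its successor in the list.\<close>

lemma zip_filter_upt:
  assumes "P b" "a \<le> b"
  shows "zip (filter P [a..<Suc b]) (tl (filter P [a..<Suc b])) =
    map (\<lambda>z. (z, LEAST w. z < w \<and> P w)) (filter P [a..<b])"
  using assms(2)
proof (induction rule: inc_induct)
  case base
  then show ?case using assms(1) by simp
next
  case (step a)
  have u: "[a..<Suc b] = a # [Suc a..<Suc b]" "[a..<b] = a # [Suc a..<b]"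
    using step by (auto simp: upt_conv_Cons simp del: upt_Suc)
  obtain h t where ht: "filter P [Suc a..<Suc b] = h # t"
  proof (cases "filter P [Suc a..<Suc b]")
    case Nil
    then show ?thesis using assms step by (auto simp: filter_empty_conv simp del: upt_Suc)
  qed
  have "(LEAST w. a < w \<and> P w) = h"
  proof (rule Least_equality)
    have "h \<in> set (filter P [Suc a..<Suc b])" using ht by simp
    then show "a < h \<and> P h" by (auto simp del: upt_Suc)
  next
    fix y assume y: "a < y \<and> P y"
    have s: "sorted (filter P [Suc a..<Suc b])" by (rule sorted_wrt_filter) (rule sorted_upt)
    show "h \<le> y"
    proof (cases "y \<le> b")
      case True
      then have "y \<in> set (h # t)" using y unfolding ht[symmetric] by (auto simp del: upt_Suc)
      then show ?thesis using s ht by auto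
    next
      case False
      have "h \<in> set (filter P [Suc a..<Suc b])" using ht by simp
      then show ?thesis using False by (auto simp del: upt_Suc)
    qed
  qed
  then show ?case using step.IH ht u by (auto simp del: upt_Suc)
qed

text \<open>The last neighbour in the list sits at offset n - 1, so arrows start exactly at the
  neighbours of smaller offset, as in \<open>piv\<close>.\<close>

lemma white_face_mod: "white_face n T (a mod n) = Al a # piv a (Suc a) (a + n - 1) @ [Be a]"
proof -
  define v where "v = a mod n"
  let ?P = "\<lambda>r. S v (v + r)"
  have v: "v < n" "v mod n = v" using n3 by (auto simp: v_def)
  have "{r. 0 < r \<and> r < n \<and> {v, (v + r) mod n} \<in> sides n T} = set (filter ?P [1..<n])"
    using v by (auto simp: S_def)
  moreover have "sorted (filter ?P [1..<n])" by (rule sorted_wrt_filter) (rule sorted_upt)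
  ultimately have "sorted_list_of_set {r. 0 < r \<and> r < n \<and> {v, (v + r) mod n} \<in> sides n T} = filter ?P [1..<n]"
    by (simp only: sorted_list_of_set.idem_if_sorted_distinct distinct_filter distinct_upt)
  then have nb: "nbrs n T v = map (\<lambda>r. (v + r) mod n) (filter ?P [1..<n])"
    by (simp add: nbrs_def)
  have Sn: "?P (n - 1)" using S_Suc[of "v + (n - 1)"] n3 S_sym by simp
  have nx: "nx v (v + r) = v + (LEAST w. r < w \<and> ?P w)" for r
  proof (rule nx_eq)
    have "r < nx v (v + r) - v \<and> ?P (nx v (v + r) - v)" using nx(1)[of "v + r" v] nx(2)[of v "v + r"] by simp
    then have L: "r < (LEAST w. r < w \<and> ?P w) \<and> ?P (LEAST w. r < w \<and> ?P w)" by (rule LeastI)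
    then show "v + r < v + (LEAST w. r < w \<and> ?P w)" "S v (v + (LEAST w. r < w \<and> ?P w))" by auto
    fix u assume u: "v + r < u" "u < v + (LEAST w. r < w \<and> ?P w)"
    show "\<not> S v u" using not_less_Least[of "u - v" "\<lambda>w. r < w \<and> ?P w"] u by auto
  qed
  have "Suc (n - 1) = n" using n3 by simp
  then have z: "zip (filter ?P [1..<n]) (tl (filter ?P [1..<n])) =
     map (\<lambda>z. (z, LEAST w. z < w \<and> ?P w)) (filter ?P [1..<n - 1])"
    using zip_filter_upt[of ?P "n - 1" 1, OF Sn] n3 by simp
  have "map (\<lambda>(y, z). Gam v y z) (zip (nbrs n T v) (tl (nbrs n T v))) =
    map (\<lambda>(y, z). Gm v (v + y) (v + z)) (zip (filter ?P [1..<n]) (tl (filter ?P [1..<n])))"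
    unfolding nb map_tl[symmetric] zip_map_map by (simp add: comp_def case_prod_unfold v)
  also have "\<dots> = map (\<lambda>r. Gm v (v + r) (nx v (v + r))) (filter ?P [1..<n - 1])"
    unfolding z by (simp add: comp_def nx)
  also have "\<dots> = piv v (Suc v) (v + (n - 1))"
  proof -
    have "[Suc v..<v + (n - 1)] = map (\<lambda>i. i + v) [1..<n - 1]"
      using map_add_upt_shift[of v 1 "n - 1"] by (simp add: add.commute)
    then show ?thesis by (simp add: piv_def filter_map comp_def add.commute)
  qed
  also have "\<dots> = piv a (Suc a) (a + n - 1)"
  proof -
    have "a = v + (a div n) * n" by (simp add: v_def)
    then show ?thesis using piv_add_mult[of v "a div n" "Suc v" "v + (n - 1)"] n3
      by (metis Nat.add_diff_assoc add.assoc add.commute add_Suc le_trans one_le_numeral)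
  qed
  finally show ?thesis unfolding white_face_def v_def by simp
qed

end

section \<open>Congruences of paths\<close>

context triangulated_polygon
begin

abbreviation eqv :: "gl2_arrow list \<Rightarrow> gl2_arrow list \<Rightarrow> bool" (infix "\<approx>" 50) where
  "as \<approx> bs \<equiv> pcong D as bs"

lemma S_cong: "x mod n = x' mod n \<Longrightarrow> y mod n = y' mod n \<Longrightarrow> S x y = S x' y'"
  by (simp add: S_def)

lemma S_symD: "S x y \<Longrightarrow> S y x"
  by (simp add: S_sym)

text \<open>Black faces are listed from their smallest residue, so the arrow may stand at any of the
  three places; the rest of the cycle, read from it, is always the same.\<close>

lemma black_face:
  assumes l: "a < b" "b < c" "c < a + n" and S: "S a b" "S b c" "S a c"
  shows "\<exists>us vs. us @ Gm a b c # vs \<in> dFm D \<and> vs @ us = [Gm c a b, Gm b c a]"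
proof -
  let ?a = "a mod n" and ?b = "b mod n" and ?c = "c mod n"
  have f: "[Gam x y z, Gam z x y, Gam y z x] \<in> dFm D"
    if "x < y" "y < z" "{x, y, z} = {?a, ?b, ?c}" for x y z
    using that triangle_cases(1)[OF assms] unfolding gl2_dimer_def by auto
  from triangle_cases(2)[OF assms] consider "?a < ?b" "?b < ?c" | "?c < ?a" "?a < ?b" | "?b < ?c" "?c < ?a"
    by blast
  then show ?thesis
  proof cases
    case 1
    have "[Gam ?a ?b ?c, Gam ?c ?a ?b, Gam ?b ?c ?a] \<in> dFm D" by (rule f) (use 1 in auto)
    then show ?thesis by (intro exI[of _ "[]"] exI[of _ "[Gam ?c ?a ?b, Gam ?b ?c ?a]"]) simp
  next
    case 2
    have "[Gam ?c ?a ?b, Gam ?b ?c ?a, Gam ?a ?b ?c] \<in> dFm D" by (rule f) (use 2 in auto)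
    then show ?thesis by (intro exI[of _ "[]"] exI[of _ "[Gam ?c ?a ?b, Gam ?b ?c ?a]"]) simp
  next
    case 3
    have "[Gam ?b ?c ?a, Gam ?a ?b ?c, Gam ?c ?a ?b] \<in> dFm D" by (rule f) (use 3 in auto)
    then show ?thesis by (intro exI[of _ "[Gam ?b ?c ?a]"] exI[of _ "[Gam ?c ?a ?b]"]) simp
  qed
qed

lemma white_in_dFp: "Al a # piv a (Suc a) (a + n - 1) @ [Be a] \<in> dFp D"
proof -
  have "a mod n < n" using n3 by simp
  then have "white_face n T (a mod n) \<in> dFp D" unfolding gl2_dimer_def by auto
  then show ?thesis by (simp only: white_face_mod)
qed

text \<open>The defining relation of the arrow \<open>Gm a b c\<close>: the rest of its black face
  against the rest of the white face at a.\<close>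

lemma triangle_rel:
  assumes l: "a < b" "b < c" "c < a + n" and S: "S a b" "S b c" "S a c"
  shows "[Gm c a b, Gm b c a] \<approx> piv a c (a + n - 1) @ [Be a, Al a] @ piv a (Suc a) b"
proof -
  have p: "piv a (Suc a) (a + n - 1) = piv a (Suc a) b @ [Gm a b c] @ piv a c (a + n - 1)"
    unfolding piv_triangle[OF assms, symmetric] using l by (simp add: piv_append)
  obtain us vs where b: "us @ Gm a b c # vs \<in> dFm D" "vs @ us = [Gm c a b, Gm b c a]"
    using black_face[OF assms] by blast
  have "(Al a # piv a (Suc a) b) @ Gm a b c # (piv a c (a + n - 1) @ [Be a]) \<in> dFp D"
    using white_in_dFp[of a] unfolding p by simp
  from pc_rel[OF this b(1), of "[]" "[]"] b(2)
  have "piv a c (a + n - 1) @ [Be a, Al a] @ piv a (Suc a) b \<approx> [Gm c a b, Gm b c a]" by simp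
  then show ?thesis by (rule pc_sym)
qed

text \<open>The same relation for the arrow at the middle vertex m, seen from which a carries the
  label a + n.\<close>

lemma triangle_rel':
  assumes l: "a < m" "m < c" "c < a + n" and S: "S a m" "S m c" "S a c"
  shows "[Gm a m c, Gm c a m] \<approx> piv m (a + n) (m + n - 1) @ [Be m, Al m] @ piv m (Suc m) c"
proof -
  have "S c (a + n)" "S m (a + n)" using S(1,3)[THEN S_symD] by simp_all
  from triangle_rel[OF l(2,3) _ S(2) this] l(1) show ?thesis by simp
qed

text \<open>The white face at \<open>a\<close>, read from the vertex of the quiver on the side \<open>ay\<close>.\<close>

definition cw :: "nat \<Rightarrow> nat \<Rightarrow> gl2_arrow list" where
  "cw a y = piv a y (a + n - 1) @ [Be a, Al a] @ piv a (Suc a) y"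

definition cc :: "nat \<Rightarrow> gl2_arrow list" where
  "cc a = Al a # piv a (Suc a) (a + n - 1) @ [Be a]"

text \<open>Putting \<open>Gm a b c\<close> in front of its relation completes both remainders to
  whole faces.\<close>

lemma black_cycle:
  assumes l: "a < b" "b < c" "c < a + n" and S: "S a b" "S b c" "S a c"
  shows "[Gm a b c, Gm c a b, Gm b c a] \<approx> cw a b"
proof -
  have "piv a b (a + n - 1) = [Gm a b c] @ piv a c (a + n - 1)"
    unfolding piv_triangle[OF assms, symmetric] using l by (simp add: piv_append)
  then show ?thesis
    using pcong_ctx[OF triangle_rel[OF assms], of "[Gm a b c]" "[]"] by (simp add: cw_def)
qed

text \<open>The third vertex of the triangle on the inner arc of ac is the last neighbour of a
  before c; a + 1 is always a candidate.\<close>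

lemma inner_triangle:
  assumes "S a c" "Suc a < c" "c < a + n"
  obtains m where "a < m" "m < c" "S a m" "S m c"
proof -
  define W where "W = {w. a < w \<and> w < c \<and> S a w}"
  have fin: "finite W" unfolding W_def by (rule finite_subset[of _ "{..<c}"]) auto
  have "Suc a \<in> W" using assms(2) S_Suc by (simp add: W_def)
  then have "Max W \<in> W" using Max_in[OF fin] by blast
  then have m: "a < Max W" "Max W < c" "S a (Max W)" unfolding W_def by simp_all
  have gap: "\<not> S a w" if "Max W < w" "w < c" for w
  proof
    assume "S a w"
    then have "w \<in> W" using that m(1) by (simp add: W_def)
    then show False using Max_ge[OF fin] that(1) by fastforce
  qed
  from consecutive_side[OF m(1,2) assms(3) m(3) assms(1) gap] have "S (Max W) c" .
  from that[OF m this] show ?thesis .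
qed

section \<open>Central cycles\<close>

lemma cw_add [simp]: "cw (a + n) (y + n) = cw a y"
proof -
  have "a + n + n - 1 = a + n - 1 + n" "Suc (a + n) = Suc a + n" using n3 by auto
  then show ?thesis unfolding cw_def by (simp only: piv_add piv_center_add mod_add_self2)
qed

text \<open>The side ay lies on a triangle a m y, and the white faces at both of its ends are
  congruent to the black face of that triangle.\<close>

lemma cw_swap_aux:
  assumes "a < y" "y < a + n" "S a y" "y \<noteq> Suc a"
  shows "cw a y \<approx> cw y (a + n)"
proof -
  obtain m where m: "a < m" "m < y" "S a m" "S m y"
    using inner_triangle[OF assms(3) _ assms(2)] assms(1,4) by (metis Suc_lessI)
  have "piv a (Suc a) y = piv a (Suc a) m @ [Gm a m y]"
    unfolding piv_triangle[OF m(1,2) assms(2) m(3,4) assms(3), symmetric]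
    using m by (simp add: piv_append)
  with pcong_ctx[OF triangle_rel[OF m(1,2) assms(2) m(3,4) assms(3)], of "[]" "[Gm a m y]"]
  have "[Gm y a m, Gm m y a, Gm a m y] \<approx> cw a y" by (simp add: cw_def)
  moreover have "[Gm y (a + n) (m + n), Gm (m + n) y (a + n), Gm (a + n) (m + n) y] \<approx> cw y (a + n)"
    by (rule black_cycle) (use m assms(1-3) m(3,4)[THEN S_symD] assms(3)[THEN S_symD] in simp_all)
  then have "[Gm y a m, Gm m y a, Gm a m y] \<approx> cw y (a + n)" by simp
  ultimately show ?thesis using pc_sym pc_trans by blast
qed

lemma cw_swap:
  assumes "a < y" "y < a + n" "S a y"
  shows "cw a y \<approx> cw y (a + n)"
proof (cases "y = Suc a")
  \<comment> \<open>For a polygon edge the triangle lies on the other arc: the ends exchange roles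
    and \<open>cw_add\<close> undoes the full turn; n >= 3 keeps a + n apart from
    \<open>Suc y\<close>.\<close>
  case True
  have "cw y (a + n) \<approx> cw (a + n) (y + n)"
    by (rule cw_swap_aux) (use assms(1,2) assms(3)[THEN S_symD] True n3 in simp_all)
  then show ?thesis using pc_sym by simp
qed (use cw_swap_aux assms in blast)

lemma cw_add_mult: "cw (a + k * n) (y + k * n) = cw a y"
proof (induction k)
  case (Suc k)
  have e: "c + Suc k * n = c + k * n + n" for c by simp
  show ?case unfolding e cw_add by (rule Suc.IH)
qed simp

lemma cw_cong:
  assumes "a < y" "y < a + n" "b < z" "z < b + n" "a mod n = b mod n" "y mod n = z mod n"
  shows "cw a y = cw b z"
proof -
  have d: "y - a = z - b" using rk_lift[of a y] rk_lift[of b z] assms by simp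
  have *: "cw u w = cw (u mod n) (u mod n + (w - u))" if "u < w" for u w
  proof -
    have "u = u mod n + (u div n) * n" "w = u mod n + (w - u) + (u div n) * n"
      using that by (simp_all add: mod_div_mult_eq)
    then show ?thesis using cw_add_mult[of "u mod n" "u div n" "u mod n + (w - u)"] by simp
  qed
  show ?thesis using *[of a y] *[of b z] assms d by simp
qed

lemma cc_cong:
  assumes "a mod n = b mod n" shows "cc a = cc b"
proof -
  have "cc u = white_face n T (u mod n)" for u by (simp add: cc_def white_face_mod)
  then show ?thesis using assms by simp
qed

text \<open>A relation rather than a function: a side lies on the white faces at both of its ends,
  and a vertex has many labels. \<open>Cy_unique\<close> identifies the choices up to
  congruence.\<close>

inductive Cy :: "gl2_vertex \<Rightarrow> gl2_arrow list \<Rightarrow> bool" where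
  "a < y \<Longrightarrow> y < a + n \<Longrightarrow> S a y \<Longrightarrow> Cy (Sd a y) (cw a y)"
| "Cy (Cn a) (cc a)"

lemma Cy_unique:
  assumes "Cy v c" "Cy v c'" shows "c \<approx> c'"
  using assms
proof (cases rule: Cy.cases[case_product Cy.cases])
  case ("1_1" a y b z)
  then consider "a mod n = b mod n" "y mod n = z mod n" | "a mod n = z mod n" "y mod n = b mod n"
    by (auto simp: doubleton_eq_iff)
  then show ?thesis
  proof cases
    case 1
    then show ?thesis using "1_1" cw_cong[of a y b z] by (simp add: pc_refl)
  next
    case 2
    then have "cw y (a + n) = cw b z" using "1_1" by (intro cw_cong) auto
    then show ?thesis using cw_swap[of a y] "1_1" by simp
  qed
next
  case ("2_2" a b)
  then show ?thesis using cc_cong[of a b] by (simp add: pc_refl)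
qed auto

lemma pred_label: obtains i where "Suc i = a + n" "(a + n - 1) = i"
  using n3 by (cases "a + n") auto

lemma src_Be': "dsrc D (Be a) = Sd a (a + n - 1)"
proof -
  obtain i where i: "Suc i = a + n" "a + n - 1 = i" by (rule pred_label)
  have "Be a = Be (Suc i)" unfolding i by simp
  then have "dsrc D (Be a) = Sd i (Suc i)" by simp
  then show ?thesis unfolding i by (simp add: insert_commute)
qed

lemma arrow_cases:
  assumes "\<alpha> \<in> dA D"
  obtains (Gam) a b c where "\<alpha> = Gm a b c" "a < b" "b < c" "c < a + n" "S a b" "S b c" "S a c"
    | (Alpha) j where "\<alpha> = Al j"
    | (Beta) j where "\<alpha> = Be j"
proof (cases \<alpha>)
  case (Gam x y z)
  show ?thesis by (rule Gam_dA[of x y z]) (use that(1) assms Gam in blast)+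
next
  case (Alpha j)
  then have "j mod n = j" using assms by (auto simp: gl2_dimer_def)
  then show ?thesis using that(2)[of j] Alpha by simp
next
  case (Beta j)
  then have "j mod n = j" using assms by (auto simp: gl2_dimer_def)
  then show ?thesis using that(3)[of j] Beta by simp
qed

lemma S_pred: "S a (a + n - 1)"
proof -
  obtain i where i: "Suc i = a + n" "a + n - 1 = i" by (rule pred_label)
  have "S (Suc i) i" using S_Suc S_sym by blast
  then show ?thesis unfolding i by simp
qed

text \<open>Reading the white face of an arrow from its source and from its target gives an equality
  of lists; congruence enters only when the chosen face changes.\<close>

lemma Cy_arrow:
  assumes "\<alpha> \<in> dA D"
  shows "\<exists>c c'. Cy (dsrc D \<alpha>) c \<and> Cy (dtgt D \<alpha>) c' \<and> c @ [\<alpha>] = \<alpha> # c'"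
  using assms
proof (cases rule: arrow_cases)
  case (Gam a b c)
  have "piv a b (a + n - 1) = [Gm a b c] @ piv a c (a + n - 1)" "piv a (Suc a) c = piv a (Suc a) b @ [Gm a b c]"
    unfolding piv_triangle[OF Gam(2-7), symmetric] using Gam by (simp_all add: piv_append)
  then have "cw a b @ [\<alpha>] = \<alpha> # cw a c" using Gam(1) by (simp add: cw_def)
  moreover have "Cy (dsrc D \<alpha>) (cw a b)" "Cy (dtgt D \<alpha>) (cw a c)"
    unfolding Gam(1) D_simps by (rule Cy.intros; use Gam in simp)+
  ultimately show ?thesis by blast
next
  case (Alpha j)
  have "cc j @ [\<alpha>] = \<alpha> # cw j (Suc j)" using Alpha by (simp add: cc_def cw_def)
  moreover have "Cy (dsrc D \<alpha>) (cc j)" unfolding Alpha D_simps by (rule Cy.intros)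
  moreover have "Cy (dtgt D \<alpha>) (cw j (Suc j))"
    unfolding Alpha D_simps by (rule Cy.intros) (use n3 S_Suc in auto)
  ultimately show ?thesis by blast
next
  case (Beta j)
  have "cw j (j + n - 1) @ [\<alpha>] = \<alpha> # cc j" using Beta by (simp add: cc_def cw_def)
  moreover have "Cy (dsrc D \<alpha>) (cw j (j + n - 1))" unfolding Beta src_Be'
    by (rule Cy.intros) (use n3 S_pred in auto)
  moreover have "Cy (dtgt D \<alpha>) (cc j)" unfolding Beta D_simps by (rule Cy.intros)
  ultimately show ?thesis by blast
qed

text \<open>The cycle slides past one arrow at a time; before each arrow \<open>Cy_unique\<close>
  exchanges it for the white face containing that arrow.\<close>

lemma Cy_central: "walk D u as v \<Longrightarrow> Cy u c \<Longrightarrow> Cy v c' \<Longrightarrow> c @ as \<approx> as @ c'"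
proof (induction as arbitrary: u c)
  case Nil
  then show ?case using Cy_unique by simp
next
  case (Cons \<alpha> as)
  then have \<alpha>: "\<alpha> \<in> dA D" "dsrc D \<alpha> = u" "walk D (dtgt D \<alpha>) as v" by auto
  obtain c1 c2 where c: "Cy u c1" "Cy (dtgt D \<alpha>) c2" "c1 @ [\<alpha>] = \<alpha> # c2"
    using Cy_arrow[OF \<alpha>(1)] \<alpha>(2) by blast
  have "c @ \<alpha> # as \<approx> c1 @ \<alpha> # as"
    using pcong_ctx[OF Cy_unique[OF Cons.prems(2) c(1)], of "[]" "\<alpha> # as"] by simp
  also have "c1 @ \<alpha> # as = \<alpha> # c2 @ as" using c(3) by (metis append_Cons append_assoc append_Nil)
  also have "\<alpha> # c2 @ as \<approx> \<alpha> # as @ c'"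
    using pcong_ctx[OF Cons.IH[OF \<alpha>(3) c(2) Cons.prems(3)], of "[\<alpha>]" "[]"] by simp
  finally show ?case by simp
qed

text \<open>Induction on the part of the polygon cut off by ac. The relation at m turns the two
  middle arrows \<open>Gm a m c\<close>, \<open>Gm c a m\<close> into a passage about m through its
  corner, which leaves the same claim for am and for mc. For a polygon edge all the paths are
  empty.\<close>

lemma side_path:
  assumes "a < c" "c < a + n" "S a c"
  shows "piv a (Suc a) c @ piv c (a + n) (c + n - 1) \<approx> bd a c"
  using assms
proof (induction "c - a" arbitrary: a c rule: less_induct)
  case less
  show ?case
  proof (cases "c = Suc a")
    case True
    then show ?thesis by (simp add: pc_refl)
  next
    case False
    then obtain m where m: "a < m" "m < c" "S a m" "S m c"
      using inner_triangle[OF less.prems(3) _ less.prems(2)] less.prems(1) by (metis Suc_lessI)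
    have 1: "piv a (Suc a) c = piv a (Suc a) m @ [Gm a m c]"
      unfolding piv_triangle[OF m(1,2) less.prems(2) m(3,4) less.prems(3), symmetric]
      using m by (simp add: piv_append)
    \<comment> \<open>Seen from c, the vertices a and m carry the labels a + n and m + n, so the
      same triangle contributes a single arrow about c.\<close>
    have "piv c (a + n) (m + n) = [Gm c (a + n) (m + n)]"
      by (rule piv_triangle)
         (use m(1,2) less.prems m(3,4)[THEN S_symD] less.prems(3)[THEN S_symD] m(3) in simp_all)
    then have 2: "piv c (a + n) (c + n - 1) = [Gm c a m] @ piv c (m + n) (c + n - 1)"
      using piv_append[of "a + n" "m + n" "c + n - 1" c] m by simp
    have "piv a (Suc a) c @ piv c (a + n) (c + n - 1) =
      piv a (Suc a) m @ [Gm a m c, Gm c a m] @ piv c (m + n) (c + n - 1)"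
      by (simp only: 1 2 append_assoc append_Cons append_Nil)
    also have "\<dots> \<approx> (piv a (Suc a) m @ piv m (a + n) (m + n - 1)) @ [Be m, Al m] @
       (piv m (Suc m) c @ piv c (m + n) (c + n - 1))"
      using pcong_ctx[OF triangle_rel'[OF m(1,2) less.prems(2) m(3,4) less.prems(3)],
          of "piv a (Suc a) m" "piv c (m + n) (c + n - 1)"]
      by (simp only: append_assoc)
    also have "\<dots> \<approx> bd a m @ [Be m, Al m] @ bd m c"
    proof (intro pcong_append pc_refl)
      show "piv a (Suc a) m @ piv m (a + n) (m + n - 1) \<approx> bd a m"
        by (rule less.hyps) (use m less.prems in auto)
      show "piv m (Suc m) c @ piv c (m + n) (c + n - 1) \<approx> bd m c"
        by (rule less.hyps) (use m less.prems in auto)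
    qed
    also have "\<dots> = bd a c" using bd_append[OF m(1,2)] by simp
    finally show ?thesis .
  qed
qed

text \<open>The relation at m replaces the last two arrows, and \<open>side_path\<close> for am
  straightens everything before the corner m into the boundary path. This moves the turning centre
  of a normal form from a to m.\<close>

lemma turn_path:
  assumes l: "a < m" "m < c" "c < a + n" and S: "S a m" "S m c" "S a c"
  shows "piv a (Suc a) c @ [Gm c a m] \<approx> bd a (Suc m) @ piv m (Suc m) c"
proof -
  have "piv a (Suc a) c = piv a (Suc a) m @ [Gm a m c]"
    unfolding piv_triangle[OF assms, symmetric] using l by (simp add: piv_append)
  then have "piv a (Suc a) c @ [Gm c a m] = piv a (Suc a) m @ [Gm a m c, Gm c a m]" by simp
  also have "\<dots> \<approx> piv a (Suc a) m @ (piv m (a + n) (m + n - 1) @ [Be m, Al m] @ piv m (Suc m) c)"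
    using pcong_ctx[OF triangle_rel'[OF assms], of _ "[]"] by simp
  also have "\<dots> = (piv a (Suc a) m @ piv m (a + n) (m + n - 1)) @ [Be m, Al m] @ piv m (Suc m) c" by simp
  also have "\<dots> \<approx> bd a m @ [Be m, Al m] @ piv m (Suc m) c"
    by (intro pcong_append pc_refl side_path) (use assms in auto)
  also have "\<dots> = bd a (Suc m) @ piv m (Suc m) c" using l by (simp add: bd_Suc)
  finally show ?thesis .
qed

lemma bd_extend: "m \<le> c \<Longrightarrow> a \<le> m \<Longrightarrow> bd a (Suc m) @ bd m (Suc c) = bd a (Suc c)"
proof (induction c rule: dec_induct)
  case (step c)
  then have "bd m (Suc (Suc c)) = bd m (Suc c) @ [Be (Suc c), Al (Suc c)]"
    "bd a (Suc (Suc c)) = bd a (Suc c) @ [Be (Suc c), Al (Suc c)]" by (simp_all add: bd_Suc)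
  then show ?case using step by (simp flip: append_assoc)
qed simp

lemma walk_bd:
  "a \<le> p \<Longrightarrow> walk D (Sd a (Suc a)) (bd a (Suc p)) (Sd p (Suc p)) \<and>
     sum_list (map wt (bd a (Suc p))) = 2 * (p - a)"
proof (induction p rule: dec_induct)
  case base
  then show ?case by (simp add: S_Suc)
next
  case (step p)
  have "Be (Suc p) \<in> dA D" "Al (Suc p) \<in> dA D" "Cn (Suc p) \<in> dV D" using n3 by simp_all
  then have "walk D (Sd p (Suc p)) [Be (Suc p), Al (Suc p)] (Sd (Suc p) (Suc (Suc p)))"
    by (simp add: S_Suc)
  then show ?case using step by (auto simp: bd_Suc walk_append)
qed


lemma walk_cw:
  assumes "a < y" "y < a + n" "S a y"
  shows "walk D (Sd a y) (cw a y) (Sd a y) \<and> sum_list (map wt (cw a y)) = n"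
proof -
  have "walk D (Sd a y) (piv a y (a + n - 1)) (Sd a (a + n - 1)) \<and>
      sum_list (map wt (piv a y (a + n - 1))) = a + n - 1 - y"
    by (rule walk_piv) (use assms S_pred in auto)
  moreover have "walk D (Sd a (Suc a)) (piv a (Suc a) y) (Sd a y) \<and>
      sum_list (map wt (piv a (Suc a) y)) = y - Suc a"
    by (rule walk_piv) (use assms S_Suc n3 in auto)
  moreover have "walk D (Sd a (a + n - 1)) [Be a, Al a] (Sd a (Suc a))"
    using n3 S_pred S_Suc by (simp add: src_Be')
  ultimately have "walk D (Sd a y) (cw a y) (Sd a y)"
    "sum_list (map wt (cw a y)) = (a + n - 1 - y) + 2 + (y - Suc a)"
    unfolding cw_def walk_append by (blast, simp)
  then show ?thesis using assms by auto
qed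

end

section \<open>Normal forms of paths from a boundary vertex\<close>

context triangulated_polygon
begin

definition pw :: "nat \<Rightarrow> nat \<Rightarrow> gl2_arrow list" where
  "pw u k = concat (replicate k (cw u (Suc u)))"

lemma pw_Suc: "pw u (Suc k) = cw u (Suc u) @ pw u k" "pw u (Suc k) = pw u k @ cw u (Suc u)"
  by (simp_all add: pw_def) (metis append_Nil2 concat.simps concat_append replicate_append_same)

lemma walk_pw: "walk D (Sd u (Suc u)) (pw u k) (Sd u (Suc u)) \<and> sum_list (map wt (pw u k)) = k * n"
proof (induction k)
  case 0
  show ?case by (simp add: pw_def S_Suc)
next
  case (Suc k)
  then show ?case using walk_cw[of u "Suc u"] n3 S_Suc[of u] by (auto simp: pw_Suc(1) walk_append)
qed

text \<open>Normal forms for paths from the boundary vertex on the side \<open>{u, u + 1}\<close>, up to powers of the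
  central cycle: sides and corners are labelled in the window \<open>{u + 1..u + n}\<close>.\<close>

definition side_nf :: "nat \<Rightarrow> nat \<Rightarrow> nat \<Rightarrow> gl2_arrow list" where
  "side_nf u p q = (if q = u + n then piv u (Suc u) p else bd u (Suc p) @ piv p (Suc p) q)"

text \<open>The normal form of the side {j - 1, j}, followed by the boundary arrow into the corner
  j.\<close>

definition corner_nf :: "nat \<Rightarrow> nat \<Rightarrow> gl2_arrow list" where
  "corner_nf u j = (if j = u + n then piv u (Suc u) (u + n - 1) else bd u j) @ [Be j]"

text \<open>The window gives every quiver vertex exactly one labelling. The polygon vertex u is
  labelled u + n in it, so the start side {u, u + 1} is the pair (\<open>Suc u\<close>, u + n),
  whose normal form is empty.\<close>

inductive nf :: "nat \<Rightarrow> gl2_vertex \<Rightarrow> gl2_arrow list \<Rightarrow> bool" for u where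
  nf_side: "u < p \<Longrightarrow> p < q \<Longrightarrow> q \<le> u + n \<Longrightarrow> S p q \<Longrightarrow> nf u (Sd p q) (side_nf u p q)"
| nf_corner: "u < j \<Longrightarrow> j \<le> u + n \<Longrightarrow> nf u (Cn j) (corner_nf u j)"

section \<open>Uniqueness, ends and weights of normal forms\<close>

lemma window_inj:
  assumes "u < p" "p \<le> u + n" "u < q" "q \<le> u + n" "p mod n = q mod n"
  shows "p = q"
proof (cases "p \<le> q")
  case True
  show ?thesis by (rule mod_inj[OF True]) (use assms in auto)
next
  case False
  then have "q \<le> p" by simp
  from mod_inj[OF this] show ?thesis using assms by auto
qed

lemma nf_unique:
  assumes "nf u v L" "nf u v L'" shows "L = L'"
  using assms
proof (cases rule: nf.cases[case_product nf.cases])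
  case (nf_side_nf_side p q p' q')
  then consider "p mod n = p' mod n" "q mod n = q' mod n" | "p mod n = q' mod n" "q mod n = p' mod n"
    by (auto simp: doubleton_eq_iff)
  then show ?thesis
  proof cases
    case 1
    have "p = p'" by (rule window_inj[of u]) (use nf_side_nf_side 1 in simp_all)
    moreover have "q = q'" by (rule window_inj[of u]) (use nf_side_nf_side 1 in simp_all)
    ultimately show ?thesis using nf_side_nf_side by simp
  next
    case 2
    have "p = q'" by (rule window_inj[of u]) (use nf_side_nf_side 2 in simp_all)
    moreover have "q = p'" by (rule window_inj[of u]) (use nf_side_nf_side 2 in simp_all)
    ultimately show ?thesis using nf_side_nf_side by simp
  qed
next
  case (nf_corner_nf_corner j j')
  have "j = j'" by (rule window_inj[of u]) (use nf_corner_nf_corner in simp_all)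
  then show ?thesis using nf_corner_nf_corner by simp
qed auto

lemma walk_nf: "nf u v L \<Longrightarrow> walk D (Sd u (Suc u)) L v"
proof (induction rule: nf.induct)
  case (nf_side p q)
  show ?case
  proof (cases "q = u + n")
    case True
    have "S u p" using nf_side(4) True S_symD by simp
    then have "walk D (Sd u (Suc u)) (piv u (Suc u) p) (Sd u p)"
      using walk_piv[of u "Suc u" p] nf_side True S_Suc by simp
    then show ?thesis using True by (simp add: side_nf_def insert_commute)
  next
    case False
    have "walk D (Sd p (Suc p)) (piv p (Suc p) q) (Sd p q)"
      using walk_piv[of p "Suc p" q] nf_side False S_Suc by simp
    moreover have "walk D (Sd u (Suc u)) (bd u (Suc p)) (Sd p (Suc p))"
      using walk_bd[of u p] nf_side(1) by simp
    ultimately show ?thesis using False by (auto simp: side_nf_def walk_append)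
  qed
next
  case (nf_corner j)
  have "Cn j \<in> dV D" "Be j \<in> dA D" using n3 by simp_all
  then have w: "walk D (Sd j (j + n - 1)) [Be j] (Cn j)" using S_pred by (simp add: src_Be')
  show ?case
  proof (cases "j = u + n")
    case True
    obtain i where i: "Suc i = u + n" "u + n - 1 = i" by (rule pred_label)
    have "walk D (Sd u (Suc u)) (piv u (Suc u) i) (Sd u i)"
      using walk_piv[of u "Suc u" i] i n3 S_Suc S_pred[of u] by simp
    moreover have "Sd u i = Sd j (j + n - 1)"
      using True i(2) n3 by (metis Nat.add_diff_assoc2 i(1) le_add2 le_trans mod_add_self2 n3 one_le_numeral)
    ultimately show ?thesis using True w i unfolding corner_nf_def walk_append by auto
  next
    case False
    obtain i where i: "j = Suc i" using nf_corner(1) by (cases j) auto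
    have "walk D (Sd u (Suc u)) (bd u (Suc i)) (Sd i (Suc i))"
      using walk_bd[of u i] nf_corner(1) i by simp
    moreover have "Sd i (Suc i) = Sd j (j + n - 1)" unfolding i by (simp add: insert_commute)
    ultimately show ?thesis using False w i unfolding corner_nf_def walk_append by auto
  qed
qed

lemma wt_side_nf:
  assumes "u < p" "p < q" "q \<le> u + n" "S p q"
  shows "sum_list (map wt (side_nf u p q)) = (if q = u + n then p - Suc u else 2 * (p - u) + (q - Suc p))"
proof (cases "q = u + n")
  case True
  then have "S u p" using assms S_symD by simp
  then show ?thesis
    using walk_piv[of u "Suc u" p] assms True S_Suc by (simp add: side_nf_def)
next
  case False
  then show ?thesis
    using walk_piv[of p "Suc p" q] walk_bd[of u p] assms S_Suc by (simp add: side_nf_def)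
qed

lemma wt_corner_nf:
  assumes "u < j" "j \<le> u + n"
  shows "sum_list (map wt (corner_nf u j)) = (if j = u + n then n - 1 else 2 * (j - Suc u) + 1)"
proof (cases "j = u + n")
  case True
  then show ?thesis
    using walk_piv[of u "Suc u" "u + n - 1"] n3 S_Suc S_pred[of u] by (simp add: corner_nf_def)
next
  case False
  obtain i where i: "j = Suc i" using assms(1) by (cases j) auto
  then show ?thesis using walk_bd[of u i] assms False by (simp add: corner_nf_def)
qed

section \<open>Right multiplication of a normal form by an arrow\<close>

lemma window_label:
  obtains j' where "u < j'" "j' \<le> u + n" "j' mod n = j mod n"
proof -
  \<comment> \<open>Adding u * n and n keeps the subtraction of \<open>Suc u\<close> from being
    truncated and does not change the residue.\<close>
  define a' where "a' = Suc u + (j + u * n + n - Suc u) mod n"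
  have n0: "0 < n" using n3 by simp
  have "u \<le> u * n" using n3 by simp
  then have le: "Suc u \<le> j + u * n + n" using n3 by linarith
  have "(j + u * n + n - Suc u) mod n < n" using n0 by simp
  then have 1: "u < a'" "a' \<le> u + n" unfolding a'_def by simp_all
  have "a' mod n = (Suc u + (j + u * n + n - Suc u)) mod n" unfolding a'_def by (rule mod_add_right_eq)
  also have "Suc u + (j + u * n + n - Suc u) = j + u * n + n" using le by linarith
  finally show ?thesis using that[OF 1] by simp
qed

text \<open>A rotation brings the triangle into the window; the given arrow may then sit at any of
  its three vertices, hence the three alternatives.\<close>

lemma triangle_window:
  assumes l: "a < b" "b < c" "c < a + n" and S: "S a b" "S b c" "S a c"
  obtains x y z where "u < x" "x < y" "y < z" "z \<le> u + n" "S x y" "S y z" "S x z"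
    "Gm a b c = Gm x y z \<or> Gm a b c = Gm y z x \<or> Gm a b c = Gm z x y"
proof -
  obtain a' where a': "u < a'" "a' \<le> u + n" "a' mod n = a mod n" by (rule window_label)
  obtain j where j: "b = a + j" "0 < j" using l(1) less_imp_add_positive by blast
  obtain k where k: "c = a + k" "j < k" "k < n" using l(2,3) j less_imp_add_positive[of b c] by auto
  have m: "(a' + i) mod n = (a + i) mod n" for i using a'(3) by (metis mod_add_left_eq)
  have S': "S a' (a' + j)" "S (a' + j) (a' + k)" "S a' (a' + k)"
    using S S_cong[OF a'(3) m] S_cong[OF m m] unfolding j(1) k(1) by simp_all
  have g: "Gm a b c = Gm a' (a' + j) (a' + k)" unfolding j(1) k(1) m a'(3) ..
  consider "a' + k \<le> u + n" | "a' + j \<le> u + n" "u + n < a' + k" | "u + n < a' + j" by linarith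
  then show ?thesis
  proof cases
    case 1
    show ?thesis by (rule that[of a' "a' + j" "a' + k"]) (use a' j k 1 S' g in simp_all)
  next
    case 2
    define c' where "c' = a' + k - n"
    have c': "a' + k = c' + n" using 2 a'(1) by (simp add: c'_def)
    have S2: "S a' c'" "S (a' + j) c'" using S' unfolding c' by simp_all
    show ?thesis
    proof (rule that[of c' a' "a' + j"])
      show "u < c'" "c' < a'" "a' < a' + j" "a' + j \<le> u + n" using c' 2 j k by linarith+
      show "S c' a'" "S a' (a' + j)" "S c' (a' + j)" using S2 S'(1) S_symD by blast+
      show "Gm a b c = Gm c' a' (a' + j) \<or> Gm a b c = Gm a' (a' + j) c' \<or> Gm a b c = Gm (a' + j) c' a'"
        unfolding g c' by simp
    qed
  next
    case 3
    define b' where "b' = a' + j - n"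
    define c' where "c' = a' + k - n"
    have c': "a' + k = c' + n" "a' + j = b' + n" using 3 a'(1) k(2) by (simp_all add: c'_def b'_def)
    have S2: "S a' c'" "S b' c'" "S a' b'" using S' unfolding c' by simp_all
    show ?thesis
    proof (rule that[of b' c' a'])
      show "u < b'" "b' < c'" "c' < a'" "a' \<le> u + n" using c' 3 j k a'(2) by linarith+
      show "S b' c'" "S c' a'" "S b' a'" using S2 S_symD by blast+
      show "Gm a b c = Gm b' c' a' \<or> Gm a b c = Gm c' a' b' \<or> Gm a b c = Gm a' b' c'"
        unfolding g c' by simp
    qed
  qed
qed

text \<open>A cycle closing at the end of a path is carried to its start, where it counts as one
  more power of the central cycle.\<close>

lemma tau_central:
  assumes "walk D (Sd u (Suc u)) as v" "Cy v c" "c' \<approx> c"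
  shows "as @ c' \<approx> cw u (Suc u) @ as"
proof -
  have "Cy (Sd u (Suc u)) (cw u (Suc u))" by (rule Cy.intros) (use n3 S_Suc in auto)
  then have "cw u (Suc u) @ as \<approx> as @ c" using Cy_central assms(1,2) by blast
  moreover have "as @ c' \<approx> as @ c" using pcong_ctx[OF assms(3), of as "[]"] by simp
  ultimately show ?thesis using pc_sym pc_trans by blast
qed

text \<open>If z is not u + n, \<open>?A\<close> merely extends the turn about x, \<open>?C\<close>
  is \<open>turn_path\<close> about x, and \<open>?B\<close> closes the black face. If z = u + n,
  the turns are about u: \<open>?C\<close> extends, \<open>?B\<close> is \<open>turn_path\<close>,
  and \<open>?A\<close> closes the black face.\<close>

lemma nf_step_Gam:
  assumes l: "u < x" "x < y" "y < z" "z \<le> u + n" and S: "S x y" "S y z" "S x z"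
  shows "\<exists>k. side_nf u x y @ [Gm x y z] \<approx> pw u k @ side_nf u x z" (is ?A)
    and "\<exists>k. side_nf u y z @ [Gm y z x] \<approx> pw u k @ side_nf u x y" (is ?B)
    and "\<exists>k. side_nf u x z @ [Gm z x y] \<approx> pw u k @ side_nf u y z" (is ?C)
proof -
  have zx: "z < x + n" using l by simp
  have k0: "\<exists>k. L \<approx> pw u k @ L'" if "L \<approx> L'" for L L'
    by (rule exI[of _ 0]) (use that in \<open>simp add: pw_def\<close>)
  have k1: "\<exists>k. L \<approx> pw u k @ L'" if "L \<approx> cw u (Suc u) @ L'" for L L'
    by (rule exI[of _ 1]) (use that in \<open>simp add: pw_def\<close>)
  have yn: "y \<noteq> u + n" using l by simp
  have w: "walk D (Sd u (Suc u)) (side_nf u x y) (Sd x y)" "walk D (Sd u (Suc u)) (side_nf u x z) (Sd x z)"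
    by (rule walk_nf, rule nf_side, use l S in simp_all)+
  have px: "piv x (Suc x) z = piv x (Suc x) y @ [Gm x y z]"
    unfolding piv_triangle[OF l(2,3) zx S, symmetric] using l by (simp add: piv_append)
  have T: "piv x (Suc x) z @ [Gm z x y] \<approx> bd x (Suc y) @ piv y (Suc y) z"
    by (rule turn_path[OF l(2,3) zx S])
  show ?C ?A ?B
  proof -
    have "\<exists>k. side_nf u x z @ [Gm z x y] \<approx> pw u k @ side_nf u y z"
      "\<exists>k. side_nf u x y @ [Gm x y z] \<approx> pw u k @ side_nf u x z"
      "\<exists>k. side_nf u y z @ [Gm y z x] \<approx> pw u k @ side_nf u x y" if z: "z \<noteq> u + n"
    proof -
      have C: "side_nf u x z @ [Gm z x y] \<approx> side_nf u y z"
      proof -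
        have "bd u (Suc x) @ piv x (Suc x) z @ [Gm z x y] \<approx> bd u (Suc x) @ bd x (Suc y) @ piv y (Suc y) z"
          using pcong_ctx[OF T, of "bd u (Suc x)" "[]"] by simp
        also have "bd u (Suc x) @ bd x (Suc y) @ piv y (Suc y) z = bd u (Suc y) @ piv y (Suc y) z"
          using bd_extend[of x y u] l by simp
        finally show ?thesis using z by (simp add: side_nf_def)
      qed
      then show "\<exists>k. side_nf u x z @ [Gm z x y] \<approx> pw u k @ side_nf u y z" by (rule k0)
      show "\<exists>k. side_nf u x y @ [Gm x y z] \<approx> pw u k @ side_nf u x z"
        by (rule k0) (use px z yn in \<open>simp add: side_nf_def pc_refl\<close>)
      \<comment> \<open>Undoing the rewriting \<open>C\<close> exposes the other two arrows of the
        triangle, so that the appended arrow closes its black face.\<close>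
      have "side_nf u y z @ [Gm y z x] \<approx> (side_nf u x z @ [Gm z x y]) @ [Gm y z x]"
        by (rule pcong_append[OF pc_sym[OF C] pc_refl])
      also have "\<dots> = side_nf u x y @ [Gm x y z, Gm z x y, Gm y z x]"
        using px z yn by (simp add: side_nf_def)
      also have "\<dots> \<approx> cw u (Suc u) @ side_nf u x y"
        by (rule tau_central[OF w(1) _ black_cycle[OF l(2,3) zx S]]) (rule Cy.intros, use l zx S in simp_all)
      finally show "\<exists>k. side_nf u y z @ [Gm y z x] \<approx> pw u k @ side_nf u x y" by (rule k1)
    qed
    moreover have "\<exists>k. side_nf u x z @ [Gm z x y] \<approx> pw u k @ side_nf u y z"
      "\<exists>k. side_nf u x y @ [Gm x y z] \<approx> pw u k @ side_nf u x z"
      "\<exists>k. side_nf u y z @ [Gm y z x] \<approx> pw u k @ side_nf u x y" if z: "z = u + n"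
    proof -
      \<comment> \<open>Here z is the polygon vertex u, so x and y are neighbours of u and
        \<open>Gm z x y\<close> turns about u.\<close>
      have Su: "S u x" "S u y" using S(2,3)[THEN S_symD] unfolding z by simp_all
      have l': "y < u + n" using l(3) z by simp
      have pu: "piv u (Suc u) y = piv u (Suc u) x @ [Gm z x y]"
      proof -
        have "piv u x y = [Gm z x y]"
          using piv_triangle[OF l(1,2) l' Su(1) S(1) Su(2)] unfolding z by simp
        then show ?thesis using piv_append[of "Suc u" x y u] l by simp
      qed
      show "\<exists>k. side_nf u x z @ [Gm z x y] \<approx> pw u k @ side_nf u y z"
        by (rule k0) (simp add: side_nf_def z pc_refl pu[unfolded z])
      have B: "side_nf u y z @ [Gm y z x] \<approx> side_nf u x y"
        using turn_path[OF l(1,2) l' Su(1) S(1) Su(2)] yn by (simp add: side_nf_def z)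
      then show "\<exists>k. side_nf u y z @ [Gm y z x] \<approx> pw u k @ side_nf u x y" by (rule k0)
      have "side_nf u x y @ [Gm x y z] \<approx> (side_nf u y z @ [Gm y z x]) @ [Gm x y z]"
        by (rule pcong_append[OF pc_sym[OF B] pc_refl])
      also have "\<dots> = side_nf u x z @ [Gm z x y, Gm y z x, Gm x y z]"
        using pu by (simp add: side_nf_def z)
      also have "\<dots> \<approx> cw u (Suc u) @ side_nf u x z"
      proof (rule tau_central[OF w(2)])
        show "[Gm z x y, Gm y z x, Gm x y z] \<approx> cw u x"
          using black_cycle[OF l(1,2) l' Su(1) S(1) Su(2)] unfolding z by simp
        have "Cy (Sd u x) (cw u x)" by (rule Cy.intros) (use l l' Su in simp_all)
        then show "Cy (Sd x z) (cw u x)" unfolding z by (simp add: insert_commute)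
      qed
      finally show "\<exists>k. side_nf u x y @ [Gm x y z] \<approx> pw u k @ side_nf u x z" by (rule k1)
    qed
    ultimately show ?C ?A ?B by blast+
  qed
qed


lemma nf_step:
  assumes \<alpha>: "\<alpha> \<in> dA D" and L: "nf u (dsrc D \<alpha>) L"
  shows "\<exists>L' k. nf u (dtgt D \<alpha>) L' \<and> L @ [\<alpha>] \<approx> pw u k @ L'"
  using \<alpha>
proof (cases rule: arrow_cases)
  case (Gam a b c)
  obtain x y z where xyz: "u < x" "x < y" "y < z" "z \<le> u + n" "S x y" "S y z" "S x z"
    "Gm a b c = Gm x y z \<or> Gm a b c = Gm y z x \<or> Gm a b c = Gm z x y"
    by (rule triangle_window[OF Gam(2-7)])
  note st = nf_step_Gam[OF xyz(1-7)]
  have nfs: "nf u (Sd x y) (side_nf u x y)" "nf u (Sd y x) (side_nf u x y)"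
    "nf u (Sd y z) (side_nf u y z)" "nf u (Sd z y) (side_nf u y z)"
    "nf u (Sd x z) (side_nf u x z)" "nf u (Sd z x) (side_nf u x z)"
    using nf_side[of u x y] nf_side[of u y z] nf_side[of u x z] xyz by (simp_all add: insert_commute)
  from xyz(8) consider "\<alpha> = Gm x y z" | "\<alpha> = Gm y z x" | "\<alpha> = Gm z x y" using Gam(1) by blast
  then show ?thesis
  proof cases
    case 1
    then have "L = side_nf u x y" using nf_unique[OF L, of "side_nf u x y"] nfs by simp
    then show ?thesis using st(1) nfs(5) unfolding 1 D_simps by blast
  next
    case 2
    then have "L = side_nf u y z" using nf_unique[OF L, of "side_nf u y z"] nfs by simp
    then show ?thesis using st(2) nfs(2) unfolding 2 D_simps by blast
  next
    case 3
    then have "L = side_nf u x z" using nf_unique[OF L, of "side_nf u x z"] nfs by simp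
    then show ?thesis using st(3) nfs(4) unfolding 3 D_simps by blast
  qed
next
  case (Alpha j0)
  obtain j where j: "u < j" "j \<le> u + n" "j mod n = j0 mod n" by (rule window_label)
  have \<alpha>: "\<alpha> = Al j" using Alpha j by simp
  have L': "L = corner_nf u j" using nf_unique[OF L nf_corner[OF j(1,2), folded D_simps(3), folded \<alpha>]] .
  consider "j = u + n" | "Suc j = u + n" | "Suc j < u + n" using j by linarith
  then show ?thesis
  proof cases
    \<comment> \<open>The arrow leaves the corner u itself: the path has run through the whole white
      face at u and is back at the start, one full cycle with empty remainder.\<close>
    case 1
    have "S (Suc u) (u + n)" using S_Suc[of u] S_symD by simp
    then have "nf u (Sd (Suc u) (u + n)) (side_nf u (Suc u) (u + n))"
      by (intro nf_side) (use n3 in simp_all)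
    moreover have "Sd (Suc u) (u + n) = dtgt D \<alpha>"
      using mod_Suc_eq[of "u + n" n] mod_Suc_eq[of u n] unfolding \<alpha> 1 D_simps by (simp add: insert_commute)
    moreover have "L @ [\<alpha>] = pw u 1 @ side_nf u (Suc u) (u + n)"
      unfolding L' \<alpha> 1 by (simp add: corner_nf_def side_nf_def pw_def cw_def)
    ultimately show ?thesis by (metis pc_refl)
  next
    \<comment> \<open>The boundary path now arrives at the last edge, which contains u and has a
      normal form turning about u. By \<open>side_path\<close> for the side {u + 1, u + n} the path
      becomes the white face at u + 1 followed by that turn.\<close>
    case 2
    have nf: "nf u (dtgt D \<alpha>) (side_nf u j (Suc j))"
      unfolding \<alpha> D_simps by (rule nf_side) (use j 2 S_Suc[of j] in simp_all)
    have S1: "S (Suc u) (u + n)" using S_Suc[of u] S_symD by simp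
    have cw1: "cw (Suc u) (u + n) = [Be (Suc u), Al (Suc u)] @ piv (Suc u) (Suc (Suc u)) (u + n)"
      by (simp add: cw_def)
    have cyu: "Cy (Sd (Suc u) (u + n)) (cw (Suc u) (u + n))" "Cy (Sd u (Suc u)) (cw u (Suc u))"
      by (rule Cy.intros; use n3 S1 S_Suc in simp)+
    have "L @ [\<alpha>] = bd u (Suc j)"
    proof -
      have "j \<noteq> u + n" using 2 by simp
      then show ?thesis unfolding L' \<alpha> corner_nf_def bd_Suc[OF j(1)] by simp
    qed
    also have "bd u (Suc j) = [Be (Suc u), Al (Suc u)] @ bd (Suc u) (u + n)"
      using bd_append[of u "Suc u" "u + n"] 2 n3 by simp
    also have "\<dots> \<approx> [Be (Suc u), Al (Suc u)] @ (piv (Suc u) (Suc (Suc u)) (u + n) @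
        piv (u + n) (Suc u + n) (u + n + n - 1))"
      by (intro pcong_append[OF pc_refl] pc_sym[OF side_path]) (use n3 S1 in simp_all)
    also have "\<dots> = cw (Suc u) (u + n) @ piv u (Suc u) (u + n - 1)"
    proof -
      have "u + n + n - 1 = u + n - 1 + n" using n3 by simp
      then show ?thesis unfolding cw1 by (simp only: piv_add piv_center_add append_assoc)
    qed
    also have "\<dots> \<approx> cw u (Suc u) @ piv u (Suc u) (u + n - 1)"
    proof (rule pcong_append[OF _ pc_refl])
      have "Sd (Suc u) (u + n) = Sd u (Suc u)" by (simp add: insert_commute)
      then show "cw (Suc u) (u + n) \<approx> cw u (Suc u)" using Cy_unique cyu by metis
    qed
    also have "\<dots> = pw u 1 @ side_nf u j (Suc j)"
    proof -
      have "u + n - 1 = j" using 2 by simp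
      then show ?thesis using 2 by (simp add: pw_def side_nf_def)
    qed
    finally show ?thesis using nf by blast
  next
    case 3
    have "nf u (dtgt D \<alpha>) (side_nf u j (Suc j))"
      unfolding \<alpha> D_simps by (rule nf_side) (use j 3 S_Suc in simp_all)
    moreover have "L @ [\<alpha>] = pw u 0 @ side_nf u j (Suc j)"
      using 3 j unfolding L' \<alpha> by (simp add: corner_nf_def side_nf_def bd_Suc pw_def)
    ultimately show ?thesis by (metis pc_refl)
  qed
next
  case (Beta j0)
  obtain j where j: "u < j" "j \<le> u + n" "j mod n = j0 mod n" by (rule window_label)
  have \<alpha>: "\<alpha> = Be j" using Beta j by simp
  have nf: "nf u (dtgt D \<alpha>) (corner_nf u j)"
    unfolding \<alpha> D_simps by (rule nf_corner[OF j(1,2)])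
  obtain i where i: "j = Suc i" using j(1) by (cases j) auto
  have src: "dsrc D \<alpha> = Sd i (Suc i)" unfolding \<alpha> i by simp
  \<comment> \<open>An equality of lists, by the choice of \<open>corner_nf\<close>; the case split
    only finds the window labels of the edge {i, i + 1}.\<close>
  have "L @ [\<alpha>] = pw u 0 @ corner_nf u j"
  proof (cases "i = u")
    case True
    have "S (Suc u) (u + n)" using S_Suc[of u] S_symD by simp
    then have "nf u (Sd (Suc u) (u + n)) (side_nf u (Suc u) (u + n))"
      by (intro nf_side) (use n3 in simp_all)
    then have "nf u (dsrc D \<alpha>) (side_nf u (Suc u) (u + n))" unfolding src True by (simp add: insert_commute)
    then have "L = side_nf u (Suc u) (u + n)" by (rule nf_unique[OF L])
    then show ?thesis using n3 unfolding \<alpha> i True by (simp add: side_nf_def corner_nf_def pw_def)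
  next
    case False
    have "nf u (dsrc D \<alpha>) (side_nf u i (Suc i))"
      unfolding src by (rule nf_side) (use j i False S_Suc in simp_all)
    then have L': "L = side_nf u i (Suc i)" by (rule nf_unique[OF L])
    show ?thesis
    proof (cases "j = u + n")
      case True
      then have "i = u + n - 1" using i by simp
      then show ?thesis using True i unfolding L' \<alpha> by (simp add: side_nf_def corner_nf_def pw_def)
    next
      case F: False
      then show ?thesis using i unfolding L' \<alpha> by (simp add: side_nf_def corner_nf_def pw_def)
    qed
  qed
  then show ?thesis using nf by (metis pc_refl)
qed

lemma pw_append: "pw u k @ pw u l = pw u (k + l)"
  by (simp add: pw_def replicate_add)

lemma normal_form:
  assumes "walk D (Sd u (Suc u)) as v"
  shows "\<exists>L k. nf u v L \<and> as \<approx> pw u k @ L"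
  using assms
proof (induction as arbitrary: v rule: rev_induct)
  case Nil
  have "S (Suc u) (u + n)" using S_Suc[of u] S_symD by simp
  then have "nf u (Sd (Suc u) (u + n)) (side_nf u (Suc u) (u + n))"
    by (intro nf_side) (use n3 in simp_all)
  moreover have "v = Sd (Suc u) (u + n)" using Nil by (auto simp: insert_commute)
  moreover have "side_nf u (Suc u) (u + n) = []" by (simp add: side_nf_def)
  ultimately show ?case by (metis append_Nil pc_refl concat.simps(1) pw_def replicate_0)
next
  case (snoc \<alpha> as)
  then have \<alpha>: "\<alpha> \<in> dA D" "dtgt D \<alpha> = v" and "walk D (Sd u (Suc u)) as (dsrc D \<alpha>)"
    by (auto simp: walk_append)
  then obtain L k where L: "nf u (dsrc D \<alpha>) L" "as \<approx> pw u k @ L" using snoc.IH by blast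
  obtain L' l where L': "nf u v L'" "L @ [\<alpha>] \<approx> pw u l @ L'" using nf_step[OF \<alpha>(1) L(1)] \<alpha>(2) by blast
  have "as @ [\<alpha>] \<approx> pw u k @ L @ [\<alpha>]" using pcong_append[OF L(2) pc_refl, of "[\<alpha>]"] by simp
  also have "\<dots> \<approx> pw u k @ pw u l @ L'" by (rule pcong_append[OF pc_refl L'(2)])
  also have "\<dots> = pw u (k + l) @ L'" by (simp flip: pw_append)
  finally show ?case using L'(1) by blast
qed

section \<open>The dimer of a triangulation is graded and thin\<close>

lemma D_faces: "F \<in> dFp D \<union> dFm D \<Longrightarrow> 2 \<le> length F \<and> (\<exists>v. walk D v F v) \<and> sum_list (map wt F) = n"
proof (elim UnE)
  assume "F \<in> dFp D"
  then obtain a where a: "a < n" "F = white_face n T a" unfolding gl2_dimer_def by auto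
  then have F: "F = Al a # piv a (Suc a) (a + n - 1) @ [Be a]" using white_face_mod[of a] by simp
  have "walk D (Sd a (Suc a)) (piv a (Suc a) (a + n - 1)) (Sd a (a + n - 1)) \<and>
      sum_list (map wt (piv a (Suc a) (a + n - 1))) = a + n - 1 - Suc a"
    by (rule walk_piv) (use n3 S_pred S_Suc in auto)
  moreover have "walk D (Sd a (a + n - 1)) [Be a] (Cn a)" using n3 S_pred by (simp add: src_Be')
  ultimately have "walk D (Cn a) F (Cn a)" "sum_list (map wt F) = n"
    unfolding F using n3 by (auto simp: walk_append)
  then show ?thesis unfolding F by auto
next
  assume "F \<in> dFm D"
  then obtain a b c where F: "F = [Gam a b c, Gam c a b, Gam b c a]" and l: "a < b" "b < c"
    and t: "{a, b, c} \<in> triangles n T" unfolding gl2_dimer_def by auto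
  have lt: "a < n" "b < n" "c < n"
    using triangle_pairs(2)[OF t, of a b] triangle_pairs(2)[OF t, of b a] triangle_pairs(2)[OF t, of c a] l
    by simp_all
  have m: "a mod n = a" "b mod n = b" "c mod n = c" using lt by simp_all
  have S: "S a b" "S b c" "S a c" unfolding S_def m
    using triangle_pairs(1)[OF t, of a b] triangle_pairs(1)[OF t, of b c] triangle_pairs(1)[OF t, of a c] l
    by simp_all
  have G: "Gm a b c \<in> dA D" "Gm c (a + n) (b + n) \<in> dA D" "Gm b c (a + n) \<in> dA D"
    by (rule Gm_dA; use l lt S S[THEN S_symD] in simp)+
  have F': "F = [Gm a b c, Gm c a b, Gm b c a]" unfolding F m ..
  have "walk D (Sd a b) F (Sd a b)"
    using G S S[THEN S_symD] unfolding F' by (simp add: insert_commute)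
  moreover have "rk n b c = c - b" "rk n a b = b - a" "rk n c a = a + n - c"
    using rk_lift[of b c] rk_lift[of a b] rk_lift[of c "a + n"] l lt m by simp_all
  then have "sum_list (map wt F) = n" unfolding F using l lt by simp
  ultimately show ?thesis unfolding F by auto
qed

sublocale graded_dimer D wt n
proof
  have "sides n T \<subseteq> Pow {..<n}"
    using triangulation n3 unfolding sides_def triangulation_def is_diagonal_def by fastforce
  then have "finite (sides n T)" by (rule finite_subset) simp
  moreover have "dV D = Corner ` {..<n} \<union> Side ` sides n T" by (auto simp: gl2_dimer_def)
  ultimately show "finite (dV D)" by simp
  show "dtgt D ` dA D \<subseteq> dV D"
  proof (rule image_subsetI)
    fix \<alpha> assume "\<alpha> \<in> dA D"
    then show "dtgt D \<alpha> \<in> dV D"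
      by (cases rule: arrow_cases) (use n3 S_Suc in simp_all)
  qed
qed (rule D_faces)

text \<open>\<open>Alpha\<close> and \<open>Beta\<close> arrows lie on one white face and on no
  black face, while every \<open>Gam\<close> arrow lies on a white and a black face. These two faces
  differ because black faces contain no \<open>Alpha\<close> arrow.\<close>

lemma D_boundary: "boundary_vertices D = Corner ` {..<n} \<union> (\<lambda>i. Side {i, Suc i mod n}) ` {..<n}"
proof -
  have white: "Alpha i \<in> set (white_face n T v) \<longleftrightarrow> i = v" "Beta i \<in> set (white_face n T v) \<longleftrightarrow> i = v" for i v
    unfolding white_face_def by auto
  have one: "card {F \<in> dFp D \<union> dFm D. \<alpha> \<in> set F} = 1" if "\<alpha> = Alpha i \<or> \<alpha> = Beta i" "i < n" for \<alpha> i
  proof -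
    have "{F \<in> dFp D \<union> dFm D. \<alpha> \<in> set F} = {white_face n T i}"
      using that white by (auto simp: gl2_dimer_def)
    then show ?thesis by simp
  qed
  have two: "card {F \<in> dFp D \<union> dFm D. \<alpha> \<in> set F} \<noteq> 1" if h: "\<alpha> = Gm a b c" "a < b" "b < c" "c < a + n"
    "S a b" "S b c" "S a c" for \<alpha> a b c
  proof
    assume "card {F \<in> dFp D \<union> dFm D. \<alpha> \<in> set F} = 1"
    then obtain F where F: "{F \<in> dFp D \<union> dFm D. \<alpha> \<in> set F} = {F}" by (auto simp: card_1_singleton_iff)
    obtain us vs where b: "us @ Gm a b c # vs \<in> dFm D" using black_face[OF h(2-7)] by blast
    have "piv a (Suc a) (a + n - 1) = piv a (Suc a) b @ [Gm a b c] @ piv a c (a + n - 1)"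
      unfolding piv_triangle[OF h(2-7), symmetric] using h by (simp add: piv_append)
    then have "\<alpha> \<in> set (Al a # piv a (Suc a) (a + n - 1) @ [Be a])" using h(1) by simp
    then have "Al a # piv a (Suc a) (a + n - 1) @ [Be a] \<in> {F}"
      unfolding F[symmetric] using white_in_dFp[of a] by blast
    moreover have "us @ Gm a b c # vs \<in> {F}" unfolding F[symmetric] using b h(1) by simp
    ultimately have "Al a # piv a (Suc a) (a + n - 1) @ [Be a] \<in> dFm D" using b by simp
    then show False unfolding gl2_dimer_def by auto
  qed
  have Al_ends: "dsrc D (Alpha i) = Corner i" "dtgt D (Alpha i) = Side {i, Suc i mod n}" for i
    by (simp_all add: gl2_dimer_def gl2_src_def gl2_tgt_def)
  show ?thesis
  proof
    show "boundary_vertices D \<subseteq> Corner ` {..<n} \<union> (\<lambda>i. Side {i, Suc i mod n}) ` {..<n}"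
    proof
      fix v assume "v \<in> boundary_vertices D"
      then obtain \<alpha> where \<alpha>: "\<alpha> \<in> dA D" "dsrc D \<alpha> = v \<or> dtgt D \<alpha> = v"
        "card {F \<in> dFp D \<union> dFm D. \<alpha> \<in> set F} = 1" unfolding boundary_vertices_def by blast
      have sd: "Sd i (Suc i) \<in> (\<lambda>i. Side {i, Suc i mod n}) ` {..<n}" for i
        using n3 mod_Suc_eq[of i n] by (intro image_eqI[of _ _ "i mod n"]) auto
      have cn: "Cn i \<in> Corner ` {..<n}" for i using n3 by simp
      from \<alpha>(1) show "v \<in> Corner ` {..<n} \<union> (\<lambda>i. Side {i, Suc i mod n}) ` {..<n}"
      proof (cases rule: arrow_cases)
        case (Gam a b c)
        with two \<alpha>(3) show ?thesis by blast
      next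
        case (Alpha j)
        show ?thesis using \<alpha>(2) sd[of j] cn[of j] unfolding Alpha D_simps by blast
      next
        case (Beta j)
        obtain i where i: "Suc i = j + n" "j + n - 1 = i" by (rule pred_label)
        have "Be j = Be (Suc i)" unfolding i by simp
        then have "dsrc D \<alpha> = Sd i (Suc i)" using Beta by simp
        then show ?thesis using \<alpha>(2) sd[of i] cn[of j] unfolding Beta D_simps by auto
      qed
    qed
    show "Corner ` {..<n} \<union> (\<lambda>i. Side {i, Suc i mod n}) ` {..<n} \<subseteq> boundary_vertices D"
    proof
      fix v assume "v \<in> Corner ` {..<n} \<union> (\<lambda>i. Side {i, Suc i mod n}) ` {..<n}"
      then obtain i where i: "i < n" "v = Corner i \<or> v = Side {i, Suc i mod n}" by blast
      have a: "Alpha i \<in> dA D" using i(1) by simp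
      have "S i (Suc i)" by (rule S_Suc)
      then have "Side {i, Suc i mod n} \<in> dV D" using Sd_dV[of i "Suc i"] i(1) by simp
      then have "v \<in> dV D" using i by auto
      moreover have "dsrc D (Alpha i) = v \<or> dtgt D (Alpha i) = v" unfolding Al_ends using i(2) by auto
      ultimately show "v \<in> boundary_vertices D"
        unfolding boundary_vertices_def using a one[of "Alpha i" i] i(1) by blast
    qed
  qed
qed

lemma boundary_cases:
  assumes "v \<in> boundary_vertices D"
  obtains i where "v = Cn i" | i where "v = Sd i (Suc i)"
proof -
  obtain i where i: "i < n" "v = Corner i \<or> v = Side {i, Suc i mod n}"
    using assms unfolding D_boundary by blast
  then have "v = Cn i \<or> v = Sd i (Suc i)" by auto
  then show ?thesis using that by blast
qed

text \<open>The end fixes the normal form, and then the weight fixes the exponent of the central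
  cycle, which has weight n > 0.\<close>

lemma thin_side:
  assumes "walk D (Sd u (Suc u)) as v" "walk D (Sd u (Suc u)) bs v"
    "sum_list (map wt as) = sum_list (map wt bs)"
  shows "as \<approx> bs"
proof -
  obtain L k where L: "nf u v L" "as \<approx> pw u k @ L" using normal_form[OF assms(1)] by blast
  obtain L' l where L': "nf u v L'" "bs \<approx> pw u l @ L'" using normal_form[OF assms(2)] by blast
  have "L = L'" by (rule nf_unique[OF L(1) L'(1)])
  moreover have "sum_list (map wt as) = k * n + sum_list (map wt L)"
    using pcong_walk[OF L(2)] walk_pw[of u k] by simp
  moreover have "sum_list (map wt bs) = l * n + sum_list (map wt L')"
    using pcong_walk[OF L'(2)] walk_pw[of u l] by simp
  ultimately have "k = l" using assms(3) n3 by simp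
  with L(2) L'(2) \<open>L = L'\<close> show ?thesis using pc_sym pc_trans by blast
qed

text \<open>\<open>Al u\<close> is the only arrow leaving the corner u, which reduces starts at
  corners to starts at polygon edges.\<close>

lemma Cn_walk:
  "walk D (Cn u) as v \<longleftrightarrow> as = [] \<and> v = Cn u \<or> (\<exists>bs. as = Al u # bs \<and> walk D (Sd u (Suc u)) bs v)"
proof (cases as)
  case Nil
  then show ?thesis using n3 by auto
next
  case (Cons \<alpha> bs)
  have "\<alpha> = Al u" if "\<alpha> \<in> dA D" "dsrc D \<alpha> = Cn u"
    using that(1)
  proof (cases rule: arrow_cases)
    case (Beta j)
    then show ?thesis using that(2) src_Be'[of j] by simp
  qed (use that(2) in simp_all)
  then show ?thesis using Cons n3 by auto
qed

sublocale thin_dimer D wt n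
proof
  fix s t as bs
  assume s: "s \<in> boundary_vertices D" and w: "walk D s as t" "walk D s bs t"
    and e: "sum_list (map wt as) = sum_list (map wt bs)"
  from s show "as \<approx> bs"
  proof (cases rule: boundary_cases)
    case (1 i)
    show ?thesis
    proof (cases as)
      case Nil
      \<comment> \<open>A nonempty path from a corner begins with an arrow of weight 1, so weight 0
        leaves only the trivial path.\<close>
      then have "bs = []" using w(2) e unfolding 1 Cn_walk by auto
      then show ?thesis using Nil by (simp add: pc_refl)
    next
      case (Cons \<alpha> as')
      then have "bs \<noteq> []" using w(1) e unfolding 1 Cn_walk by auto
      then obtain bs' where "as = Al i # as'" "walk D (Sd i (Suc i)) as' t"
        "bs = Al i # bs'" "walk D (Sd i (Suc i)) bs' t"
        using w Cons unfolding 1 Cn_walk by auto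
      then show ?thesis using thin_side[of i as' t bs'] e pcong_ctx[of D as' bs' "[Al i]" "[]"] by simp
    qed
  next
    case (2 i)
    then show ?thesis using thin_side w e by blast
  qed
qed

end

text \<open>The weights of the normal forms, written without reference to the triangulation.\<close>

definition side_deg :: "nat \<Rightarrow> nat \<Rightarrow> gl2_vertex \<Rightarrow> nat \<Rightarrow> bool" where
  "side_deg n u v m \<longleftrightarrow>
    (\<exists>p q. u < p \<and> p < q \<and> q \<le> u + n \<and> v = Side {p mod n, q mod n} \<and>
       m = (if q = u + n then p - Suc u else 2 * (p - u) + (q - Suc p))) \<or>
    (\<exists>j. u < j \<and> j \<le> u + n \<and> v = Corner (j mod n) \<and>
       m = (if j = u + n then n - 1 else 2 * (j - Suc u) + 1))"

section \<open>Weights of paths from boundary vertices\<close>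

context triangulated_polygon
begin

lemma nf_side_deg: "nf u v L \<Longrightarrow> side_deg n u v (sum_list (map wt L))"
proof (induction rule: nf.induct)
  case (nf_side p q)
  show ?case unfolding side_deg_def
    by (rule disjI1, intro exI[of _ p] exI[of _ q] conjI) (use nf_side wt_side_nf in simp_all)
next
  case (nf_corner j)
  show ?case unfolding side_deg_def
    by (rule disjI2, intro exI[of _ j] conjI) (use nf_corner wt_corner_nf in simp_all)
qed

lemma side_deg_nf:
  assumes "side_deg n u v m" "v \<in> dV D"
  shows "\<exists>L. nf u v L \<and> sum_list (map wt L) = m"
  using assms(1) unfolding side_deg_def
proof (elim disjE exE conjE)
  fix p q assume l: "u < p" "p < q" "q \<le> u + n" and v: "v = Side {p mod n, q mod n}"
    and m: "m = (if q = u + n then p - Suc u else 2 * (p - u) + (q - Suc p))"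
  \<comment> \<open>This is where the triangulation enters: \<open>side_deg\<close> admits every
    chord, and membership of v in \<open>dV D\<close> selects the sides.\<close>
  have S: "S p q" using assms(2) unfolding v by (simp only: Sd_dV)
  show ?thesis unfolding v m using nf_side[OF l S] wt_side_nf[OF l S] by blast
next
  fix j assume l: "u < j" "j \<le> u + n" and v: "v = Corner (j mod n)"
    and m: "m = (if j = u + n then n - 1 else 2 * (j - Suc u) + 1)"
  show ?thesis unfolding v m using nf_corner[OF l] wt_corner_nf[OF l] by blast
qed

text \<open>Powers of the central cycle add multiples of n to the weight of the normal form ending
  at v; the resulting set is expressed through n, u and v only.\<close>

lemma degs_side:
  assumes "v \<in> dV D"
  shows "degs (Sd u (Suc u)) v = {k * n + m | k m. side_deg n u v m}"
proof (intro Set.set_eqI iffI)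
  fix d assume "d \<in> degs (Sd u (Suc u)) v"
  then obtain as where as: "walk D (Sd u (Suc u)) as v" "d = sum_list (map wt as)"
    unfolding degs_def by blast
  obtain L k where L: "nf u v L" "as \<approx> pw u k @ L" using normal_form[OF as(1)] by blast
  have "d = k * n + sum_list (map wt L)" using pcong_walk[OF L(2)] walk_pw[of u k] as(2) by simp
  with nf_side_deg[OF L(1)] show "d \<in> {k * n + m | k m. side_deg n u v m}" by blast
next
  fix d assume "d \<in> {k * n + m | k m. side_deg n u v m}"
  then obtain k m where d: "d = k * n + m" "side_deg n u v m" by blast
  obtain L where L: "nf u v L" "sum_list (map wt L) = m" using side_deg_nf[OF d(2) assms] by blast
  have "walk D (Sd u (Suc u)) (pw u k @ L) v"
    unfolding walk_append using walk_pw[of u k] walk_nf[OF L(1)] by blast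
  moreover have "d = sum_list (map wt (pw u k @ L))" using walk_pw[of u k] L(2) d(1) by simp
  ultimately show "d \<in> degs (Sd u (Suc u)) v" unfolding degs_def by blast
qed

lemma degs_corner: "degs (Cn u) v = {d. d = 0 \<and> v = Cn u \<or> (\<exists>e \<in> degs (Sd u (Suc u)) v. d = Suc e)}"
proof (intro Set.set_eqI iffI)
  fix d assume "d \<in> degs (Cn u) v"
  then obtain as where as: "walk D (Cn u) as v" "d = sum_list (map wt as)" unfolding degs_def by blast
  from as(1)[unfolded Cn_walk] show "d \<in> {d. d = 0 \<and> v = Cn u \<or> (\<exists>e \<in> degs (Sd u (Suc u)) v. d = Suc e)}"
  proof (elim disjE exE conjE)
    fix bs assume b: "as = Al u # bs" "walk D (Sd u (Suc u)) bs v"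
    then have "sum_list (map wt bs) \<in> degs (Sd u (Suc u)) v" unfolding degs_def by blast
    moreover have "d = Suc (sum_list (map wt bs))" using as(2) b(1) by simp
    ultimately show ?thesis by blast
  qed (use as(2) in simp)
next
  fix d assume "d \<in> {d. d = 0 \<and> v = Cn u \<or> (\<exists>e \<in> degs (Sd u (Suc u)) v. d = Suc e)}"
  then consider "d = 0" "v = Cn u" | bs where "walk D (Sd u (Suc u)) bs v" "d = Suc (sum_list (map wt bs))"
    unfolding degs_def by blast
  then show "d \<in> degs (Cn u) v"
  proof cases
    case 1
    then have "walk D (Cn u) [] v" "d = sum_list (map wt [])" unfolding Cn_walk by simp_all
    then show ?thesis unfolding degs_def by blast
  next
    case 2
    then have "walk D (Cn u) (Al u # bs) v" "d = sum_list (map wt (Al u # bs))"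
      unfolding Cn_walk by simp_all
    then show ?thesis unfolding degs_def by blast
  qed
qed

end

theorem theorem3p9:
  fixes n :: nat and T F :: "nat set set"
  assumes "3 \<le> n"
    and "triangulation n T"
    and "fan_triangulation n F"
  shows "boundary_algebras_isomorphic (gl2_dimer n T) (gl2_dimer n F)"
proof -
  interpret T: triangulated_polygon n T using assms by unfold_locales
  interpret F: triangulated_polygon n F using assms by unfold_locales (simp_all add: fan_triangulation_def)
  show ?thesis
  proof (rule thin_dimers_isomorphic[OF T.thin_dimer_axioms F.thin_dimer_axioms])
    show bV: "boundary_vertices T.D = boundary_vertices F.D" by (simp only: T.D_boundary F.D_boundary)
    fix s t assume s: "s \<in> boundary_vertices T.D" and t: "t \<in> boundary_vertices T.D"
    \<comment> \<open>A boundary vertex t lies in both quivers, so \<open>degs_side\<close> applies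
      to both triangulations and yields the same set.\<close>
    have "t \<in> dV T.D" "t \<in> dV F.D" using t bV T.bV_dV F.bV_dV by auto
    with s show "T.degs s t = F.degs s t"
      by (cases rule: T.boundary_cases) (simp_all only: T.degs_corner F.degs_corner T.degs_side F.degs_side)
  qed
qed

end
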